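(* Let $K$ be a non-exploding compact metric space and let $d\in\mathbb{N}^+$. If $\mu$ is a continuous mass distribution on $K$, then for the prevalent $f\in C(K,\mathbb{R}^d)$ there is an open set $U_f\subset\mathbb{R}^d$ such that $\mu(f^{-1}(U_f))=\mu(K)$ and for all $y\in U_f$ we have $$\dim_H f^{-1}(y)\geq \dim_H\mu\quad\text{and}\quad \dim_P f^{-1}(y)\geq\dim_P\mu.$$
   Context: Prevalence: for an abelian Polish group $G$, a set $A\subset G$ is shy if there exist a Borel set $B\supset A$ in $G$ and a Borel probability measure $\nu$ on $G$ with $\nu(B+x)=0$ for all $x\in G$; complements of shy sets are prevalent. "For the prevalent $f\in G$ property $P$ holds" means that $\{f\in G: P(f)\}$ is prevalent. For a compact metric space $K$, $C(K,\mathbb{R}^d)$ is the Banach space of continuous maps $K\to\mathbb{R}^d$ with the maximum norm (regarded as an abelian Polish group under addition). Dimensions: $\dim_H$ is Hausdorff dimension, with $\dim_H\emptyset=-1$. For a non-empty totally bounded metric space $X$, $N_\delta(X)$ is the smallest number of closed balls of radius $\delta$ covering $X$, and $\overline{\dim}_B X=\limsup_{\delta\to0+}\log N_\delta(X)/\log(1/\delta)$; $\overline{\dim}_B\emptyset=-1$ and $\overline{\dim}_B X=\infty$ if $X$ is not totally bounded. The packing dimension is $\dim_P X=\inf\{\sup_i\overline{\dim}_B X_i: X=\bigcup_{i=1}^\infty X_i\}$ (so $\dim_P\emptyset=-1$). Measures: a mass distribution on a metric space $X$ is a Borel measure $\mu$ with $0<\mu(X)<\infty$; it is continuous if $\mu(\{x\})=0$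 for all $x\in X$. For a mass distribution $\mu$ on a compact metric space $K$, $\dim_H\mu=\inf\{\dim_H B: B\subset K\text{ Borel},\ \mu(B)>0\}$ and $\dim_P\mu=\inf\{\dim_P B: B\subset K\text{ Borel},\ \mu(B)>0\}$. Non-exploding: for a metric space $X$ and $r>0$ let $N(r)$ be the minimal number such that every closed ball $B(x,r)$ can be covered by $N(r)$ closed balls of radius $r/2$. $X$ is non-exploding if $\lim_{r\to0+}\frac{\log N(r)}{\log r}=0$. (For example, every subspace of $\mathbb{R}^m$ is non-exploding.) *)

theory Defs
  imports "HOL-Probability.Probability"
begin

section \<open>Covering by closed balls\<close>

text \<open>
  A subset \<open>X\<close> of a metric space is regarded as a metric space in its own right, so the balls
  used for covering have their centres in \<open>X\<close>.
\<close>

definition cball_coverable :: "'a::metric_space set \<Rightarrow> 'a set \<Rightarrow> real \<Rightarrow> nat \<Rightarrow> bool" where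
  "cball_coverable X A r n \<longleftrightarrow>
     (\<exists>C. C \<subseteq> X \<and> finite C \<and> card C \<le> n \<and> A \<subseteq> (\<Union>c\<in>C. cball c r))"

definition covering_number :: "real \<Rightarrow> 'a::metric_space set \<Rightarrow> nat" where
  "covering_number \<delta> X = (LEAST n. cball_coverable X X \<delta> n)"

definition halving_number :: "'a::metric_space set \<Rightarrow> real \<Rightarrow> nat" where
  "halving_number X r = (LEAST n. \<forall>x\<in>X. cball_coverable X (X \<inter> cball x r) (r / 2) n)"

text \<open>
  The first conjunct says that \<^term>\<open>halving_number X r\<close> is finite for small \<open>r\<close>; otherwise
  \<open>LEAST\<close> returns an arbitrary number. It always holds for totally bounded \<open>X\<close>.
\<close>

definition non_exploding :: "'a::metric_space set \<Rightarrow> bool" where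
  "non_exploding X \<longleftrightarrow>
     (\<forall>\<^sub>F r in at_right 0. \<exists>n. \<forall>x\<in>X. cball_coverable X (X \<inter> cball x r) (r / 2) n) \<and>
     ((\<lambda>r. ln (real (halving_number X r)) / ln r) \<longlongrightarrow> 0) (at_right 0)"


section \<open>Dimensions of sets\<close>

text \<open>
  In \<open>diam_pow\<close> the conventions are that the empty set contributes \<open>0\<close> and that \<open>0\<close> to the power
  \<open>0\<close> is \<open>1\<close> (whereas \<open>0 powr 0 = 0\<close> in the library). The library's \<^const>\<open>diameter\<close> is only
  meaningful for bounded sets, hence the boundedness requirement on the covering sets.
\<close>

definition diam_pow :: "real \<Rightarrow> 'a::metric_space set \<Rightarrow> ennreal" where
  "diam_pow s U =
     (if U = {} then 0 else if s = 0 then 1 else ennreal (diameter U powr s))"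

definition hausdorff_premeasure :: "real \<Rightarrow> real \<Rightarrow> 'a::metric_space set \<Rightarrow> ennreal" where
  "hausdorff_premeasure s \<delta> A =
     (INF U\<in>{U :: nat \<Rightarrow> 'a set. A \<subseteq> (\<Union>i. U i) \<and> (\<forall>i. bounded (U i) \<and> diameter (U i) \<le> \<delta>)}.
        \<Sum>i. diam_pow s (U i))"

definition hausdorff_measure :: "real \<Rightarrow> 'a::metric_space set \<Rightarrow> ennreal" where
  "hausdorff_measure s A = (SUP \<delta>\<in>{0<..}. hausdorff_premeasure s \<delta> A)"

definition hausdorff_dim :: "'a::metric_space set \<Rightarrow> ereal" where
  "hausdorff_dim A =
     (if A = {} then -1 else Inf {ereal s |s. 0 \<le> s \<and> hausdorff_measure s A = 0})"

definition upper_box_dim :: "'a::metric_space set \<Rightarrow> ereal" where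
  "upper_box_dim A =
     (if A = {} then -1
      else if \<not> totally_bounded A then \<infinity>
      else Limsup (at_right 0) (\<lambda>\<delta>. ereal (ln (real (covering_number \<delta> A)) / ln (1 / \<delta>))))"

definition packing_dim :: "'a::metric_space set \<Rightarrow> ereal" where
  "packing_dim A =
     (INF F\<in>{F :: nat \<Rightarrow> 'a set. A = (\<Union>i. F i)}. SUP i. upper_box_dim (F i))"


section \<open>Mass distributions\<close>

definition mass_distribution :: "'a::metric_space measure \<Rightarrow> bool" where
  "mass_distribution \<mu> \<longleftrightarrow>
     sets \<mu> = sets borel \<and> 0 < emeasure \<mu> (space \<mu>) \<and> emeasure \<mu> (space \<mu>) < \<infinity>"

definition continuous_mass_distribution :: "'a::metric_space measure \<Rightarrow> bool" where
  "continuous_mass_distribution \<mu> \<longleftrightarrow>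
     mass_distribution \<mu> \<and> (\<forall>x. emeasure \<mu> {x} = 0)"

definition hausdorff_dim_measure :: "'a::metric_space measure \<Rightarrow> ereal" where
  "hausdorff_dim_measure \<mu> = (INF B\<in>{B \<in> sets borel. 0 < emeasure \<mu> B}. hausdorff_dim B)"

definition packing_dim_measure :: "'a::metric_space measure \<Rightarrow> ereal" where
  "packing_dim_measure \<mu> = (INF B\<in>{B \<in> sets borel. 0 < emeasure \<mu> B}. packing_dim B)"


section \<open>Prevalence\<close>

text \<open>
  These notions are meant for Polish groups. Polishness is not part of the type class because the
  function space \<open>'k \<Rightarrow>\<^sub>C 'b\<close> is separable only for suitable \<open>'k\<close> (such as compact metric ones).
\<close>

definition shy :: "'g::topological_ab_group_add set \<Rightarrow> bool" where
  "shy A \<longleftrightarrow>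
     (\<exists>B \<nu>. B \<in> sets borel \<and> A \<subseteq> B \<and> prob_space \<nu> \<and> sets \<nu> = sets borel \<and>
        (\<forall>x. emeasure \<nu> ((\<lambda>b. b + x) ` B) = 0))"

definition prevalent :: "'g::topological_ab_group_add set \<Rightarrow> bool" where
  "prevalent A \<longleftrightarrow> shy (- A)"

end

theory Submission
  imports Defs
begin

text \<open>
  Fix \<open>d\<close> and a random map \<open>h = \<Sum>l. 2\<^sup>-\<^sup>l\<^sup>-\<^sup>1 h\<^sub>l\<close>, where \<open>h\<^sub>l\<close> takes independent values in
  \<open>{-1, 0, 1}\<^sup>d\<close> on disjoint closed cells of tiny mass that cover \<open>K\<close> up to mass \<open>2\<^sup>-\<^sup>l\<close>; the law of \<open>h\<close>
  witnesses prevalence. The tail of the series has a B-spline density on each cell, so for any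
  continuous \<open>g\<close>, any Borel set \<open>B\<close> and any point \<open>y\<close> the conditional density at \<open>y\<close> of the image under
  \<open>g + h\<close> of \<open>\<mu>\<close> restricted to \<open>B\<close>, given the first \<open>n\<close> levels, is a martingale. Its \<open>n\<close>-th increment is
  a sum of orthogonal terms, one for each cell, so its variance is at most the mass of the largest
  cell times a constant depending only on \<open>n\<close>, whatever \<open>g\<close> is. As the cells of level \<open>n\<close> may be chosen
  after any finite family of points and test sets, Chebyshev and Borel--Cantelli make the densities
  converge uniformly and as fast as we please.

  Where the limit density is positive (an open set whose preimage has full measure), the
  approximating densities on \<open>K\<close> are measures that concentrate on the fibre over \<open>y\<close> and give a ball
  of radius \<open>2\<^sup>-\<^sup>k\<close> at most \<open>2\<^sup>o\<^sup>(\<^sup>k\<^sup>)\<close> times its \<open>\<mu>\<close>-mass. The fibre thus inherits the local dimensions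
  of \<open>\<mu>\<close>: for the Hausdorff dimension by the mass distribution principle, for the packing dimension
  by Baire's theorem.
\<close>

section \<open>Dimension bounds from concentrating measures\<close>

text \<open>Prevalence asks for one law that works for all translates, so every estimate on
  \<open>h\<close> must hold for arbitrary continuous \<open>g\<close>. The variance bound qualifies
  because it uses only the height of the kernel and the masses of the cells. The tent is chosen for
  two properties. It has an exact two-scale relation, which turns the densities into an exact
  martingale, and it is Lipschitz, so finitely many points \<open>y\<close> control a whole ball of
  them. A uniform law refines as well, but its density jumps. On a connected space a continuous map
  that takes different constant values on cells needs gaps between them. The martingale property
  holds only for sets that avoid the gaps from some level on, whence the closed sets
  \<open>core i\<close>. These also make the local dimensions of mu, known almost everywhere,
  uniform enough to be used at every point. No limit measure on a fibre is constructed: both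
  dimension bounds are proved for a sequence of measures, with compactness reducing each question to
  finitely many balls and hence to a single index.\<close>

abbreviation decays :: "(nat \<Rightarrow> 'a::metric_space measure) \<Rightarrow> real \<Rightarrow> nat \<Rightarrow> 'a \<Rightarrow> bool" where
  "decays lam s k x \<equiv>
     \<forall>\<^sub>F m in sequentially. measure (lam m) (ball x ((1/2)^(k+2))) \<le> 2 powr (-(real k * s))"

text \<open>The mass distribution principle without a limit measure. Each covering set that meets
  \<open>F\<close> is enlarged to an open ball; compactness leaves finitely many balls, and their
  bounds, each valid eventually, hold together at one index. So the thresholds in
  \<open>decays\<close> may depend on the point and on the scale.\<close>

lemma hausdorff_dim_ge_concentrating:
  fixes F A :: "'a::metric_space set" and lam :: "nat \<Rightarrow> 'a measure"
  assumes F: "compact F" "F \<subseteq> A"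
    and fin: "\<And>m. finite_measure (lam m)" and sets: "\<And>m. sets (lam m) = sets borel"
    and conc: "\<And>V. open V \<Longrightarrow> F \<subseteq> V \<Longrightarrow> \<forall>\<^sub>F m in sequentially. measure (lam m) (- V) = 0"
    and mass: "c > 0" "\<forall>\<^sub>F m in sequentially. c \<le> measure (lam m) UNIV"
    and small: "\<And>s. 0 < s \<Longrightarrow> s < t \<Longrightarrow>
      \<exists>k0. \<forall>k\<ge>k0. \<forall>x\<in>F. decays lam s k x"
  shows "ereal t \<le> hausdorff_dim A"
proof -
  have Fne: "F \<noteq> {}"
  proof
    assume "F = {}"
    then have "\<forall>\<^sub>F m in sequentially. measure (lam m) (- {}) = 0"
      using conc[of "{}"] by simp
    with mass(2) have "\<forall>\<^sub>F m in sequentially. False"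
      by eventually_elim (use mass(1) in auto)
    then show False by simp
  qed
  have "t \<le> s" if s: "0 \<le> s" and H0: "hausdorff_measure s A = 0" for s
  proof (rule ccontr)
    assume "\<not> t \<le> s"
    \<comment> \<open>The midpoint is positive even when \<open>s = 0\<close>, as
      \<open>small\<close> requires; since all diameters are at most 1, their
      \<open>s'\<close>-powers are at most their \<open>s\<close>-powers.\<close>
    define s' where "s' = (s + t) / 2"
    have s': "s < s'" "0 < s'" "s' < t" using s \<open>\<not> t \<le> s\<close> by (auto simp: s'_def)
    obtain k0 where k0: "\<And>k x. k \<ge> k0 \<Longrightarrow> x \<in> F \<Longrightarrow>
        decays lam s' k x"
      using small[OF s'(2,3)] by blast
    define \<delta> where "\<delta> = (1/2::real)^(k0+3)"
    have \<delta>: "0 < \<delta>" "\<delta> \<le> 1" by (auto simp: \<delta>_def power_le_one)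
    \<comment> \<open>The factor \<open>8 powr s'\<close> pays for rounding a size at least
      \<open>2^-(k+3)\<close> to the bound at scale \<open>k\<close>. With the 4, the total
      \<open>8 powr s' * 2 * \<epsilon>\<close> is only \<open>c / 2\<close>.\<close>
    define \<epsilon> where "\<epsilon> = c / (4 * 8 powr s')"
    have \<epsilon>: "\<epsilon> > 0" using mass(1) by (simp add: \<epsilon>_def)
    have "hausdorff_premeasure s \<delta> A \<le> hausdorff_measure s A"
      unfolding hausdorff_measure_def using \<delta> by (intro SUP_upper) auto
    then have "hausdorff_premeasure s \<delta> A < ennreal \<epsilon>" using H0 \<epsilon> by simp
    then obtain U where U: "A \<subseteq> (\<Union>i::nat. U i)" "\<And>i. bounded (U i)" "\<And>i. diameter (U i) \<le> \<delta>"
      and Usum: "(\<Sum>i. diam_pow s (U i)) < ennreal \<epsilon>"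
      unfolding hausdorff_premeasure_def INF_less_iff by auto
    define w where "w i = (if U i = {} then 0 else if s = 0 then 1 else diameter (U i) powr s)" for i
    have w: "diam_pow s (U i) = ennreal (w i)" "w i \<ge> 0" for i
      by (auto simp: diam_pow_def w_def)
    \<comment> \<open>Covering sets may have diameter 0 and then fit no dyadic scale. They are
      padded to positive size \<open>\<sigma> i\<close>, and the \<open>s'\<close>-powers of the
      padding sum to at most \<open>\<epsilon>\<close>.\<close>
    define \<sigma> where "\<sigma> i = min \<delta> ((\<epsilon> * (1/2)^(i+1)) powr (1/s'))" for i :: nat
    define e where "e i = max (diameter (U i)) (\<sigma> i)" for i
    have \<sigma>: "0 < \<sigma> i" "\<sigma> i powr s' \<le> \<epsilon> * (1/2)^(i+1)" for i
    proof -
      show *: "0 < \<sigma> i" using \<delta> \<epsilon> by (auto simp: \<sigma>_def)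
      have "\<sigma> i powr s' \<le> ((\<epsilon> * (1/2)^(i+1)) powr (1/s')) powr s'"
        using * s' by (intro powr_mono2) (auto simp: \<sigma>_def)
      also have "\<dots> = \<epsilon> * (1/2)^(i+1)" using s' \<epsilon> by (simp add: powr_powr)
      finally show "\<sigma> i powr s' \<le> \<epsilon> * (1/2)^(i+1)" .
    qed
    have "\<sigma> i \<le> \<delta>" for i by (simp add: \<sigma>_def)
    then have e: "0 < e i" "e i \<le> \<delta>" "diameter (U i) \<le> e i" for i
      using \<sigma>(1)[of i] U(3)[of i] by (auto simp: e_def less_max_iff_disj)
    have ex_k: "\<exists>k\<ge>k0. (1/2::real)^(k+3) \<le> e i \<and> e i < (1/2)^(k+2)" for i
    proof -
      obtain n where n: "(1/2::real)^n < e i" using real_arch_pow_inv[of "e i" "1/2"] e by auto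
      define k where "k = (LEAST k. (1/2::real)^(k+3) \<le> e i)"
      have "(1/2::real)^(n+3) \<le> (1/2)^n" by (intro power_decreasing) auto
      then have ex: "\<exists>k. (1/2::real)^(k+3) \<le> e i" using n by (intro exI[of _ n]) linarith
      have k1: "(1/2::real)^(k+3) \<le> e i" unfolding k_def by (rule LeastI_ex[OF ex])
      have "k \<ge> k0"
      proof (rule ccontr)
        assume "\<not> k \<ge> k0"
        then have "(1/2::real)^(k0+3) < (1/2)^(k+3)" by (intro power_strict_decreasing) auto
        then show False using k1 e(2)[of i] unfolding \<delta>_def by linarith
      qed
      moreover have "e i < (1/2)^(k+2)"
      proof (cases k)
        case 0
        then show ?thesis using e(2)[of i] \<open>k \<ge> k0\<close> by (auto simp: \<delta>_def power3_eq_cube power2_eq_square)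
      next
        case (Suc j)
        have "\<not> (1/2::real)^(j+3) \<le> e i"
          by (rule not_less_Least) (use Suc k_def in simp)
        then show ?thesis using Suc by (simp add: eval_nat_numeral)
      qed
      ultimately show ?thesis using k1 by blast
    qed
    then obtain k where k: "\<And>i. k i \<ge> k0" "\<And>i. (1/2::real)^(k i+3) \<le> e i" "\<And>i. e i < (1/2)^(k i+2)"
      by metis
    have kw: "2 powr (-(real (k i) * s')) \<le> 8 powr s' * (w i + \<epsilon> * (1/2)^(i+1))" if "U i \<noteq> {}" for i
    proof -
      have "2 powr (-(real (k i) * s')) = 8 powr s' * ((1/2::real)^(k i+3)) powr s'"
      proof -
        have "8 * (1/2::real)^(k i+3) = 2 powr (- real (k i))"
          by (simp add: powr_minus powr_realpow power_add power_divide divide_simps)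
        then have "(8 * (1/2::real)^(k i+3)) powr s' = 2 powr (-(real (k i) * s'))"
          by (simp add: powr_powr)
        then show ?thesis by (simp add: powr_mult)
      qed
      also have "((1/2::real)^(k i+3)) powr s' \<le> e i powr s'"
        using k(2)[of i] s' by (intro powr_mono2) auto
      also have "e i powr s' \<le> diameter (U i) powr s' + \<sigma> i powr s'"
        by (auto simp: e_def max_def)
      also have "diameter (U i) powr s' \<le> w i"
      proof (cases "diameter (U i) = 0")
        case True
        then show ?thesis using w(2)[of i] by simp
      next
        case False
        have D: "diameter (U i) > 0" using False diameter_ge_0[OF U(2)[of i]] by linarith
        have D1: "diameter (U i) \<le> 1" using U(3)[of i] \<delta> by linarith
        show ?thesis
        proof (cases "s = 0")
          case True
          then show ?thesis using that D D1 s' by (simp add: w_def powr_le1)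
        next
          case False
          then show ?thesis using that D D1 s' by (simp add: w_def powr_mono')
        qed
      qed
      also note \<sigma>(2)[of i]
      finally show ?thesis by simp
    qed
    define I where "I = {i. U i \<inter> F \<noteq> {}}"
    have "\<exists>x. \<forall>i\<in>I. x i \<in> U i \<inter> F" unfolding I_def by (intro bchoice) auto
    then obtain x where x: "\<And>i. i \<in> I \<Longrightarrow> x i \<in> U i" "\<And>i. i \<in> I \<Longrightarrow> x i \<in> F" by auto
    let ?B = "\<lambda>i. ball (x i) ((1/2)^(k i+2))"
    have UB: "U i \<subseteq> ?B i" if "i \<in> I" for i
    proof
      fix z assume "z \<in> U i"
      then have "dist (x i) z \<le> diameter (U i)"
        using diameter_bounded_bound[OF U(2)] x(1)[OF that] by blast
      then show "z \<in> ?B i" using e(3)[of i] k(3)[of i] by simp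
    qed
    have "F \<subseteq> (\<Union>i\<in>I. ?B i)"
    proof
      fix z assume "z \<in> F"
      then obtain i where "z \<in> U i" using U(1) F(2) by blast
      then have "i \<in> I" using \<open>z \<in> F\<close> by (auto simp: I_def)
      then show "z \<in> (\<Union>i\<in>I. ?B i)" using UB \<open>z \<in> U i\<close> by blast
    qed
    then obtain J where J: "J \<subseteq> I" "finite J" "F \<subseteq> (\<Union>i\<in>J. ?B i)"
      using compactE_image[OF F(1), of I ?B] by auto
    define V where "V = (\<Union>i\<in>J. ?B i)"
    have oV: "open V" by (auto simp: V_def)
    have "\<forall>\<^sub>F m in sequentially. \<forall>i\<in>J. measure (lam m) (?B i) \<le> 2 powr (-(real (k i) * s'))"
      using J(1) by (intro eventually_ball_finite J(2) ballI k0 k(1) x(2)) auto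
    moreover have "\<forall>\<^sub>F m in sequentially. measure (lam m) (- V) = 0"
      using J(3) oV by (intro conc) (auto simp: V_def)
    ultimately have "\<forall>\<^sub>F m in sequentially. c \<le> (\<Sum>i\<in>J. 2 powr (-(real (k i) * s')))"
      using mass(2)
    proof eventually_elim
      case (elim m)
      interpret finite_measure "lam m" by (rule fin)
      have sp: "space (lam m) = UNIV" using sets_eq_imp_space_eq[OF sets[of m]] by simp
      have "c \<le> measure (lam m) (V \<union> - V)" using elim unfolding Compl_partition by simp
      also have "\<dots> \<le> measure (lam m) V + measure (lam m) (- V)"
        using oV by (intro measure_subadditive) (auto simp: sets)
      also have "\<dots> = measure (lam m) V" using elim by simp
      also have "\<dots> \<le> (\<Sum>i\<in>J. measure (lam m) (?B i))"
        unfolding V_def by (intro finite_measure_subadditive_finite J) (auto simp: sets)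
      also have "\<dots> \<le> (\<Sum>i\<in>J. 2 powr (-(real (k i) * s')))"
        using elim by (intro sum_mono) auto
      finally show ?case .
    qed
    then have "c \<le> (\<Sum>i\<in>J. 2 powr (-(real (k i) * s')))" by simp
    also have "\<dots> \<le> (\<Sum>i\<in>J. 8 powr s' * (w i + \<epsilon> * (1/2)^(i+1)))"
      using J(1) by (intro sum_mono kw) (auto simp: I_def)
    also have "\<dots> = 8 powr s' * ((\<Sum>i\<in>J. w i) + \<epsilon> * (\<Sum>i\<in>J. (1/2)^(i+1)))"
      unfolding sum_distrib_left[symmetric] sum.distrib by (rule refl)
    also have "(\<Sum>i\<in>J. w i) \<le> \<epsilon>"
    proof -
      have "ennreal (\<Sum>i\<in>J. w i) = (\<Sum>i\<in>J. diam_pow s (U i))" by (simp add: w sum_ennreal)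
      also have "\<dots> \<le> (\<Sum>i. diam_pow s (U i))" using J(2) by (intro sum_le_suminf) auto
      also have "\<dots> \<le> ennreal \<epsilon>" using Usum by simp
      finally show ?thesis using \<epsilon> by simp
    qed
    also have "(\<Sum>i\<in>J. (1/2::real)^(i+1)) \<le> 1"
    proof -
      have S: "(\<lambda>i. (1/2::real)^(i+1)) sums 1" using power_half_series by simp
      show ?thesis using sum_le_suminf[OF sums_summable[OF S] J(2)] sums_unique[OF S] by simp
    qed
    finally have "c \<le> 8 powr s' * (\<epsilon> + \<epsilon> * 1)" using \<epsilon> by simp
    also have "\<dots> = c / 2" by (simp add: \<epsilon>_def)
    finally show False using mass(1) by simp
  qed
  then show ?thesis using Fne F(2) by (auto simp: hausdorff_dim_def intro!: Inf_greatest)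
qed

section \<open>Box counting and the packing dimension\<close>

lemma totally_bounded_if_compact_UNIV:
  fixes A :: "'a::metric_space set"
  assumes "compact (UNIV :: 'a set)"
  shows "totally_bounded A"
proof (rule totally_bounded_subset[OF _ subset_UNIV])
  show "totally_bounded (UNIV :: 'a set)"
    using assms compact_eq_totally_bounded[of "UNIV :: 'a set"]
    by (simp add: totally_bounded_metric ball_def)
qed

text \<open>A limsup needs only arbitrarily small radii, and after taking logarithms the constant
  \<open>\<kappa>\<close> and the shift by 4 are negligible against \<open>k\<close>.\<close>

lemma upper_box_dim_ge_frequently:
  fixes A :: "'a::metric_space set"
  assumes "A \<noteq> {}" "\<kappa> > 0"
    and freq: "\<And>b. \<exists>k\<ge>b. \<kappa> * 2 powr (real k * s) \<le> real (covering_number ((1/2)^(k+4)) A)"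
  shows "ereal s \<le> upper_box_dim A"
proof (cases "totally_bounded A")
  case False
  then show ?thesis using assms(1) by (simp add: upper_box_dim_def)
next
  case tb: True
  let ?f = "\<lambda>\<delta>. ereal (ln (real (covering_number \<delta> A)) / ln (1 / \<delta>))"
  have "r \<le> Limsup (at_right 0) ?f" if rs: "r < ereal s" for r
  proof (rule ccontr)
    assume "\<not> ?thesis"
    then have lt: "Limsup (at_right 0) ?f < r" by simp
    obtain q where q: "r < ereal q" "q < s" using ereal_dense2[OF rs] by auto
    have "\<forall>\<^sub>F \<delta> in at_right 0. ?f \<delta> < ereal q"
      using Limsup_lessD[OF less_trans[OF lt q(1)]] .
    then obtain d where d: "d > 0" "\<And>\<delta>. 0 < \<delta> \<Longrightarrow> \<delta> < d \<Longrightarrow> ?f \<delta> < ereal q"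
      by (auto simp: eventually_at_right_field)
    have "(\<lambda>k. (1/2::real)^(k+4)) \<longlonglongrightarrow> 0"
      by (intro LIMSEQ_ignore_initial_segment LIMSEQ_power_zero) auto
    then have "\<forall>\<^sub>F k in sequentially. (1/2::real)^(k+4) < d" using d(1) by (rule order_tendstoD)
    moreover have "\<forall>\<^sub>F k in sequentially. q * (real k * ln 2 + 4 * ln 2) < ln \<kappa> + real k * s * ln 2"
      using q(2) by real_asymp
    ultimately have "\<forall>\<^sub>F k in sequentially. (1/2::real)^(k+4) < d \<and> q * (real k * ln 2 + 4 * ln 2) < ln \<kappa> + real k * s * ln 2"
      by eventually_elim auto
    then obtain b where b: "\<And>k. k \<ge> b \<Longrightarrow> (1/2::real)^(k+4) < d"
      "\<And>k. k \<ge> b \<Longrightarrow> q * (real k * ln 2 + 4 * ln 2) < ln \<kappa> + real k * s * ln 2"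
      by (auto simp: eventually_sequentially)
    obtain k where k: "k \<ge> b" "\<kappa> * 2 powr (real k * s) \<le> real (covering_number ((1/2)^(k+4)) A)"
      using freq by blast
    let ?N = "real (covering_number ((1/2)^(k+4)) A)"
    have "0 < \<kappa> * 2 powr (real k * s)" using assms(2) by simp
    then have "ln (\<kappa> * 2 powr (real k * s)) \<le> ln ?N" using k(2) by simp
    then have "ln \<kappa> + real k * s * ln 2 \<le> ln ?N" using assms(2) by (simp add: ln_mult ln_powr)
    moreover have l: "ln (1 / (1/2::real)^(k+4)) = real k * ln 2 + 4 * ln 2"
      by (simp add: ln_div ln_realpow power_divide algebra_simps ln_mult)
    moreover have "ln ?N / ln (1 / (1/2)^(k+4)) < q" using d(2)[of "(1/2)^(k+4)"] b(1)[OF k(1)] by simp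
    moreover have "0 < real k * ln 2 + 4 * ln (2::real)" by (intro add_nonneg_pos) auto
    ultimately have "ln ?N < q * (real k * ln 2 + 4 * ln 2)" "ln \<kappa> + real k * s * ln 2 \<le> ln ?N"
      by (auto simp: divide_simps)
    then show False using b(2)[OF k(1)] by linarith
  qed
  then have "ereal s \<le> Limsup (at_right 0) ?f" by (rule dense_le)
  then show ?thesis using assms(1) tb by (simp add: upper_box_dim_def)
qed

text \<open>A net given by total boundedness may have its centres outside \<open>A\<close>. Moving
  them into \<open>A\<close> doubles the radius, hence the start from \<open>\<delta>/2\<close>;
  afterwards the \<open>LEAST\<close> in \<open>covering_number\<close> is attained.\<close>

lemma covering_number_cover:
  fixes A :: "'a::metric_space set"
  assumes "totally_bounded A" "\<delta> > 0"
  shows "\<exists>C. C \<subseteq> A \<and> finite C \<and> card C \<le> covering_number \<delta> A \<and> A \<subseteq> (\<Union>c\<in>C. cball c \<delta>)"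
proof -
  have "\<exists>C. finite C \<and> A \<subseteq> (\<Union>x\<in>C. ball x (\<delta>/2))"
  proof -
    have "\<delta> / 2 > 0" using assms(2) by simp
    then show ?thesis using assms(1) unfolding totally_bounded_metric ball_def by blast
  qed
  then obtain C0 where C0: "finite C0" "A \<subseteq> (\<Union>x\<in>C0. ball x (\<delta>/2))"
    by blast
  define g where "g x = (SOME y. y \<in> A \<and> dist x y < \<delta>/2)" for x
  define C where "C = g ` {x \<in> C0. ball x (\<delta>/2) \<inter> A \<noteq> {}}"
  have g: "g x \<in> A \<and> dist x (g x) < \<delta>/2" if "ball x (\<delta>/2) \<inter> A \<noteq> {}" for x
  proof -
    have "\<exists>y. y \<in> A \<and> dist x y < \<delta>/2" using that by (auto simp: ball_def)
    then show ?thesis unfolding g_def by (rule someI_ex)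
  qed
  have "A \<subseteq> (\<Union>c\<in>C. cball c \<delta>)"
  proof
    fix a assume a: "a \<in> A"
    then obtain x where x: "x \<in> C0" "a \<in> ball x (\<delta>/2)" using C0 by blast
    then have ne: "ball x (\<delta>/2) \<inter> A \<noteq> {}" using a by blast
    have "dist (g x) a \<le> \<delta>" using g[OF ne] x(2) dist_triangle[of "g x" a x] by (simp add: dist_commute)
    moreover have "g x \<in> C" using x(1) ne by (simp add: C_def)
    ultimately show "a \<in> (\<Union>c\<in>C. cball c \<delta>)" by (intro UN_I) auto
  qed
  moreover have "C \<subseteq> A" using g by (simp add: C_def image_subset_iff)
  moreover have "finite C" using C0(1) by (simp add: C_def)
  ultimately have "cball_coverable A A \<delta> (card C)"
    unfolding cball_coverable_def by blast
  then have "cball_coverable A A \<delta> (covering_number \<delta> A)"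
    unfolding covering_number_def by (rule LeastI)
  then show ?thesis by (simp add: cball_coverable_def)
qed

text \<open>Baire's theorem puts a relatively open part of the support-like set \<open>F'\<close>
  into the closure of one member of the countable cover. The mass there is carried by finitely many
  \<open>E k\<close> with \<open>k\<close> beyond any given \<open>b\<close>, so at one of these
  scales that member needs many balls. That this happens at arbitrarily fine scales is exactly what
  an upper box dimension detects.\<close>

lemma packing_dim_ge_concentrating:
  fixes F A :: "'a::metric_space set" and lam :: "nat \<Rightarrow> 'a measure" and E :: "nat \<Rightarrow> 'a set"
  assumes F: "compact F" "F \<subseteq> A"
    and fin: "\<And>m. finite_measure (lam m)" and sets: "\<And>m. sets (lam m) = sets borel"
    and conc: "\<And>V. open V \<Longrightarrow> F \<subseteq> V \<Longrightarrow> \<forall>\<^sub>F m in sequentially. measure (lam m) (- V) = 0"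
    and mass: "c > 0" "\<forall>\<^sub>F m in sequentially. c \<le> measure (lam m) UNIV"
    and E: "\<And>k. E k \<in> sets borel"
    and blocks: "\<And>b. \<exists>J. finite J \<and> J \<subseteq> {b..} \<and> (\<forall>m. measure (lam m) (- (\<Union>k\<in>J. E k)) = 0)"
    and small: "\<And>s. 0 < s \<Longrightarrow> s < t \<Longrightarrow>
      \<exists>k0. \<forall>k\<ge>k0. \<forall>x\<in>E k. decays lam s k x"
    and t: "0 < t"
  shows "ereal t \<le> packing_dim A"
proof -
  note [measurable_cong] = sets
  have sp: "space (lam m) = UNIV" for m using sets_eq_imp_space_eq[OF sets[of m]] by simp
  have subadd: "measure (lam m) (X \<union> Y) \<le> measure (lam m) X + measure (lam m) Y"
    if "X \<in> sets borel" "Y \<in> sets borel" for X Y m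
    using that by (intro measure_subadditive) (auto simp: sets finite_measure.emeasure_finite[OF fin])
  have mono: "measure (lam m) X \<le> measure (lam m) Y" if "X \<subseteq> Y" "Y \<in> sets borel" for X Y m
    using that finite_measure.finite_measure_mono[OF fin, of X Y m] by (simp add: sets)
  have subfin: "measure (lam m) (\<Union>i\<in>I. X i) \<le> (\<Sum>i\<in>I. measure (lam m) (X i))"
    if "finite I" "\<And>i. i \<in> I \<Longrightarrow> X i \<in> sets borel" for X :: "'b \<Rightarrow> 'a set" and I m
    using that by (intro finite_measure.finite_measure_subadditive_finite[OF fin]) (auto simp: sets)
  \<comment> \<open>Full convergence to 0 makes these sets closed under finite unions, while its
    failure still gives a fixed amount of mass for infinitely many indices, one of which will
    suffice.\<close>
  define nul where "nul V \<longleftrightarrow> (\<lambda>m. measure (lam m) V) \<longlonglongrightarrow> 0" for V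
  have nul_mono: "nul X" if "nul Y" "X \<subseteq> Y" "Y \<in> sets borel" for X Y
    unfolding nul_def
    by (rule tendsto_sandwich[OF _ _ tendsto_const that(1)[unfolded nul_def]]) (intro always_eventually allI mono that measure_nonneg)+
  have nul_Un: "nul (X \<union> Y)" if "nul X" "nul Y" "X \<in> sets borel" "Y \<in> sets borel" for X Y
  proof -
    have lim: "(\<lambda>m. measure (lam m) X + measure (lam m) Y) \<longlonglongrightarrow> 0"
      using tendsto_add[OF that(1,2)[unfolded nul_def]] by simp
    show ?thesis unfolding nul_def
      by (rule tendsto_sandwich[OF _ _ tendsto_const lim]) (intro always_eventually allI subadd that measure_nonneg)+
  qed
  have nul_UN: "nul (\<Union>i\<in>I. X i)"
    if "finite I" "\<And>i. i \<in> I \<Longrightarrow> nul (X i)" "\<And>i. i \<in> I \<Longrightarrow> X i \<in> sets borel" for X :: "'a \<Rightarrow> 'a set" and I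
    using that
  proof (induction I rule: finite_induct)
    case empty then show ?case by (simp add: nul_def)
  next
    case (insert i I)
    then show ?case by (auto intro!: nul_Un)
  qed
  \<comment> \<open>\<open>F'\<close> plays the role of the support of a limit measure; limits need not exist.\<close>
  define F' where "F' = {x \<in> F. \<forall>\<rho>>0. \<not> nul (ball x \<rho>)}"
  have clF: "closed F" by (rule compact_imp_closed[OF F(1)])
  have "closed F'"
  proof -
    have "open {x. \<exists>\<rho>>0. nul (ball x \<rho>)}"
    proof (subst open_subopen, intro ballI)
      fix x assume "x \<in> {x. \<exists>\<rho>>0. nul (ball x \<rho>)}"
      then obtain \<rho> where \<rho>: "\<rho> > 0" "nul (ball x \<rho>)" by auto
      have "nul (ball z (\<rho>/2))" if "z \<in> ball x (\<rho>/2)" for z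
      proof (rule nul_mono[OF \<rho>(2)])
        show "ball z (\<rho>/2) \<subseteq> ball x \<rho>"
        proof
          fix w assume "w \<in> ball z (\<rho>/2)"
          then show "w \<in> ball x \<rho>" using that dist_triangle[of x w z] unfolding mem_ball by linarith
        qed
      qed simp
      moreover have "\<rho> / 2 > 0" using \<rho>(1) by simp
      ultimately have "ball x (\<rho>/2) \<subseteq> {x. \<exists>\<rho>>0. nul (ball x \<rho>)}" by blast
      then show "\<exists>T. open T \<and> x \<in> T \<and> T \<subseteq> {x. \<exists>\<rho>>0. nul (ball x \<rho>)}"
        using \<open>\<rho> / 2 > 0\<close> by (intro exI[of _ "ball x (\<rho>/2)"] conjI) auto
    qed
    moreover have "F' = F - {x. \<exists>\<rho>>0. nul (ball x \<rho>)}" by (auto simp: F'_def)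
    ultimately show ?thesis using clF by auto
  qed
  have F'F: "F' \<subseteq> F" by (auto simp: F'_def)
  have cpF': "compact F'" using compact_Int_closed[OF F(1) \<open>closed F'\<close>] F'F by (simp add: Int_absorb1)
  have avoid: "\<exists>V. open V \<and> X \<subseteq> V \<and> nul V" if X: "compact X" "X \<subseteq> F" "X \<inter> F' = {}" for X
  proof -
    have "\<forall>x\<in>X. \<exists>\<rho>>0. nul (ball x \<rho>)" using that by (auto simp: F'_def)
    then obtain \<rho> where \<rho>: "\<And>x. x \<in> X \<Longrightarrow> \<rho> x > 0" "\<And>x. x \<in> X \<Longrightarrow> nul (ball x (\<rho> x))" by metis
    obtain D where D: "D \<subseteq> X" "finite D" "X \<subseteq> (\<Union>x\<in>D. ball x (\<rho> x))"
      using compactE_image[OF X(1), of X "\<lambda>x. ball x (\<rho> x)"] \<rho>(1) by force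
    then show ?thesis using \<rho> by (intro exI[of _ "\<Union>x\<in>D. ball x (\<rho> x)"]) (auto intro!: nul_UN)
  qed
  \<comment> \<open>Inside \<open>F\<close> the remainder is compact and avoids \<open>F'\<close>,
    so finitely many \<open>nul\<close> balls cover it; away from \<open>F\<close> and these balls
    the mass vanishes eventually by \<open>conc\<close>.\<close>
  have nul_off: "nul (X - W)" if X: "closed X" and W: "open W" "F' \<inter> X \<subseteq> W" for X W
  proof -
    have "compact (F \<inter> (X - W))" using F(1) X W(1) by (intro compact_Int_closed) auto
    then obtain V where V: "open V" "F \<inter> (X - W) \<subseteq> V" "nul V"
      using avoid[of "F \<inter> (X - W)"] W(2) by blast
    let ?G = "V \<union> W \<union> - X"
    have "open ?G" using V W X by auto
    moreover have "F \<subseteq> ?G" using V by auto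
    ultimately have "\<forall>\<^sub>F m in sequentially. measure (lam m) (- ?G) = 0" by (rule conc)
    then have "nul (- ?G)" unfolding nul_def by (rule tendsto_eventually)
    have bG: "- ?G \<in> sets borel" by (intro borel_comp borel_open \<open>open ?G\<close>)
    have bV: "V \<in> sets borel" using V by simp
    have "nul (V \<union> - ?G)" using V(3) \<open>nul (- ?G)\<close> bV bG by (rule nul_Un)
    then show ?thesis by (rule nul_mono) (use bG bV in \<open>blast intro: sets.Un\<close>)+
  qed
  have not_nul_freq: "\<exists>e>0. \<exists>\<^sub>F m in sequentially. e \<le> measure (lam m) X" if "\<not> nul X" for X
    using that by (auto simp: nul_def tendsto_iff not_eventually not_less)
  have "F' \<noteq> {}"
  proof
    assume "F' = {}"
    then have "nul UNIV" using nul_off[of UNIV "{}"] by simp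
    then have "\<forall>\<^sub>F m in sequentially. measure (lam m) UNIV < c"
      unfolding nul_def using mass(1) by (rule order_tendstoD)
    with mass(2) have "\<forall>\<^sub>F m in sequentially. False" by eventually_elim auto
    then show False by simp
  qed
  show ?thesis unfolding packing_dim_def
  proof (rule INF_greatest)
    fix G :: "nat \<Rightarrow> 'a set" assume "G \<in> {G. A = (\<Union>i. G i)}"
    then have G: "A = (\<Union>i. G i)" by simp
    \<comment> \<open>Otherwise the closures would cut the compact set \<open>F'\<close> into
      countably many closed sets without relative interior.\<close>
    have "\<exists>i T. openin (top_of_set F') T \<and> T \<noteq> {} \<and> T \<subseteq> closure (G i)"
    proof (rule ccontr)
      assume neg: "\<not> ?thesis"
      let ?X = "top_of_set F'"
      have "?X interior_of \<Union>((\<lambda>i. F' \<inter> closure (G i)) ` UNIV) = {}"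
      proof (rule Baire_category_alt)
        show "completely_metrizable_space ?X \<or> locally_compact_space ?X \<and> regular_space ?X"
          using cpF'
          by (intro disjI2 conjI metrizable_imp_regular_space metrizable_space_subtopology
              metrizable_space_euclidean compact_imp_locally_compact_space) (simp add: compact_space_subtopology)
        fix T assume "T \<in> (\<lambda>i. F' \<inter> closure (G i)) ` UNIV"
        then obtain i where T: "T = F' \<inter> closure (G i)" by auto
        show "closedin ?X T \<and> ?X interior_of T = {}"
          using neg T by (auto simp: closedin_closed_Int interior_of_def)
      qed auto
      moreover have "\<Union>((\<lambda>i. F' \<inter> closure (G i)) ` UNIV) = F'"
        using F'F F(2) closure_subset unfolding G by blast
      ultimately show False using \<open>F' \<noteq> {}\<close> by (simp add: interior_of_topspace[of ?X, simplified])
    qed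
    then obtain i T where T: "openin (top_of_set F') T" "T \<noteq> {}" "T \<subseteq> closure (G i)" by blast
    obtain x0 V where x0: "x0 \<in> T" and V: "open V" "T = F' \<inter> V"
      using T by (auto simp: openin_open)
    obtain \<rho> where \<rho>: "\<rho> > 0" "cball x0 \<rho> \<subseteq> V" using V x0 open_contains_cball[of V] by blast
    let ?K = "cball x0 \<rho>"
    have sub: "F' \<inter> ?K \<subseteq> closure (G i)" using \<rho>(2) V T(3) by auto
    have "\<not> nul ?K"
      using x0 V \<rho>(1) nul_mono[of ?K "ball x0 \<rho>"] by (auto simp: F'_def)
    then obtain c' where c': "c' > 0" "\<exists>\<^sub>F m in sequentially. c' \<le> measure (lam m) ?K"
      using not_nul_freq by blast
    have Gne: "G i \<noteq> {}" using T(2,3) by auto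
    have "ereal s \<le> upper_box_dim (G i)" if s: "0 < s" "s < t" for s
    proof (cases "totally_bounded (G i)")
      case False
      then show ?thesis using Gne by (simp add: upper_box_dim_def)
    next
      case tb: True
      define s' where "s' = (s + t) / 2"
      define \<theta> where "\<theta> = s' - s"
      have s': "0 < s'" "s' < t" "\<theta> > 0" using s by (auto simp: s'_def \<theta>_def field_simps)
      obtain k0 where k0: "\<And>k x. k \<ge> k0 \<Longrightarrow> x \<in> E k \<Longrightarrow> decays lam s' k x"
        using small[OF s'(1,2)] by blast
      let ?q = "2 powr (- \<theta>)"
      have q: "0 < ?q" "?q < 1" using s'(3) by (auto simp: powr_less_one)
      \<comment> \<open>Geometric weights distribute the mass over the scales: some scale must carry
        more than its share \<open>c' / (2 * S) * ?q ^ k\<close>. The weights cost the exponent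
        \<open>\<theta>\<close>, which is why the argument starts from
        \<open>s' = s + \<theta>\<close>.\<close>
      define S where "S = (\<Sum>k. ?q ^ k)"
      have Ssum: "summable (\<lambda>k. ?q ^ k)" using q by (intro summable_geometric) auto
      have S: "S > 0" unfolding S_def using q by (intro suminf_pos Ssum) auto
      have qk: "?q ^ k = 2 powr (-(real k * \<theta>))" for k
        by (simp add: powr_realpow[symmetric] powr_powr mult.commute)
      show ?thesis
      proof (rule upper_box_dim_ge_frequently[OF Gne])
        show "c' / (2 * S) > 0" using c' S by simp
        fix b
        obtain J where J: "finite J" "J \<subseteq> {max b k0..}" "\<And>m. measure (lam m) (- (\<Union>k\<in>J. E k)) = 0"
          using blocks by blast
        have "\<forall>k. \<exists>C. C \<subseteq> G i \<and> finite C \<and> card C \<le> covering_number ((1/2)^(k+4)) (G i) \<and>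
               G i \<subseteq> (\<Union>c\<in>C. cball c ((1/2)^(k+4)))"
          using covering_number_cover[OF tb] by simp
        then obtain Z where Z: "\<And>k. finite (Z k)" "\<And>k. card (Z k) \<le> covering_number ((1/2)^(k+4)) (G i)"
          "\<And>k. G i \<subseteq> (\<Union>c\<in>Z k. cball c ((1/2)^(k+4)))" by metis
        \<comment> \<open>Passing from closed balls of radius \<open>2^-(k+4)\<close> to open ones
          of radius \<open>2^-(k+3)\<close> makes \<open>W k\<close> an open neighbourhood of the
          closure. Such a ball, once it meets \<open>E k\<close> in \<open>x\<close>, lies in the
          ball of radius \<open>2^-(k+2)\<close> about \<open>x\<close> to which
          \<open>decays\<close> applies.\<close>
        define W where "W k = (\<Union>c\<in>Z k. ball c ((1/2)^(k+3)))" for k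
        have clG: "closure (G i) \<subseteq> W k" for k
        proof -
          have "closure (G i) \<subseteq> (\<Union>c\<in>Z k. cball c ((1/2)^(k+4)))"
            using Z by (intro closure_minimal) auto
          also have "\<dots> \<subseteq> W k"
          proof -
            have "(1/2::real)^(k+4) < (1/2)^(k+3)" by (intro power_strict_decreasing) auto
            then have "cball c ((1/2)^(k+4)) \<subseteq> ball c ((1/2)^(k+3))" for c :: 'a
              by (metis mem_ball mem_cball order.strict_trans1 subsetI)
            then show ?thesis unfolding W_def by (intro UN_mono) auto
          qed
          finally show ?thesis .
        qed
        have ow: "open (W k)" for k by (auto simp: W_def)
        have nulW: "nul (?K - W k)" for k
          using clG sub by (intro nul_off ow) auto
        define N0 where "N0 = - (\<Union>k\<in>J. E k)"
        have bN: "N0 \<in> sets borel" unfolding N0_def using E J(1) by (intro borel_comp sets.finite_UN) auto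
        \<comment> \<open>The error terms, one for each scale in \<open>J\<close>, must together
          stay below half the mass; the added 1 covers an empty \<open>J\<close>.\<close>
        define \<eta> where "\<eta> = c' / (2 * (real (card J) + 1))"
        have \<eta>: "\<eta> > 0" "real (card J) * \<eta> < c' / 2" using c' by (auto simp: \<eta>_def field_simps add_pos_nonneg)
        have "\<forall>\<^sub>F m in sequentially. \<forall>k\<in>J. measure (lam m) (?K - W k) < \<eta>"
          by (intro eventually_ball_finite J ballI order_tendstoD(2)[OF nulW[unfolded nul_def] \<eta>(1)])
        moreover have "\<forall>\<^sub>F m in sequentially. \<forall>k\<in>J. \<forall>z\<in>Z k. measure (lam m) (ball z ((1/2)^(k+3)) \<inter> E k) \<le> 2 powr (-(real k * s'))"
        proof (intro eventually_ball_finite J Z ballI)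
          fix k z assume k: "k \<in> J" "z \<in> Z k"
          show "\<forall>\<^sub>F m in sequentially. measure (lam m) (ball z ((1/2)^(k+3)) \<inter> E k) \<le> 2 powr (-(real k * s'))"
          proof (cases "ball z ((1/2)^(k+3)) \<inter> E k = {}")
            case True
            then show ?thesis by simp
          next
            case False
            then obtain x where x: "x \<in> ball z ((1/2)^(k+3))" "x \<in> E k" by blast
            have "ball z ((1/2)^(k+3)) \<subseteq> ball x ((1/2)^(k+2))"
            proof
              fix w assume "w \<in> ball z ((1/2)^(k+3))"
              then have "dist x w < (1/2)^(k+3) + (1/2)^(k+3)"
                using x(1) dist_triangle[of x w z] unfolding mem_ball by (simp add: dist_commute)
              then show "w \<in> ball x ((1/2)^(k+2))" by (simp add: power_add eval_nat_numeral)
            qed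
            then have "measure (lam m) (ball z ((1/2)^(k+3)) \<inter> E k) \<le> measure (lam m) (ball x ((1/2)^(k+2)))" for m
              by (intro mono) auto
            moreover have "k \<ge> k0" using J(2) k(1) by auto
            ultimately show ?thesis using k0[OF \<open>k \<ge> k0\<close> x(2)] by (auto elim!: eventually_mono intro: order_trans)
          qed
        qed
        \<comment> \<open>The lower bound on \<open>?K\<close> holds only for infinitely many
          \<open>m\<close>, so it remains a premise until \<open>frequently_mp\<close> supplies one
          such index; the conclusion no longer mentions \<open>m\<close>.\<close>
        ultimately have "\<forall>\<^sub>F m in sequentially. c' \<le> measure (lam m) ?K \<longrightarrow>
            c' / 2 < (\<Sum>k\<in>J. real (card (Z k)) * 2 powr (-(real k * s')))"
        proof eventually_elim
          case m: (elim m)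
          show ?case
          proof
            assume "c' \<le> measure (lam m) ?K"
            also have "\<dots> \<le> measure (lam m) ((\<Union>k\<in>J. (W k \<inter> E k) \<union> (?K - W k)) \<union> N0)"
              using J(1) E ow bN by (intro mono) (auto simp: N0_def)
            also have "\<dots> \<le> measure (lam m) (\<Union>k\<in>J. (W k \<inter> E k) \<union> (?K - W k)) + measure (lam m) N0"
              using J(1) E ow bN by (intro subadd) auto
            also have "\<dots> = measure (lam m) (\<Union>k\<in>J. (W k \<inter> E k) \<union> (?K - W k))" using J(3) by (simp add: N0_def del: Compl_UN)
            also have "\<dots> \<le> (\<Sum>k\<in>J. measure (lam m) ((W k \<inter> E k) \<union> (?K - W k)))"
              using J(1) E ow by (intro subfin) auto
            also have "\<dots> \<le> (\<Sum>k\<in>J. real (card (Z k)) * 2 powr (-(real k * s')) + \<eta>)"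
            proof (rule sum_mono)
              fix k assume k: "k \<in> J"
              have "W k \<inter> E k = (\<Union>z\<in>Z k. ball z ((1/2)^(k+3)) \<inter> E k)" by (auto simp: W_def)
              then have "measure (lam m) (W k \<inter> E k) \<le> (\<Sum>z\<in>Z k. measure (lam m) (ball z ((1/2)^(k+3)) \<inter> E k))"
                using Z(1) E subfin[of "Z k" "\<lambda>z. ball z ((1/2)^(k+3)) \<inter> E k" m] by simp
              also have "\<dots> \<le> (\<Sum>z\<in>Z k. 2 powr (-(real k * s')))" using m k by (intro sum_mono) auto
              finally have "measure (lam m) (W k \<inter> E k) \<le> real (card (Z k)) * 2 powr (-(real k * s'))" by simp
              moreover have "measure (lam m) ((W k \<inter> E k) \<union> (?K - W k)) \<le> measure (lam m) (W k \<inter> E k) + measure (lam m) (?K - W k)"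
                using E ow by (intro subadd) auto
              ultimately show "measure (lam m) ((W k \<inter> E k) \<union> (?K - W k)) \<le> real (card (Z k)) * 2 powr (-(real k * s')) + \<eta>"
                using m k by force
            qed
            also have "\<dots> = (\<Sum>k\<in>J. real (card (Z k)) * 2 powr (-(real k * s'))) + real (card J) * \<eta>"
              by (simp add: sum.distrib)
            finally show "c' / 2 < (\<Sum>k\<in>J. real (card (Z k)) * 2 powr (-(real k * s')))" using \<eta>(2) by linarith
          qed
        qed
        from frequently_mp[OF this c'(2)] have big: "c' / 2 < (\<Sum>k\<in>J. real (card (Z k)) * 2 powr (-(real k * s')))" by simp
        have "\<exists>k\<in>J. c' / (2 * S) * ?q ^ k < real (card (Z k)) * 2 powr (-(real k * s'))"
        proof (rule ccontr)
          assume "\<not> ?thesis"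
          then have "(\<Sum>k\<in>J. real (card (Z k)) * 2 powr (-(real k * s'))) \<le> (\<Sum>k\<in>J. c' / (2 * S) * ?q ^ k)"
            by (intro sum_mono) (auto simp: not_less)
          also have "\<dots> = c' / (2 * S) * (\<Sum>k\<in>J. ?q ^ k)" by (simp add: sum_distrib_left)
          also have "\<dots> \<le> c' / (2 * S) * S" unfolding S_def
            using c' S[unfolded S_def] J(1) by (intro mult_left_mono sum_le_suminf Ssum) auto
          finally show False using big S by simp
        qed
        then obtain k where k: "k \<in> J" "c' / (2 * S) * 2 powr (-(real k * \<theta>)) < real (card (Z k)) * 2 powr (-(real k * s'))"
          unfolding qk by blast
        have "c' / (2 * S) * 2 powr (real k * s) = c' / (2 * S) * 2 powr (-(real k * \<theta>)) * 2 powr (real k * s')"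
          by (simp add: powr_add[symmetric] \<theta>_def algebra_simps)
        also have "\<dots> \<le> real (card (Z k)) * 2 powr (-(real k * s')) * 2 powr (real k * s')"
          using k(2) by (intro mult_right_mono) auto
        also have "\<dots> = real (card (Z k))" by (simp add: powr_add[symmetric])
        also have "\<dots> \<le> real (covering_number ((1/2)^(k+4)) (G i))" using Z(2) by simp
        finally show "\<exists>k\<ge>b. c' / (2 * S) * 2 powr (real k * s) \<le> real (covering_number ((1/2)^(k+4)) (G i))"
          using k(1) J(2) by (intro exI[of _ k]) auto
      qed
    qed
    then have "r \<le> upper_box_dim (G i)" if r: "r < ereal t" for r
    proof -
      have "max r 0 < ereal t" using r t by simp
      from ereal_dense2[OF this] obtain s where "max r 0 < ereal s" "s < t" by auto
      then show ?thesis using \<open>\<And>s. 0 < s \<Longrightarrow> s < t \<Longrightarrow> ereal s \<le> upper_box_dim (G i)\<close>[of s]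
        by (auto intro: order_trans less_imp_le)
    qed
    then have "ereal t \<le> upper_box_dim (G i)" by (rule dense_le)
    also have "\<dots> \<le> (SUP i. upper_box_dim (G i))" by (rule SUP_upper) simp
    finally show "ereal t \<le> (SUP i. upper_box_dim (G i))" .
  qed
qed

section \<open>Local dimensions of a mass distribution\<close>

text \<open>A separated set of largest cardinality is a net, because an uncovered point could be
  added to it. Its points lie in \<open>A\<close>, as the centres counted by
  \<open>covering_number\<close> must.\<close>

lemma separated_cover:
  fixes A :: "'a::metric_space set"
  assumes "0 \<le> \<delta>" "\<And>S. finite S \<Longrightarrow> S \<subseteq> A \<Longrightarrow> (\<And>x y. x \<in> S \<Longrightarrow> y \<in> S \<Longrightarrow> x \<noteq> y \<Longrightarrow> \<delta> < dist x y) \<Longrightarrow> card S \<le> N"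
  shows "\<exists>S. finite S \<and> S \<subseteq> A \<and> card S \<le> N \<and> A \<subseteq> (\<Union>x\<in>S. cball x \<delta>)"
proof -
  define P where "P S \<longleftrightarrow> finite S \<and> S \<subseteq> A \<and> (\<forall>x\<in>S. \<forall>y\<in>S. x \<noteq> y \<longrightarrow> \<delta> < dist x y)" for S
  have bnd: "\<forall>S. P S \<longrightarrow> card S \<le> N"
  proof (intro allI impI)
    fix S assume "P S"
    then show "card S \<le> N" unfolding P_def by (intro assms(2)) blast+
  qed
  have "P {}" by (simp add: P_def)
  then have "\<exists>S. P S \<and> (\<forall>T. P T \<longrightarrow> card T \<le> card S)"
    using bnd ex_has_greatest_nat[of P "{}" card "Suc N"] by (simp add: less_Suc_eq_le)
  then obtain S where S: "P S" "\<And>T. P T \<Longrightarrow> card T \<le> card S" by blast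
  have "A \<subseteq> (\<Union>x\<in>S. cball x \<delta>)"
  proof
    fix a assume a: "a \<in> A"
    show "a \<in> (\<Union>x\<in>S. cball x \<delta>)"
    proof (rule ccontr)
      assume "a \<notin> (\<Union>x\<in>S. cball x \<delta>)"
      then have far: "\<delta> < dist x a" if "x \<in> S" for x using that by (meson UN_I mem_cball not_less)
      have "a \<notin> S" using far[of a] assms(1) by auto
      have "P (insert a S)" using S(1) a far by (auto simp: P_def dist_commute)
      then have "card (insert a S) \<le> card S" by (rule S(2))
      then show False using \<open>a \<notin> S\<close> S(1) by (simp add: P_def)
    qed
  qed
  moreover have "card S \<le> N" using S(1) bnd by blast
  ultimately show ?thesis using S(1) by (intro exI[of _ S]) (simp add: P_def)
qed

text \<open>The points at which mu has local dimension at least \<open>q\<close> when read off at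
  the single scale \<open>2^-k\<close>.\<close>

definition low_ball :: "'a::metric_space measure \<Rightarrow> real \<Rightarrow> nat \<Rightarrow> 'a set" where
  "low_ball \<mu> q k = {x. measure \<mu> (ball x ((1/2)^k)) \<le> 2 powr (-(real k * q))}"

context
  fixes \<mu> :: "'a::metric_space measure"
  assumes fin: "finite_measure \<mu>" and sets: "sets \<mu> = sets borel"
begin

interpretation finite_measure \<mu> by (rule fin)

lemma space_UNIV: "space \<mu> = UNIV"
  using sets_eq_imp_space_eq[OF sets] by simp

text \<open>Lower semicontinuity of the mass of open balls: a slightly smaller concentric ball
  already has mass above \<open>a\<close>, and it lies inside the ball of radius \<open>r\<close>
  about every nearby centre.\<close>

lemma open_measure_ball_gt: "open {x. a < measure \<mu> (ball x r)}"
proof (subst open_subopen, intro ballI)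
  fix x assume "x \<in> {x. a < measure \<mu> (ball x r)}"
  then have x: "a < measure \<mu> (ball x r)" by simp
  let ?r = "\<lambda>n. r - 1 / real (Suc n)"
  have "(\<lambda>n. measure \<mu> (ball x (?r n))) \<longlonglongrightarrow> measure \<mu> (\<Union>n. ball x (?r n))"
  proof (intro finite_Lim_measure_incseq)
    show "incseq (\<lambda>n. ball x (?r n))"
      unfolding incseq_def by (intro allI impI subset_ball diff_left_mono frac_le) auto
  qed (auto simp: sets)
  also have "(\<Union>n. ball x (?r n)) = ball x r"
  proof (intro equalityI subsetI)
    fix y assume "y \<in> ball x r"
    then obtain n where "1 / real (Suc n) < r - dist x y"
      using reals_Archimedean[of "r - dist x y"] by (auto simp: inverse_eq_divide)
    then show "y \<in> (\<Union>n. ball x (?r n))" by (auto intro!: exI[of _ n])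
  next
    fix y assume "y \<in> (\<Union>n. ball x (?r n))"
    then obtain n where "dist x y < ?r n" by auto
    also have "\<dots> < r" by simp
    finally show "y \<in> ball x r" by simp
  qed
  finally have "\<forall>\<^sub>F n in sequentially. a < measure \<mu> (ball x (?r n))" using x by (rule order_tendstoD)
  then obtain n where n: "a < measure \<mu> (ball x (?r n))" by (auto simp: eventually_sequentially)
  have "a < measure \<mu> (ball z r)" if "z \<in> ball x (1 / real (Suc n))" for z
  proof -
    have "ball x (?r n) \<subseteq> ball z r"
    proof
      fix w assume "w \<in> ball x (?r n)"
      then show "w \<in> ball z r" using that dist_triangle[of z w x] unfolding mem_ball
        by (simp add: dist_commute)
    qed
    then have "measure \<mu> (ball x (?r n)) \<le> measure \<mu> (ball z r)"
      by (intro finite_measure_mono) (auto simp: sets)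
    then show ?thesis using n by simp
  qed
  then have "ball x (1 / real (Suc n)) \<subseteq> {x. a < measure \<mu> (ball x r)}" by blast
  then show "\<exists>T. open T \<and> x \<in> T \<and> T \<subseteq> {x. a < measure \<mu> (ball x r)}"
    by (intro exI[of _ "ball x (1 / real (Suc n))"]) auto
qed

text \<open>Closedness, the reason for using open balls here, makes inner regularity of \<open>\<mu>\<close> unnecessary.\<close>

lemma closed_low_ball: "closed (low_ball \<mu> q k)"
proof -
  have "low_ball \<mu> q k = - {x. 2 powr (-(real k * q)) < measure \<mu> (ball x ((1/2)^k))}"
    by (auto simp: low_ball_def)
  then show ?thesis using open_measure_ball_gt by (simp add: closed_Compl)
qed

lemma card_separated_le:
  assumes "finite S" "\<And>x y. x \<in> S \<Longrightarrow> y \<in> S \<Longrightarrow> x \<noteq> y \<Longrightarrow> 2 * \<rho> < dist x y"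
    and "\<And>x. x \<in> S \<Longrightarrow> a < measure \<mu> (ball x \<rho>)"
  shows "real (card S) * a \<le> measure \<mu> UNIV"
proof -
  have "disjoint_family_on (\<lambda>x. ball x \<rho>) S"
    unfolding disjoint_family_on_def
  proof (intro ballI impI)
    fix x y assume xy: "x \<in> S" "y \<in> S" "x \<noteq> y"
    show "ball x \<rho> \<inter> ball y \<rho> = {}"
    proof (rule ccontr)
      assume "ball x \<rho> \<inter> ball y \<rho> \<noteq> {}"
      then obtain z where "dist x z < \<rho>" "dist y z < \<rho>" by auto
      then show False using assms(2)[OF xy] dist_triangle[of x y z] by (simp add: dist_commute)
    qed
  qed
  then have "measure \<mu> (\<Union>x\<in>S. ball x \<rho>) = (\<Sum>x\<in>S. measure \<mu> (ball x \<rho>))"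
    using assms(1) by (intro finite_measure_finite_Union) (auto simp: sets)
  moreover have "measure \<mu> (\<Union>x\<in>S. ball x \<rho>) \<le> measure \<mu> UNIV"
    using sets by (intro finite_measure_mono) auto
  moreover have "(\<Sum>x\<in>S. a) \<le> (\<Sum>x\<in>S. measure \<mu> (ball x \<rho>))"
    using assms(3) by (intro sum_mono) (auto intro: less_imp_le)
  ultimately show ?thesis by simp
qed

lemma cover_heavy_balls:
  assumes \<rho>: "0 \<le> \<rho>" and "0 < a" "\<And>x. x \<in> A \<Longrightarrow> a < measure \<mu> (ball x \<rho>)"
  shows "\<exists>S. finite S \<and> S \<subseteq> A \<and> real (card S) \<le> measure \<mu> UNIV / a \<and> A \<subseteq> (\<Union>x\<in>S. cball x (2 * \<rho>))"
proof -
  have "\<exists>S. finite S \<and> S \<subseteq> A \<and> card S \<le> nat \<lfloor>measure \<mu> UNIV / a\<rfloor> \<and> A \<subseteq> (\<Union>x\<in>S. cball x (2 * \<rho>))"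
  proof (rule separated_cover)
    show "0 \<le> 2 * \<rho>" using \<rho> by simp
    fix S assume "finite S" "S \<subseteq> A" "\<And>x y. x \<in> S \<Longrightarrow> y \<in> S \<Longrightarrow> x \<noteq> y \<Longrightarrow> 2 * \<rho> < dist x y"
    then have "real (card S) * a \<le> measure \<mu> UNIV" using assms by (intro card_separated_le) auto
    then have "real (card S) \<le> measure \<mu> UNIV / a" using assms(2) by (simp add: field_simps)
    then show "card S \<le> nat \<lfloor>measure \<mu> UNIV / a\<rfloor>" by linarith
  qed
  moreover have "real (nat \<lfloor>measure \<mu> UNIV / a\<rfloor>) \<le> measure \<mu> UNIV / a" using assms(2) by simp
  ultimately show ?thesis by (meson of_nat_le_iff order_trans)
qed

text \<open>Disjoint balls of mass above \<open>2^-(kq)\<close> number at most \<open>2^(kq)\<close>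
  times the total mass, and a maximal separated set of their centres is a net. The remaining
  constants disappear in the logarithmic limit.\<close>

lemma upper_box_dim_heavy_balls_le:
  assumes tb: "totally_bounded A" and q: "0 < q"
    and heavy: "\<And>k x. k \<ge> b \<Longrightarrow> x \<in> A \<Longrightarrow> 2 powr (-(real k * q)) < measure \<mu> (ball x ((1/2)^k))"
  shows "upper_box_dim A \<le> ereal q"
proof (cases "A = {}")
  case True
  then show ?thesis using q by (simp add: upper_box_dim_def one_ereal_def)
next
  case ne: False
  let ?M = "measure \<mu> UNIV"
  have M: "0 < ?M"
  proof -
    obtain x where "x \<in> A" using ne by blast
    have "0 < 2 powr (-(real b * q))" by simp
    also have "\<dots> < measure \<mu> (ball x ((1/2)^b))" using heavy \<open>x \<in> A\<close> by blast
    also have "\<dots> \<le> ?M" using sets by (intro finite_measure_mono) auto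
    finally show ?thesis .
  qed
  have bound: "ln (real (covering_number \<delta> A)) \<le> ln ?M + q * ln 4 + q * ln (1 / \<delta>)"
    if \<delta>: "0 < \<delta>" "\<delta> < (1/2)^b" for \<delta>
  proof -
    have "\<exists>k. (1/2::real)^k \<le> \<delta> / 2"
      using real_arch_pow_inv[of "\<delta>/2" "1/2"] \<delta> by (auto intro: less_imp_le)
    \<comment> \<open>Balls of radius \<open>2 * 2^-k\<close> must fit into radius
      \<open>\<delta>\<close>, and minimality gives \<open>2^k < 4 / \<delta>\<close>; this is the 4
      in \<open>bound\<close>.\<close>
    define k where "k = (LEAST k. (1/2::real)^k \<le> \<delta> / 2)"
    have k1: "(1/2::real)^k \<le> \<delta> / 2" unfolding k_def by (rule LeastI_ex) fact
    have kb: "k > b"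
    proof (rule ccontr)
      assume "\<not> k > b"
      then have "(1/2::real)^b \<le> (1/2)^k" by (intro power_decreasing) auto
      then show False using k1 \<delta> by linarith
    qed
    then obtain j where j: "k = Suc j" by (cases k) auto
    have "\<not> (1/2::real)^j \<le> \<delta> / 2" by (rule not_less_Least) (use j k_def in simp)
    then have k2: "1 / (1/2::real)^k < 4 / \<delta>" using \<delta> j by (simp add: field_simps)
    obtain S where S: "finite S" "S \<subseteq> A" "real (card S) \<le> ?M / 2 powr (-(real k * q))"
      "A \<subseteq> (\<Union>x\<in>S. cball x (2 * (1/2)^k))"
      using cover_heavy_balls[of "(1/2)^k" "2 powr (-(real k * q))" A] heavy kb by auto
    have "cball x (2 * (1/2)^k) \<subseteq> cball x \<delta>" for x :: 'a using k1 by (intro subset_cball) simp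
    then have "A \<subseteq> (\<Union>x\<in>S. cball x \<delta>)" using S(4) by blast
    then have "cball_coverable A A \<delta> (card S)" using S by (auto simp: cball_coverable_def)
    then have le: "covering_number \<delta> A \<le> card S" unfolding covering_number_def by (rule Least_le)
    have "cball_coverable A A \<delta> (covering_number \<delta> A)" unfolding covering_number_def
      by (rule LeastI) fact
    then have pos: "0 < covering_number \<delta> A" using ne by (auto simp: cball_coverable_def intro!: Nat.gr0I)
    have "real (covering_number \<delta> A) \<le> ?M / 2 powr (-(real k * q))" using le S(3) by linarith
    also have "\<dots> = ?M * (1 / (1/2)^k) powr q"
    proof -
      have "1 / (1/2::real)^k = 2 powr real k" by (simp add: powr_realpow power_divide)
      then show ?thesis by (simp add: powr_powr powr_minus divide_simps)
    qed
    also have "\<dots> \<le> ?M * (4 / \<delta>) powr q" using k2 q M by (intro mult_left_mono powr_mono2) auto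
    finally have "ln (real (covering_number \<delta> A)) \<le> ln (?M * (4 / \<delta>) powr q)"
      using pos by simp
    also have "\<dots> = ln ?M + q * ln 4 + q * ln (1 / \<delta>)"
      using M \<delta> by (simp add: ln_mult ln_powr ln_div algebra_simps)
    finally show ?thesis .
  qed
  have lim: "Limsup (at_right 0) (\<lambda>\<delta>. ereal (ln (real (covering_number \<delta> A)) / ln (1 / \<delta>))) \<le> ereal q + ereal e"
    if "e > 0" for e
  proof (rule Limsup_bounded)
    have ev: "\<forall>\<^sub>F \<delta> in at_right 0. \<delta> < c" if "0 < c" for c :: real
      using order_tendstoD(2)[OF tendsto_ident_at that] .
    have "\<forall>\<^sub>F \<delta> in at_right 0. \<delta> < (1/2::real)^b" "\<forall>\<^sub>F \<delta> in at_right 0. \<delta> < (1::real)"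
      by (auto intro!: ev)
    moreover have "\<forall>\<^sub>F \<delta> in at_right 0. (0::real) < \<delta>" by (simp add: eventually_at_right_less)
    moreover have "\<forall>\<^sub>F \<delta> in at_right 0. ln ?M + q * ln 4 \<le> e * ln (1 / \<delta>)"
      using that by real_asymp
    ultimately show "\<forall>\<^sub>F \<delta> in at_right 0. ereal (ln (real (covering_number \<delta> A)) / ln (1 / \<delta>)) \<le> ereal q + ereal e"
    proof eventually_elim
      case (elim \<delta>)
      have "0 < ln (1 / \<delta>)" using elim by simp
      moreover have "ln (real (covering_number \<delta> A)) \<le> (q + e) * ln (1 / \<delta>)"
        using bound[of \<delta>] elim by (simp add: algebra_simps)
      ultimately show ?case by (simp add: divide_le_eq)
    qed
  qed
  have "Limsup (at_right 0) (\<lambda>\<delta>. ereal (ln (real (covering_number \<delta> A)) / ln (1 / \<delta>))) \<le> ereal q"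
    using lim by (rule ereal_le_epsilon2)
  then show ?thesis using ne tb by (simp add: upper_box_dim_def)
qed

text \<open>The points whose balls are heavy at all scales from \<open>b\<close> on form a set of
  upper box dimension at most \<open>q\<close>, hence of packing dimension below that of mu, so it
  is null.\<close>

lemma AE_low_ball_frequently:
  assumes cp: "compact (UNIV :: 'a set)" and q: "0 < q" "ereal q < packing_dim_measure \<mu>"
  shows "AE x in \<mu>. \<forall>b. \<exists>k\<ge>b. x \<in> low_ball \<mu> q k"
  unfolding AE_all_countable
proof
  fix b
  let ?A = "\<Inter>k\<in>{b..}. - low_ball \<mu> q k"
  have "\<exists>k. k \<in> {b..}" by auto
  then have A: "?A \<in> sets borel" using closed_low_ball[of q]
    by (intro sets.countable_INT'') auto
  have "\<not> 0 < emeasure \<mu> ?A"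
  proof
    assume "0 < emeasure \<mu> ?A"
    then have "packing_dim_measure \<mu> \<le> packing_dim ?A"
      unfolding packing_dim_measure_def using A by (intro INF_lower) auto
    also have "\<dots> \<le> (SUP i::nat. upper_box_dim ?A)"
      unfolding packing_dim_def by (intro INF_lower2[of "\<lambda>_. ?A"]) auto
    also have "\<dots> = upper_box_dim ?A" by simp
    also have "\<dots> \<le> ereal q"
    proof (rule upper_box_dim_heavy_balls_le[OF _ q(1)])
      show "totally_bounded ?A" by (rule totally_bounded_if_compact_UNIV[OF cp])
      show "2 powr (-(real k * q)) < measure \<mu> (ball x ((1/2)^k))" if "k \<ge> b" "x \<in> ?A" for k x
      proof -
        have "x \<notin> low_ball \<mu> q k" using that by blast
        then show ?thesis by (simp add: low_ball_def)
      qed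
    qed
    finally show False using q(2) by simp
  qed
  then have "?A \<in> null_sets \<mu>" using A by (auto simp: null_sets_def sets)
  then show "AE x in \<mu>. \<exists>k\<ge>b. x \<in> low_ball \<mu> q k"
    by (rule AE_I') auto
qed

end

section \<open>The Hausdorff counterpart and uniformity on closed sets\<close>

lemma diameter_cball_le:
  fixes x :: "'a::metric_space"
  assumes "0 \<le> r"
  shows "diameter (cball x r) \<le> 2 * r"
proof -
  have "dist y z \<le> 2 * r" if "y \<in> cball x r" "z \<in> cball x r" for y z
    using that dist_triangle[of y z x] by (simp add: dist_commute)
  then show ?thesis using assms unfolding diameter_def by (auto intro!: cSUP_least)
qed

lemma hausdorff_premeasure_le_cballs:
  fixes A :: "'a::metric_space set"
  assumes cov: "A \<subseteq> (\<Union>k::nat. \<Union>x\<in>S k. cball x (r k))" and fin: "\<And>k. finite (S k)"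
    and r: "\<And>k. 0 \<le> r k" "\<And>k. S k \<noteq> {} \<Longrightarrow> 2 * r k \<le> \<delta>" and s: "0 < s" and \<delta>: "0 \<le> \<delta>"
  shows "hausdorff_premeasure s \<delta> A \<le> (\<Sum>k. ennreal (real (card (S k)) * (2 * r k) powr s))"
proof -
  have "\<forall>k. \<exists>e. bij_betw e {0..<card (S k)} (S k)" using ex_bij_betw_nat_finite fin by blast
  then obtain e where e: "\<And>k. bij_betw (e k) {0..<card (S k)} (S k)" by metis
  define V where "V = (\<lambda>(k, j). if j < card (S k) then cball (e k j) (r k) else {})"
  have "A \<subseteq> (\<Union>i. V (prod_decode i))"
  proof
    fix a assume "a \<in> A"
    then obtain k x where x: "x \<in> S k" "a \<in> cball x (r k)" using cov by blast
    then have "x \<in> e k ` {0..<card (S k)}" using e[of k] by (simp add: bij_betw_def)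
    then obtain j where "j < card (S k)" "x = e k j" by auto
    then have "a \<in> V (prod_decode (prod_encode (k, j)))" using x by (simp add: V_def)
    then show "a \<in> (\<Union>i. V (prod_decode i))" by blast
  qed
  moreover have "bounded (V p) \<and> diameter (V p) \<le> \<delta>" for p
  proof (cases p)
    case (Pair k j)
    show ?thesis
    proof (cases "j < card (S k)")
      case True
      then have "S k \<noteq> {}" by auto
      then show ?thesis using True Pair r(2)[of k] diameter_cball_le[OF r(1), of "e k j" k]
        by (auto simp: V_def)
    next
      case False
      then show ?thesis using Pair \<delta> by (simp add: V_def)
    qed
  qed
  ultimately have "hausdorff_premeasure s \<delta> A \<le> (\<Sum>i. diam_pow s (V (prod_decode i)))"
    unfolding hausdorff_premeasure_def by (intro INF_lower) auto
  also have "\<dots> = (\<Sum>k. \<Sum>j. diam_pow s (V (k, j)))"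
    by (rule suminf_ennreal_2dimen[of _ "\<lambda>p. diam_pow s (V p)"]) simp
  also have "\<dots> \<le> (\<Sum>k. ennreal (real (card (S k)) * (2 * r k) powr s))"
  proof (rule suminf_le)
    fix k
    have "(\<Sum>j. diam_pow s (V (k, j))) = (\<Sum>j<card (S k). diam_pow s (V (k, j)))"
      by (rule suminf_finite) (auto simp: V_def diam_pow_def)
    also have "\<dots> \<le> (\<Sum>j<card (S k). ennreal ((2 * r k) powr s))"
    proof (rule sum_mono)
      fix j
      have "diameter (cball (e k j) (r k)) powr s \<le> (2 * r k) powr s"
        using s diameter_cball_le[OF r(1)] diameter_ge_0[of "cball (e k j) (r k)"] by (intro powr_mono2) auto
      then show "diam_pow s (V (k, j)) \<le> ennreal ((2 * r k) powr s)"
        using s by (auto simp: diam_pow_def V_def intro: ennreal_leI)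
    qed
    also have "\<dots> = ennreal (real (card (S k)) * (2 * r k) powr s)"
      by (simp add: ennreal_mult ennreal_of_nat_eq_real_of_nat)
    finally show "(\<Sum>j. diam_pow s (V (k, j))) \<le> ennreal (real (card (S k)) * (2 * r k) powr s)" .
  qed auto
  finally show ?thesis .
qed

text \<open>The points with heavy balls at infinitely many scales are covered, for each
  \<open>b\<close>, by about \<open>2^(kq)\<close> balls of radius \<open>2 * 2^-k\<close> for every
  \<open>k >= b\<close>. For \<open>s > q\<close> the \<open>s\<close>-sums form a geometric tail,
  so this set has zero \<open>s\<close>-dimensional measure, and below the dimension of mu that
  makes it null.\<close>

lemma AE_low_ball_eventually:
  fixes \<mu> :: "'a::metric_space measure"
  assumes fin: "finite_measure \<mu>" and sets: "sets \<mu> = sets borel"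
    and q: "0 < q" "ereal q < hausdorff_dim_measure \<mu>"
  shows "AE x in \<mu>. \<exists>k0. \<forall>k\<ge>k0. x \<in> low_ball \<mu> q k"
proof -
  note lb = closed_low_ball[OF fin sets]
  define M where "M = measure \<mu> UNIV"
  define A where "A = (\<Inter>b. \<Union>k\<in>{b..}. - low_ball \<mu> q k)"
  have A: "A \<in> sets borel" unfolding A_def using lb[of q] by (auto intro!: sets.countable_INT sets.countable_UN'' )
  obtain s where s: "q < s" "ereal s < hausdorff_dim_measure \<mu>" using ereal_dense2[OF q(2)] by auto
  define p where "p = 2 powr (-(s - q))"
  have p: "0 < p" "p < 1" using s by (auto simp: p_def powr_less_one)
  \<comment> \<open>The covering balls have diameter at most \<open>4 * 2^-(k+b)\<close>, which
    gives the factor \<open>4 powr s\<close>.\<close>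
  define C where "C = M * 4 powr s"
  have M: "0 \<le> M" and C: "0 \<le> C" by (auto simp: M_def C_def)
  have "hausdorff_premeasure s \<delta> A \<le> ennreal \<epsilon>" if \<delta>: "0 < \<delta>" and \<epsilon>: "0 < \<epsilon>" for \<delta> \<epsilon>
  proof -
    have "(\<lambda>b. C * p ^ b / (1 - p)) \<longlonglongrightarrow> C * 0 / (1 - p)"
      using p by (intro tendsto_intros LIMSEQ_power_zero) auto
    then have "\<forall>\<^sub>F b in sequentially. C * p ^ b / (1 - p) < \<epsilon>"
      using \<epsilon> by (auto dest: order_tendstoD)
    moreover have "\<forall>\<^sub>F b in sequentially. 4 * (1/2::real)^b < \<delta>"
      using \<delta> by real_asymp
    ultimately have "\<forall>\<^sub>F b in sequentially. C * p ^ b / (1 - p) < \<epsilon> \<and> 4 * (1/2::real)^b < \<delta>"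
      by eventually_elim auto
    then obtain b where b: "C * p ^ b / (1 - p) < \<epsilon>" "4 * (1/2::real)^b < \<delta>"
      by (auto simp: eventually_sequentially)
    have "\<forall>k. \<exists>S. finite S \<and> real (card S) \<le> M / 2 powr (-(real k * q)) \<and>
        - low_ball \<mu> q k \<subseteq> (\<Union>x\<in>S. cball x (2 * (1/2)^k))"
    proof
      fix k
      show "\<exists>S. finite S \<and> real (card S) \<le> M / 2 powr (-(real k * q)) \<and>
          - low_ball \<mu> q k \<subseteq> (\<Union>x\<in>S. cball x (2 * (1/2)^k))"
        using cover_heavy_balls[OF fin sets, of "(1/2)^k" "2 powr (-(real k * q))" "- low_ball \<mu> q k"]
        unfolding M_def by (simp add: low_ball_def) blast
    qed
    then obtain T where T: "\<And>k. finite (T k)" "\<And>k. real (card (T k)) \<le> M / 2 powr (-(real k * q))"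
      "\<And>k. - low_ball \<mu> q k \<subseteq> (\<Union>x\<in>T k. cball x (2 * (1/2)^k))" by metis
    define r where "r k = 2 * (1/2::real)^(k+b)" for k
    have "hausdorff_premeasure s \<delta> A \<le> (\<Sum>k. ennreal (real (card (T (k + b))) * (2 * r k) powr s))"
    proof (rule hausdorff_premeasure_le_cballs)
      have "A \<subseteq> (\<Union>k\<in>{b..}. - low_ball \<mu> q k)" by (auto simp: A_def)
      also have "\<dots> \<subseteq> (\<Union>k. - low_ball \<mu> q (k + b))"
      proof
        fix x assume "x \<in> (\<Union>k\<in>{b..}. - low_ball \<mu> q k)"
        then obtain k where "k \<ge> b" "x \<in> - low_ball \<mu> q k" by auto
        then have "x \<in> - low_ball \<mu> q ((k - b) + b)" by simp
        then show "x \<in> (\<Union>k. - low_ball \<mu> q (k + b))" by blast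
      qed
      also have "\<dots> \<subseteq> (\<Union>k. \<Union>x\<in>T (k + b). cball x (r k))"
        using T(3) unfolding r_def by (intro UN_mono) auto
      finally show "A \<subseteq> (\<Union>k. \<Union>x\<in>T (k + b). cball x (r k))" .
      show "2 * r k \<le> \<delta>" for k
      proof -
        have "(1/2::real)^(k+b) \<le> (1/2)^b" by (intro power_decreasing) auto
        then show ?thesis using b(2) unfolding r_def by linarith
      qed
    qed (use T(1) q s \<delta> in \<open>auto simp: r_def\<close>)
    also have "\<dots> \<le> (\<Sum>k. ennreal (C * p ^ b * p ^ k))"
    proof (intro suminf_le allI ennreal_leI)
      fix k
      have rw: "(2 * r k) powr s = 4 powr s * 2 powr (-(real (k+b) * s))"
      proof -
        have "(1/2::real)^(k+b) = 2 powr (- real (k + b))"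
          by (simp only: powr_minus powr_realpow zero_less_numeral power_divide power_one inverse_eq_divide)
        then have "2 * r k = 4 * 2 powr (- real (k + b))" by (simp only: r_def)
        then show ?thesis by (simp add: powr_mult powr_powr algebra_simps)
      qed
      have "real (card (T (k+b))) * (2 * r k) powr s \<le> M / 2 powr (-(real (k+b) * q)) * (2 * r k) powr s"
        using T(2)[of "k + b"] by (rule mult_right_mono) simp
      also have "M / 2 powr (-(real (k+b) * q)) * (2 * r k) powr s = C * p ^ (k+b)"
      proof -
        have "p ^ (k+b) = 2 powr (-(real (k+b) * s)) * 2 powr (real (k+b) * q)"
          using p by (simp add: p_def powr_realpow[symmetric] powr_powr powr_add[symmetric] algebra_simps)
        moreover have "M / 2 powr (-(real (k+b) * q)) = M * 2 powr (real (k+b) * q)"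
          by (simp only: powr_minus divide_inverse inverse_inverse_eq)
        ultimately show ?thesis unfolding C_def rw by simp
      qed
      also have "\<dots> = C * p ^ b * p ^ k" by (simp add: power_add)
      finally show "real (card (T (k+b))) * (2 * r k) powr s \<le> C * p ^ b * p ^ k" .
    qed auto
    also have "\<dots> = ennreal (\<Sum>k. C * p ^ b * p ^ k)"
      using p C by (intro suminf_ennreal2 summable_mult summable_geometric) auto
    also have "(\<Sum>k. C * p ^ b * p ^ k) = C * p ^ b / (1 - p)"
      using p by (subst suminf_mult) (auto simp: suminf_geometric)
    also have "ennreal \<dots> \<le> ennreal \<epsilon>" using b(1) by (intro ennreal_leI) simp
    finally show ?thesis .
  qed
  then have null: "hausdorff_premeasure s \<delta> A = 0" if "\<delta> > 0" for \<delta>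
  proof -
    have "hausdorff_premeasure s \<delta> A \<le> 0"
      by (rule ennreal_le_epsilon) (use that \<open>\<And>\<epsilon> \<delta>. 0 < \<delta> \<Longrightarrow> 0 < \<epsilon> \<Longrightarrow> hausdorff_premeasure s \<delta> A \<le> ennreal \<epsilon>\<close> in simp)
    then show ?thesis by simp
  qed
  then have "hausdorff_measure s A = 0" by (auto simp: hausdorff_measure_def null intro!: antisym SUP_least)
  then have "hausdorff_dim A \<le> ereal s"
    using q s by (auto simp: hausdorff_dim_def one_ereal_def intro!: Inf_lower)
  have "\<not> 0 < emeasure \<mu> A"
  proof
    assume "0 < emeasure \<mu> A"
    then have "hausdorff_dim_measure \<mu> \<le> hausdorff_dim A"
      unfolding hausdorff_dim_measure_def using A by (intro INF_lower) auto
    then show False using \<open>hausdorff_dim A \<le> ereal s\<close> s(2) by simp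
  qed
  then have "A \<in> null_sets \<mu>" using A by (auto simp: null_sets_def sets)
  then show ?thesis by (rule AE_I') (auto simp: A_def)
qed

text \<open>Egorov's argument: continuity from above gives the \<open>i\<close>-th exhaustion an
  index with error below \<open>\<epsilon> * (1/2)^(i+1)\<close>, and these errors sum to
  \<open>\<epsilon>\<close>.\<close>

lemma (in finite_measure) egorov_sets:
  fixes X :: "nat \<Rightarrow> nat \<Rightarrow> 'a set"
  assumes X: "\<And>i k. X i k \<in> sets M" and inc: "\<And>i. incseq (X i)"
    and ae: "\<And>i. AE x in M. \<exists>k. x \<in> X i k" and \<epsilon>: "0 < \<epsilon>"
  shows "\<exists>\<kappa>. measure M (space M - (\<Inter>i. X i (\<kappa> i))) \<le> \<epsilon>"
proof -
  have "\<exists>k. measure M (space M - X i k) < \<epsilon> * (1/2)^(i+1)" for i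
  proof -
    have "(\<lambda>k. measure M (space M - X i k)) \<longlonglongrightarrow> measure M (\<Inter>k. space M - X i k)"
    proof (intro finite_Lim_measure_decseq)
      show "decseq (\<lambda>k. space M - X i k)" unfolding decseq_def using incseqD[OF inc] by blast
    qed (use X in auto)
    moreover have "measure M (\<Inter>k. space M - X i k) = 0"
    proof -
      have "(\<Inter>k. space M - X i k) \<in> null_sets M"
        using ae[of i] X by (subst AE_iff_null_sets) (auto intro!: sets.countable_INT)
      then show ?thesis by (simp add: measure_eq_0_null_sets)
    qed
    ultimately have "\<forall>\<^sub>F k in sequentially. measure M (space M - X i k) < \<epsilon> * (1/2)^(i+1)"
      using \<epsilon> by (intro order_tendstoD(2)[where a="\<epsilon> * (1/2)^(i+1)"]) auto
    then show ?thesis by (auto simp: eventually_sequentially)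
  qed
  then obtain \<kappa> where \<kappa>: "\<And>i. measure M (space M - X i (\<kappa> i)) < \<epsilon> * (1/2)^(i+1)" by metis
  have S: "(\<lambda>i. \<epsilon> * (1/2::real)^(i+1)) sums (\<epsilon> * 1)" using power_half_series by (intro sums_mult) simp
  have sm: "summable (\<lambda>i. measure M (space M - X i (\<kappa> i)))"
    by (rule summable_comparison_test'[OF sums_summable[OF S], of 0]) (use \<kappa> in \<open>simp add: less_imp_le\<close>)
  have "measure M (space M - (\<Inter>i. X i (\<kappa> i))) = measure M (\<Union>i. space M - X i (\<kappa> i))"
    by (intro arg_cong[where f="measure M"]) auto
  also have "\<dots> \<le> (\<Sum>i. measure M (space M - X i (\<kappa> i)))"
    using X sm by (intro finite_measure_subadditive_countably) auto
  also have "\<dots> \<le> (\<Sum>i. \<epsilon> * (1/2::real)^(i+1))"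
    using \<kappa> by (intro suminf_le sm sums_summable[OF S]) (auto intro: less_imp_le)
  also have "\<dots> = \<epsilon>" using sums_unique[OF S] by simp
  finally show ?thesis by blast
qed

lemma low_ball_antimono: "q' \<le> q \<Longrightarrow> low_ball \<mu> q k \<subseteq> low_ball \<mu> q' k"
proof -
  assume "q' \<le> q"
  then have "2 powr (-(real k * q)) \<le> (2::real) powr (-(real k * q'))"
    by (intro powr_mono) (auto intro: mult_left_mono)
  then show ?thesis unfolding low_ball_def by (blast intro: order_trans)
qed

lemma rat_between_ereal:
  assumes "ereal q < a"
  shows "\<exists>r. q < real_of_rat r \<and> ereal (real_of_rat r) < a"
proof -
  obtain q1 where q1: "ereal q < ereal q1" "ereal q1 < a" using ereal_dense2[OF assms] by auto
  obtain r where r: "q < real_of_rat r" "real_of_rat r < q1" using of_rat_dense[of q q1] q1(1) by auto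
  then have "ereal (real_of_rat r) < ereal q1" by simp
  then have "ereal (real_of_rat r) < a" using q1(2) by (rule less_trans)
  then show ?thesis using r(1) by blast
qed

text \<open>Only countably many conditions can be made uniform at once, so the exponents are
  rational, enumerated by \<open>from_nat\<close>, and \<open>low_ball_antimono\<close> passes to
  real ones. For packing, a condition is a pair of an exponent and a threshold \<open>b\<close>, and
  "infinitely often" is exhausted by the finite blocks \<open>{b..b+k0}\<close>. Finite unions keep
  the sets closed and provide the \<open>J\<close> that the packing bound needs.\<close>

lemma regular_closed_set:
  fixes \<mu> :: "'a::metric_space measure"
  assumes cp: "compact (UNIV :: 'a set)" and fin: "finite_measure \<mu>" and sets: "sets \<mu> = sets borel"
    and \<epsilon>: "0 < \<epsilon>"
  shows "\<exists>G. closed G \<and> measure \<mu> (- G) \<le> \<epsilon> \<and>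
    (\<forall>q>0. ereal q < hausdorff_dim_measure \<mu> \<longrightarrow> (\<exists>k0. \<forall>k\<ge>k0. G \<subseteq> low_ball \<mu> q k)) \<and>
    (\<forall>q>0. ereal q < packing_dim_measure \<mu> \<longrightarrow>
       (\<forall>b. \<exists>J. finite J \<and> J \<subseteq> {b..} \<and> G \<subseteq> (\<Union>k\<in>J. low_ball \<mu> q k)))"
proof -
  interpret finite_measure \<mu> by (rule fin)
  have sp: "space \<mu> = UNIV" by (rule space_UNIV[OF fin sets])
  note lb = closed_low_ball[OF fin sets]
  define X where "X i k0 = (let q = real_of_rat (from_nat i) in
      if 0 < q \<and> ereal q < hausdorff_dim_measure \<mu> then (\<Inter>k\<in>{k0..}. low_ball \<mu> q k) else UNIV)" for i k0
  define Y where "Y i k0 = (let (r, b) = from_nat i; q = real_of_rat r in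
      if 0 < q \<and> ereal q < packing_dim_measure \<mu> then (\<Union>k\<in>{b..b+k0}. low_ball \<mu> q k) else UNIV)" for i k0
  have X: "closed (X i k)" for i k unfolding X_def Let_def using lb by auto
  have Y: "closed (Y i k)" for i k unfolding Y_def Let_def using lb by (auto simp: case_prod_unfold)
  have "\<exists>\<kappa>. measure \<mu> (space \<mu> - (\<Inter>i. X i (\<kappa> i))) \<le> \<epsilon> / 2"
  proof (rule egorov_sets)
    show "incseq (X i)" for i by (auto simp: X_def Let_def incseq_def)
    show "AE x in \<mu>. \<exists>k. x \<in> X i k" for i
      using AE_low_ball_eventually[OF fin sets, of "real_of_rat (from_nat i)"]
      by (cases "0 < real_of_rat (from_nat i) \<and> ereal (real_of_rat (from_nat i)) < hausdorff_dim_measure \<mu>")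
         (auto simp: X_def Let_def)
  qed (use X \<epsilon> sets in auto)
  then obtain \<kappa> where \<kappa>: "measure \<mu> (- (\<Inter>i. X i (\<kappa> i))) \<le> \<epsilon> / 2" unfolding sp Compl_eq_Diff_UNIV by blast
  have "\<exists>\<kappa>. measure \<mu> (space \<mu> - (\<Inter>i. Y i (\<kappa> i))) \<le> \<epsilon> / 2"
  proof (rule egorov_sets)
    show "incseq (Y i)" for i by (fastforce simp: Y_def Let_def incseq_def case_prod_unfold)
    show "AE x in \<mu>. \<exists>k. x \<in> Y i k" for i
    proof -
      obtain r :: rat and b :: nat where rb: "from_nat i = (r, b)" by force
      show ?thesis
      proof (cases "0 < real_of_rat r \<and> ereal (real_of_rat r) < packing_dim_measure \<mu>")
        case True
        then have "AE x in \<mu>. \<forall>b. \<exists>k\<ge>b. x \<in> low_ball \<mu> (real_of_rat r) k"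
          using AE_low_ball_frequently[OF fin sets cp] by blast
        then show ?thesis
        proof eventually_elim
          case (elim x)
          then obtain k where "k \<ge> b" "x \<in> low_ball \<mu> (real_of_rat r) k" by blast
          then have "x \<in> Y i (k - b)" using True by (auto simp: Y_def rb intro!: bexI[of _ k])
          then show ?case by blast
        qed
      next
        case False
        then show ?thesis by (auto simp: Y_def rb)
      qed
    qed
  qed (use Y \<epsilon> sets in auto)
  then obtain l where l: "measure \<mu> (- (\<Inter>i. Y i (l i))) \<le> \<epsilon> / 2" unfolding sp Compl_eq_Diff_UNIV by blast
  define G where "G = (\<Inter>i. X i (\<kappa> i)) \<inter> (\<Inter>i. Y i (l i))"
  have cl: "closed (\<Inter>i. X i (\<kappa> i))" "closed (\<Inter>i. Y i (l i))" using X Y by auto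
  have "measure \<mu> (- G) \<le> measure \<mu> (- (\<Inter>i. X i (\<kappa> i))) + measure \<mu> (- (\<Inter>i. Y i (l i)))"
    unfolding G_def Compl_Int using cl by (intro measure_subadditive) (auto simp: sets simp del: Compl_INT)
  then have m: "measure \<mu> (- G) \<le> \<epsilon>" using \<kappa> l by linarith
  show ?thesis
  proof (intro exI[of _ G] conjI allI impI m)
    show "closed G" unfolding G_def using cl by auto
  next
    fix q :: real assume q: "0 < q" "ereal q < hausdorff_dim_measure \<mu>"
    obtain r where r: "q < real_of_rat r" "ereal (real_of_rat r) < hausdorff_dim_measure \<mu>"
      using rat_between_ereal[OF q(2)] by blast
    have "0 < real_of_rat r" using r(1) q(1) by linarith
    define i where "i = to_nat r"
    have ri: "from_nat i = r" by (simp add: i_def)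
    have "X i (\<kappa> i) = (\<Inter>k\<in>{\<kappa> i..}. low_ball \<mu> (real_of_rat r) k)"
      using r(2) \<open>0 < real_of_rat r\<close> by (simp add: X_def ri)
    then have "\<forall>k\<ge>\<kappa> i. G \<subseteq> low_ball \<mu> (real_of_rat r) k" by (auto simp: G_def)
    then show "\<exists>k0. \<forall>k\<ge>k0. G \<subseteq> low_ball \<mu> q k"
      using low_ball_antimono[of q "real_of_rat r" \<mu>] r by (meson less_imp_le order_trans)
  next
    fix q :: real and b :: nat assume q: "0 < q" "ereal q < packing_dim_measure \<mu>"
    obtain r where r: "q < real_of_rat r" "ereal (real_of_rat r) < packing_dim_measure \<mu>"
      using rat_between_ereal[OF q(2)] by blast
    have "0 < real_of_rat r" using r(1) q(1) by linarith
    define i where "i = to_nat (r, b)"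
    have ri: "from_nat i = (r, b)" by (simp add: i_def)
    have "Y i (l i) = (\<Union>k\<in>{b..b+l i}. low_ball \<mu> (real_of_rat r) k)"
      using r(2) \<open>0 < real_of_rat r\<close> by (simp add: Y_def ri)
    then have "G \<subseteq> (\<Union>k\<in>{b..b+l i}. low_ball \<mu> (real_of_rat r) k)" by (auto simp: G_def)
    also have "\<dots> \<subseteq> (\<Union>k\<in>{b..b+l i}. low_ball \<mu> q k)"
      using r by (intro UN_mono low_ball_antimono) auto
    finally show "\<exists>J. finite J \<and> J \<subseteq> {b..} \<and> G \<subseteq> (\<Union>k\<in>J. low_ball \<mu> q k)"
      by (intro exI[of _ "{b..b+l i}"]) auto
  qed
qed

section \<open>A refinable kernel\<close>

definition tent :: "real \<Rightarrow> real" where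
  "tent u = max 0 (1 - \<bar>u\<bar>)"

lemma tent_bounds: "0 \<le> tent u" "tent u \<le> 1"
  by (auto simp: tent_def)

lemma tent_lipschitz: "\<bar>tent u - tent v\<bar> \<le> \<bar>u - v\<bar>"
  unfolding tent_def by linarith

text \<open>Summing over pairs of bits gives the offsets -1, 0, 1 the weights 1, 2, 1 of the
  two-scale relation; with pairs, these weights come from a uniform choice.\<close>

lemma tent_refine:
  "(\<Sum>p\<in>UNIV. tent (2 * u - (of_bool (fst p) + of_bool (snd p) - 1))) = 2 * tent u"
proof -
  have U: "(UNIV :: (bool \<times> bool) set) = {(False, False), (False, True), (True, False), (True, True)}"
    by auto
  have "tent (2 * u + 1) + 2 * tent (2 * u) + tent (2 * u - 1) = 2 * tent u"
  proof -
    consider "u \<le> -1" | "-1 < u" "u \<le> -1/2" | "-1/2 < u" "u \<le> 0" | "0 < u" "u \<le> 1/2" | "1/2 < u" "u \<le> 1" | "1 < u"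
      by linarith
    then show ?thesis by cases (simp_all add: tent_def max_def abs_if)
  qed
  then show ?thesis unfolding U by (simp add: algebra_simps)
qed

lemma tent_floor: "tent (of_int \<lfloor>u\<rfloor> - u) + tent (of_int (\<lfloor>u\<rfloor> + 1) - u) = 1"
proof -
  have "of_int \<lfloor>u\<rfloor> \<le> u" "u < of_int \<lfloor>u\<rfloor> + 1" by linarith+
  then show ?thesis unfolding tent_def by linarith
qed

definition kern :: "nat \<Rightarrow> real ^ 'd \<Rightarrow> real" where
  "kern n y = (\<Prod>i\<in>UNIV. 2 ^ n * tent (2 ^ n * y $ i))"

lemma kern_nonneg: "0 \<le> kern n y"
  unfolding kern_def by (intro prod_nonneg mult_nonneg_nonneg ballI tent_bounds) auto

lemma kern_alt: "kern n (y :: real ^ 'd) = 2 ^ (n * CARD('d)) * (\<Prod>i\<in>UNIV. tent (2 ^ n * y $ i))"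
  by (simp add: kern_def prod.distrib power_mult)

lemma kern_le: "kern n (y :: real ^ 'd) \<le> 2 ^ (n * CARD('d))"
proof -
  have "(\<Prod>i\<in>UNIV. tent (2 ^ n * y $ i)) \<le> 1" by (intro prod_le_1) (auto simp: tent_bounds)
  then show ?thesis unfolding kern_alt by simp
qed

lemma kern_eq_0: "(1/2) ^ n \<le> \<bar>y $ i\<bar> \<Longrightarrow> kern n y = 0"
proof -
  assume "(1/2) ^ n \<le> \<bar>y $ i\<bar>"
  then have "1 \<le> \<bar>2 ^ n * y $ i\<bar>" by (simp add: abs_mult power_divide field_simps)
  then have "tent (2 ^ n * y $ i) = 0" by (simp add: tent_def)
  then show ?thesis unfolding kern_def by (intro prod_zero) (auto intro!: exI[of _ i])
qed

lemma kern_eq_0_norm: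
  assumes "CARD('d) * (1/2) ^ n \<le> norm (y :: real ^ 'd)"
  shows "kern n y = 0"
proof -
  have "\<exists>i. (1/2) ^ n \<le> \<bar>y $ i\<bar>"
  proof (rule ccontr)
    assume "\<not> ?thesis"
    then have "(\<Sum>i\<in>UNIV. \<bar>y $ i\<bar>) < (\<Sum>i\<in>(UNIV :: 'd set). (1/2) ^ n)"
      by (intro sum_strict_mono) (auto simp: not_le)
    then show False using norm_le_l1_cart[of y] assms by simp
  qed
  then show ?thesis using kern_eq_0 by blast
qed

text \<open>The \<open>itself\<close> argument carries the dimension, which \<open>n\<close> alone
  does not determine.\<close>

definition kern_lip :: "'d::finite itself \<Rightarrow> nat \<Rightarrow> real" where
  "kern_lip _ n = 2 ^ (n * CARD('d)) * (CARD('d) * 2 ^ n)"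

lemma kern_lip_pos: "0 < kern_lip TYPE('d::finite) n"
  by (simp add: kern_lip_def)

lemma kern_lipschitz: "\<bar>kern n y - kern n z\<bar> \<le> kern_lip TYPE('d) n * norm (y - z :: real ^ 'd)"
proof -
  have "norm ((\<Prod>i\<in>UNIV. tent (2 ^ n * y $ i)) - (\<Prod>i\<in>UNIV. tent (2 ^ n * z $ i))) \<le>
      (\<Sum>i\<in>UNIV. norm (tent (2 ^ n * y $ i) - tent (2 ^ n * z $ i)))"
    by (rule norm_prod_diff) (auto simp: tent_bounds)
  also have "\<dots> \<le> (\<Sum>i\<in>(UNIV :: 'd set). 2 ^ n * norm (y - z))"
  proof (rule sum_mono)
    fix i :: 'd
    have "norm (tent (2 ^ n * y $ i) - tent (2 ^ n * z $ i)) \<le> \<bar>2 ^ n * y $ i - 2 ^ n * z $ i\<bar>"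
      using tent_lipschitz by simp
    also have "\<dots> = 2 ^ n * \<bar>(y - z) $ i\<bar>" by (simp add: abs_mult right_diff_distrib[symmetric])
    also have "\<dots> \<le> 2 ^ n * norm (y - z)" using component_le_norm_cart[of "y - z" i] by simp
    finally show "norm (tent (2 ^ n * y $ i) - tent (2 ^ n * z $ i)) \<le> 2 ^ n * norm (y - z)" .
  qed
  finally have "\<bar>(\<Prod>i\<in>UNIV. tent (2 ^ n * y $ i)) - (\<Prod>i\<in>UNIV. tent (2 ^ n * z $ i))\<bar> \<le> CARD('d) * 2 ^ n * norm (y - z)"
    by simp
  then have "2 ^ (n * CARD('d)) * \<bar>(\<Prod>i\<in>UNIV. tent (2 ^ n * y $ i)) - (\<Prod>i\<in>UNIV. tent (2 ^ n * z $ i))\<bar>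
      \<le> 2 ^ (n * CARD('d)) * (CARD('d) * 2 ^ n * norm (y - z))" by (intro mult_left_mono) auto
  then show ?thesis unfolding kern_alt kern_lip_def by (simp add: right_diff_distrib[symmetric] abs_mult mult.assoc)
qed

lemma continuous_on_kern: "continuous_on A (kern n)"
  unfolding kern_def tent_def by (intro continuous_intros)

definition bits :: "('d \<Rightarrow> bool \<times> bool) \<Rightarrow> real ^ 'd" where
  "bits e = (\<chi> i. of_bool (fst (e i)) + of_bool (snd (e i)) - 1)"

lemma bits_bound: "\<bar>bits e $ i\<bar> \<le> 1"
  by (auto simp: bits_def)

lemma card_fun_UNIV: "CARD('d::finite \<Rightarrow> bool \<times> bool) = 4 ^ CARD('d)"
  by (simp add: card_fun)

text \<open>
  The two-scale relation of the tent: \<open>kern n\<close> is the density of the sum of \<open>2\<^sup>-\<^sup>l\<^sup>-\<^sup>1\<close> times independent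
  copies of \<^const>\<open>bits\<close> over \<open>l \<ge> n\<close>.
\<close>

lemma kern_refine:
  "kern n (y :: real ^ 'd) = (\<Sum>e\<in>UNIV. kern (Suc n) (y - (1/2) ^ Suc n *\<^sub>R bits e)) / CARD('d \<Rightarrow> bool \<times> bool)"
proof -
  have "(\<Sum>e\<in>UNIV. kern (Suc n) (y - (1/2) ^ Suc n *\<^sub>R bits e)) =
      (\<Sum>e\<in>PiE UNIV (\<lambda>_. UNIV). \<Prod>i\<in>UNIV. 2 ^ Suc n * tent (2 * (2 ^ n * y $ i) - (of_bool (fst (e i)) + of_bool (snd (e i)) - 1)))"
  proof (intro sum.cong)
    fix e :: "'d \<Rightarrow> bool \<times> bool"
    have "2 ^ Suc n * (y - (1/2) ^ Suc n *\<^sub>R bits e) $ i = 2 * (2 ^ n * y $ i) - (of_bool (fst (e i)) + of_bool (snd (e i)) - 1)" for i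
      by (simp add: bits_def power_divide right_diff_distrib)
    then show "kern (Suc n) (y - (1/2) ^ Suc n *\<^sub>R bits e) =
        (\<Prod>i\<in>UNIV. 2 ^ Suc n * tent (2 * (2 ^ n * y $ i) - (of_bool (fst (e i)) + of_bool (snd (e i)) - 1)))"
      unfolding kern_def by presburger
  qed auto
  also have "\<dots> = (\<Prod>i\<in>UNIV. \<Sum>p\<in>UNIV. 2 ^ Suc n * tent (2 * (2 ^ n * y $ i) - (of_bool (fst p) + of_bool (snd p) - 1)))"
    by (rule prod_sum_PiE[symmetric]) auto
  also have "\<dots> = (\<Prod>i\<in>UNIV. 4 * (2 ^ n * tent (2 ^ n * y $ i)))"
    unfolding sum_distrib_left[symmetric] tent_refine by (intro prod.cong) auto
  also have "\<dots> = 4 ^ CARD('d) * kern n y" unfolding prod.distrib[of "\<lambda>_. 4"] kern_def by simp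
  finally show ?thesis unfolding card_fun_UNIV by simp
qed

text \<open>In each coordinate the tents at the two integers around \<open>2 ^ n * x $ i\<close>
  already sum to one by \<open>tent_floor\<close>. Expanding the product over coordinates gives
  equality on these grid points, and further points only add nonnegative terms.\<close>

lemma kern_grid_sum:
  fixes x :: "real ^ 'd"
  assumes "finite A" "PiE UNIV (\<lambda>i. {\<lfloor>2 ^ n * x $ i\<rfloor>, \<lfloor>2 ^ n * x $ i\<rfloor> + 1}) \<subseteq> A"
  shows "2 ^ (n * CARD('d)) \<le> (\<Sum>k\<in>A. kern n ((\<chi> i. of_int (k i) / 2 ^ n) - x))"
proof -
  let ?P = "PiE UNIV (\<lambda>i. {\<lfloor>2 ^ n * x $ i\<rfloor>, \<lfloor>2 ^ n * x $ i\<rfloor> + 1})"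
  have "(\<Sum>k\<in>?P. kern n ((\<chi> i. of_int (k i) / 2 ^ n) - x)) =
      (\<Sum>k\<in>?P. \<Prod>i\<in>UNIV. 2 ^ n * tent (of_int (k i) - 2 ^ n * x $ i))"
    by (simp add: kern_def right_diff_distrib)
  also have "\<dots> = (\<Prod>i\<in>UNIV. \<Sum>p\<in>{\<lfloor>2 ^ n * x $ i\<rfloor>, \<lfloor>2 ^ n * x $ i\<rfloor> + 1}. 2 ^ n * tent (of_int p - 2 ^ n * x $ i))"
    by (rule prod_sum_PiE[symmetric]) auto
  also have "\<dots> = (\<Prod>i\<in>(UNIV :: 'd set). 2 ^ n)"
  proof (intro prod.cong refl)
    fix i
    show "(\<Sum>p\<in>{\<lfloor>2 ^ n * x $ i\<rfloor>, \<lfloor>2 ^ n * x $ i\<rfloor> + 1}. 2 ^ n * tent (of_int p - 2 ^ n * x $ i)) = 2 ^ n"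
      using tent_floor[of "2 ^ n * x $ i"] by (simp add: distrib_left[symmetric])
  qed
  also have "\<dots> = 2 ^ (n * CARD('d))" by (simp add: power_mult)
  finally have "2 ^ (n * CARD('d)) = (\<Sum>k\<in>?P. kern n ((\<chi> i. of_int (k i) / 2 ^ n) - x))" by simp
  also have "\<dots> \<le> (\<Sum>k\<in>A. kern n ((\<chi> i. of_int (k i) / 2 ^ n) - x))"
    using assms by (intro sum_mono2) (auto simp: kern_nonneg)
  finally show ?thesis .
qed

section \<open>Small cells\<close>

text \<open>Without atoms each point has a small ball of little mass; a Lebesgue number argument
  makes the radius uniform, with the factor 2 leaving room to move the centre.\<close>

lemma uniformly_small_balls:
  fixes \<mu> :: "'a::metric_space measure"
  assumes cp: "compact (UNIV :: 'a set)" and fin: "finite_measure \<mu>" and sets: "sets \<mu> = sets borel"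
    and atom: "\<And>x. emeasure \<mu> {x} = 0" and m: "0 < m"
  shows "\<exists>r>0. \<forall>x. measure \<mu> (cball x r) \<le> m"
proof -
  interpret finite_measure \<mu> by (rule fin)
  have "\<exists>r>0. measure \<mu> (cball x (2 * r)) \<le> m" for x
  proof -
    have "(\<lambda>n. measure \<mu> (cball x (2 * (1 / real (Suc n))))) \<longlonglongrightarrow> measure \<mu> (\<Inter>n. cball x (2 * (1 / real (Suc n))))"
    proof (intro finite_Lim_measure_decseq)
      show "decseq (\<lambda>n. cball x (2 * (1 / real (Suc n))))"
        unfolding decseq_def by (intro allI impI subset_cball mult_left_mono frac_le) auto
    qed (auto simp: sets)
    also have "(\<Inter>n. cball x (2 * (1 / real (Suc n)))) = {x}"
    proof (intro equalityI subsetI)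
      fix y assume y: "y \<in> (\<Inter>n. cball x (2 * (1 / real (Suc n))))"
      show "y \<in> {x}"
      proof (rule ccontr)
        assume "y \<notin> {x}"
        then have "0 < dist x y / 2" by auto
        then obtain n where "inverse (real (Suc n)) < dist x y / 2" using reals_Archimedean by blast
        moreover have "dist x y \<le> 2 * (1 / real (Suc n))" using y by (simp only: INT_iff mem_cball) blast
        ultimately show False by (simp add: inverse_eq_divide)
      qed
    qed auto
    also have "measure \<mu> {x} = 0" using atom by (simp add: measure_def)
    finally have "\<forall>\<^sub>F n in sequentially. measure \<mu> (cball x (2 * (1 / real (Suc n)))) < m"
      using m by (rule order_tendstoD)
    then obtain n where "measure \<mu> (cball x (2 * (1 / real (Suc n)))) < m" by (auto simp: eventually_sequentially)
    then show ?thesis by (intro exI[of _ "1 / real (Suc n)"]) auto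
  qed
  then obtain r where r: "\<And>x. 0 < r x" "\<And>x. measure \<mu> (cball x (2 * r x)) \<le> m" by metis
  have "(UNIV :: 'a set) \<subseteq> (\<Union>x\<in>UNIV. ball x (r x))" using r(1) by auto
  then obtain D where D: "finite D" "(UNIV :: 'a set) \<subseteq> (\<Union>x\<in>D. ball x (r x))"
    using compactE_image[OF cp, of UNIV "\<lambda>x. ball x (r x)"] by auto
  then have ne: "D \<noteq> {}" by auto
  define r0 where "r0 = Min (r ` D)"
  have "r0 > 0" using D ne r by (auto simp: r0_def)
  moreover have "measure \<mu> (cball x r0) \<le> m" for x
  proof -
    have "x \<in> (\<Union>x\<in>D. ball x (r x))" using D(2) by blast
    then obtain z where z: "z \<in> D" "dist z x < r z" by auto
    have "r0 \<le> r z" using D z by (auto simp: r0_def)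
    have "cball x r0 \<subseteq> cball z (2 * r z)"
    proof
      fix y assume "y \<in> cball x r0"
      then show "y \<in> cball z (2 * r z)" using z \<open>r0 \<le> r z\<close> dist_triangle[of z y x] unfolding mem_cball by linarith
    qed
    then have "measure \<mu> (cball x r0) \<le> measure \<mu> (cball z (2 * r z))"
      by (intro finite_measure_mono) (auto simp: sets)
    then show ?thesis using r(2)[of z] by linarith
  qed
  ultimately show ?thesis by blast
qed

text \<open>The annulus contains the transition zone of a cutoff that is 1 on the closed ball and 0
  off the larger one; its mass is the price of continuity.\<close>

lemma thin_annulus:
  fixes \<mu> :: "'a::metric_space measure"
  assumes fin: "finite_measure \<mu>" and sets: "sets \<mu> = sets borel" and e: "0 < e"
  shows "\<exists>r'>r. measure \<mu> (ball z r' - cball z r) \<le> e"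
proof -
  interpret finite_measure \<mu> by (rule fin)
  have "(\<lambda>n. measure \<mu> (ball z (r + 1 / real (Suc n)) - cball z r)) \<longlonglongrightarrow> measure \<mu> (\<Inter>n. ball z (r + 1 / real (Suc n)) - cball z r)"
  proof (intro finite_Lim_measure_decseq)
    show "decseq (\<lambda>n. ball z (r + 1 / real (Suc n)) - cball z r)"
      unfolding decseq_def by (intro allI impI Diff_mono subset_ball add_left_mono frac_le) auto
  qed (auto simp: sets)
  also have "(\<Inter>n. ball z (r + 1 / real (Suc n)) - cball z r) = {}"
  proof -
    have False if y: "\<forall>n. dist z y < r + 1 / real (Suc n)" "r < dist z y" for y
    proof -
      obtain n where "inverse (real (Suc n)) < dist z y - r" using reals_Archimedean[of "dist z y - r"] y(2) by auto
      then show False using y(1)[rule_format, of n] by (simp add: inverse_eq_divide)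
    qed
    then show ?thesis by (force simp: not_le)
  qed
  finally have "\<forall>\<^sub>F n in sequentially. measure \<mu> (ball z (r + 1 / real (Suc n)) - cball z r) < e"
    using e by (intro order_tendstoD) auto
  then obtain n where "measure \<mu> (ball z (r + 1 / real (Suc n)) - cball z r) < e" by (auto simp: eventually_sequentially)
  then show ?thesis by (intro exI[of _ "r + 1 / real (Suc n)"]) auto
qed

lemma sum_partition_telescope:
  fixes b :: "nat \<Rightarrow> real"
  shows "(\<Sum>j<N. b j * (\<Prod>i<j. 1 - b i)) = 1 - (\<Prod>i<N. 1 - b i)"
  by (induction N) (auto simp: algebra_simps)

text \<open>
  The cells are the sets \<open>{\<phi> j = 1}\<close>; they are disjoint because the \<open>\<phi> j\<close> sum to at most one.
\<close>

lemma partition_into_small_cells: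
  fixes \<mu> :: "'a::metric_space measure"
  assumes cp: "compact (UNIV :: 'a set)" and fin: "finite_measure \<mu>" and sets: "sets \<mu> = sets borel"
    and atom: "\<And>x. emeasure \<mu> {x} = 0" and m: "0 < m" and e: "0 < e"
  shows "\<exists>N (\<phi> :: nat \<Rightarrow> 'a \<Rightarrow> real). (\<forall>j. continuous_on UNIV (\<phi> j)) \<and> (\<forall>j x. 0 \<le> \<phi> j x) \<and>
    (\<forall>x. (\<Sum>j<N. \<phi> j x) \<le> 1) \<and> (\<forall>j. measure \<mu> {x. \<phi> j x = 1} \<le> m) \<and>
    measure \<mu> {x. \<forall>j<N. \<phi> j x \<noteq> 1} \<le> e"
proof -
  interpret finite_measure \<mu> by (rule fin)
  obtain r where r: "0 < r" "\<And>x. measure \<mu> (cball x r) \<le> m"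
    using uniformly_small_balls[OF cp fin sets atom m] by blast
  have "(UNIV :: 'a set) \<subseteq> (\<Union>x\<in>UNIV. ball x r)" using r(1) by auto
  then obtain D where D: "finite D" "(UNIV :: 'a set) \<subseteq> (\<Union>x\<in>D. ball x r)"
    using compactE_image[OF cp, of UNIV "\<lambda>x. ball x r"] by auto
  define N where "N = card D"
  obtain h where h: "bij_betw h {0..<N} D" using ex_bij_betw_nat_finite[OF D(1)] unfolding N_def by blast
  have cov: "\<exists>j<N. x \<in> ball (h j) r" for x
  proof -
    obtain z where "z \<in> D" "x \<in> ball z r" using D(2) by blast
    moreover then have "z \<in> h ` {0..<N}" using h by (simp add: bij_betw_def)
    ultimately show ?thesis by auto
  qed
  have "N > 0" using cov[of undefined] by auto
  have "\<forall>j. \<exists>r'>r. measure \<mu> (ball (h j) r' - cball (h j) r) \<le> e / N"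
    using thin_annulus[OF fin sets] e \<open>N > 0\<close> by simp
  then obtain r' where r': "\<And>j. r < r' j" "\<And>j. measure \<mu> (ball (h j) (r' j) - cball (h j) r) \<le> e / N" by metis
  define b where "b j x = max 0 (min 1 ((r' j - dist (h j) x) / (r' j - r)))" for j x
  have b01: "0 \<le> b j x" "b j x \<le> 1" for j x by (auto simp: b_def)
  have b1: "b j x = 1 \<longleftrightarrow> dist (h j) x \<le> r" for j x
    using r'(1)[of j] by (auto simp: b_def min_def max_def divide_simps split: if_splits)
  have b0: "b j x = 0 \<longleftrightarrow> r' j \<le> dist (h j) x" for j x
    using r'(1)[of j] by (auto simp: b_def min_def max_def divide_simps split: if_splits)
  \<comment> \<open>Multiplying by the complements of the earlier cutoffs makes the sum telescope to
    at most one. Since all factors are at most one, \<open>\<phi> j x = 1\<close> forces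
    \<open>b j x = 1\<close>, so the cell sits in a ball of small mass.\<close>
  define \<phi> where "\<phi> j x = b j x * (\<Prod>i<j. 1 - b i x)" for j x
  have cont_b: "continuous_on UNIV (b j)" for j
    unfolding b_def using r'(1)[of j] by (intro continuous_intros) auto
  have cont: "continuous_on UNIV (\<phi> j)" for j
    unfolding \<phi>_def by (intro continuous_intros cont_b)
  have prod01: "0 \<le> (\<Prod>i<j. 1 - b i x)" "(\<Prod>i<j. 1 - b i x) \<le> 1" for j x
    using b01 by (auto intro!: prod_nonneg prod_le_1)
  have nonneg: "0 \<le> \<phi> j x" for j x using b01 prod01 by (simp add: \<phi>_def)
  have "(\<Sum>j<N. \<phi> j x) \<le> 1" for x
    unfolding \<phi>_def sum_partition_telescope using prod01 by simp
  moreover have "measure \<mu> {x. \<phi> j x = 1} \<le> m" for j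
  proof -
    have "{x. \<phi> j x = 1} \<subseteq> cball (h j) r"
    proof
      fix x assume "x \<in> {x. \<phi> j x = 1}"
      then have "1 = b j x * (\<Prod>i<j. 1 - b i x)" by (simp add: \<phi>_def)
      also have "\<dots> \<le> b j x * 1" using b01 prod01 by (intro mult_left_mono) auto
      finally have "b j x = 1" using b01(2)[of j x] by simp
      then show "x \<in> cball (h j) r" by (simp add: b1)
    qed
    then have "measure \<mu> {x. \<phi> j x = 1} \<le> measure \<mu> (cball (h j) r)"
      by (intro finite_measure_mono) (auto simp: sets)
    then show ?thesis using r(2)[of "h j"] by linarith
  qed
  moreover have "measure \<mu> {x. \<forall>j<N. \<phi> j x \<noteq> 1} \<le> e"
  proof -
    have "{x. \<forall>j<N. \<phi> j x \<noteq> 1} \<subseteq> (\<Union>j<N. ball (h j) (r' j) - cball (h j) r)"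
    proof
      fix x assume x: "x \<in> {x. \<forall>j<N. \<phi> j x \<noteq> 1}"
      \<comment> \<open>The first cutoff that does not vanish at \<open>x\<close> decides: the
        earlier factors are all 1, so \<open>\<phi> j x\<close> equals \<open>b j x\<close>, and a
        value other than 1 places \<open>x\<close> in the annulus of \<open>j\<close>.\<close>
      define j where "j = (LEAST j. b j x \<noteq> 0)"
      obtain j0 where j0: "j0 < N" "x \<in> ball (h j0) r" using cov by blast
      then have "b j0 x \<noteq> 0" using b1[of j0 x] by auto
      then have bj: "b j x \<noteq> 0" and "j \<le> j0"
        unfolding j_def by (rule LeastI[where P="\<lambda>j. b j x \<noteq> 0"], rule Least_le)
      have "b i x = 0" if "i < j" for i using that not_less_Least unfolding j_def by blast
      then have "\<phi> j x = b j x" by (simp add: \<phi>_def)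
      then have "b j x \<noteq> 1" using x \<open>j \<le> j0\<close> j0(1) by auto
      then have "x \<in> ball (h j) (r' j) - cball (h j) r" using bj b0[of j x] b1[of j x] by auto
      then show "x \<in> (\<Union>j<N. ball (h j) (r' j) - cball (h j) r)" using \<open>j \<le> j0\<close> j0(1) by auto
    qed
    then have "measure \<mu> {x. \<forall>j<N. \<phi> j x \<noteq> 1} \<le> measure \<mu> (\<Union>j<N. ball (h j) (r' j) - cball (h j) r)"
      by (intro finite_measure_mono) (auto simp: sets)
    also have "\<dots> \<le> (\<Sum>j<N. measure \<mu> (ball (h j) (r' j) - cball (h j) r))"
      by (intro finite_measure_subadditive_finite) (auto simp: sets)
    also have "\<dots> \<le> (\<Sum>j<N. e / N)" using r'(2) by (intro sum_mono) auto
    also have "\<dots> = e" using \<open>N > 0\<close> by simp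
    finally show ?thesis .
  qed
  ultimately show ?thesis using cont nonneg by blast
qed

section \<open>The random map\<close>

text \<open>Outcomes are coded as natural numbers, a countable discrete space, so
  \<open>coins\<close> lives on the Borel sets of a product topology and continuous functions of the
  coins are measurable.\<close>

definition coin :: "'d::finite itself \<Rightarrow> nat measure" where
  "coin _ = measure_pmf (map_pmf to_nat (pmf_of_set (UNIV :: ('d \<Rightarrow> bool \<times> bool) set)))"

definition coins :: "'d::finite itself \<Rightarrow> (nat \<times> nat \<Rightarrow> nat) measure" where
  "coins d = PiM UNIV (\<lambda>_. coin d)"

definition step :: "nat \<Rightarrow> real ^ 'd" where
  "step k = bits (from_nat k)"

lemma prob_space_coin: "prob_space (coin d)"
  unfolding coin_def by (rule prob_space_measure_pmf)

lemma sets_coin: "sets (coin d) = sets borel"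
  by (simp add: coin_def sets_borel_eq_count_space)

lemma prob_space_coins: "prob_space (coins d)"
  unfolding coins_def by (intro prob_space_PiM prob_space_coin)

lemma sets_coins: "sets (coins d) = sets borel"
proof -
  have "sets (coins d) = sets (PiM UNIV (\<lambda>_::nat \<times> nat. borel :: nat measure))"
    unfolding coins_def by (intro sets_PiM_cong refl sets_coin)
  then show ?thesis by (simp add: sets_PiM_equal_borel)
qed

lemma space_coins: "space (coins d) = UNIV"
  using sets_eq_imp_space_eq[OF sets_coins] by simp

lemma coin_integral:
  "(\<integral>k. F (step k) \<partial>coin TYPE('d::finite)) = (\<Sum>e\<in>UNIV. F (bits e :: real ^ 'd)) / CARD('d \<Rightarrow> bool \<times> bool)"
  for F :: "real ^ 'd \<Rightarrow> real"
  unfolding coin_def step_def by (simp add: integral_map_pmf integral_pmf_of_set)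

lemma norm_bits_le: "norm (bits e :: real ^ 'd) \<le> CARD('d)"
proof -
  have "(\<Sum>i\<in>UNIV. \<bar>(bits e :: real ^ 'd) $ i\<bar>) \<le> (\<Sum>i\<in>(UNIV :: 'd set). 1)"
    by (intro sum_mono bits_bound)
  then show ?thesis using norm_le_l1_cart[of "bits e :: real ^ 'd"] by simp
qed

text \<open>Redrawing coordinate \<open>c\<close> with a fresh coin preserves the product law. This
  replaces conditioning on all other coins.\<close>

lemma coins_resample:
  fixes F :: "(nat \<times> nat \<Rightarrow> nat) \<Rightarrow> real"
  assumes F: "F \<in> borel_measurable borel" and bound: "\<And>w. \<bar>F w\<bar> \<le> b"
  shows "(\<integral>w. F w \<partial>coins d) = (\<integral>w. (\<integral>k. F (w(c := k)) \<partial>coin d) \<partial>coins d)"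
proof -
  interpret C: prob_space "coin d" by (rule prob_space_coin)
  interpret Q: prob_space "coins d" by (rule prob_space_coins)
  interpret pair_prob_space "coin d" "coins d" ..
  have eq: "distr (coin d \<Otimes>\<^sub>M coins d) (coins d) (\<lambda>(k, w). w(c := k)) = coins d"
    using distr_pair_PiM_eq_PiM[of UNIV "\<lambda>_. coin d" c] unfolding coins_def by (simp add: prob_space_coin)
  have upd: "(\<lambda>(k, w). w(c := k)) \<in> measurable (coin d \<Otimes>\<^sub>M coins d) (coins d)"
    unfolding coins_def case_prod_unfold by (rule measurable_fun_upd[of _ UNIV]) auto
  have F': "F \<in> borel_measurable (coins d)"
    using F measurable_cong_sets[OF sets_coins refl] by blast
  have "(\<integral>w. F w \<partial>coins d) = (\<integral>w. F w \<partial>distr (coin d \<Otimes>\<^sub>M coins d) (coins d) (\<lambda>(k, w). w(c := k)))"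
    unfolding eq ..
  also have "\<dots> = (\<integral>(k, w). F (w(c := k)) \<partial>(coin d \<Otimes>\<^sub>M coins d))"
    by (subst integral_distr[OF upd F']) (simp add: case_prod_unfold)
  also have "\<dots> = (\<integral>w. (\<integral>k. F (w(c := k)) \<partial>coin d) \<partial>coins d)"
  proof (rule integral_snd[symmetric])
    have "(\<lambda>p. F (case p of (k, w) \<Rightarrow> w(c := k))) \<in> borel_measurable (coin d \<Otimes>\<^sub>M coins d)"
      using measurable_compose[OF upd F'] by simp
    then show "integrable (coin d \<Otimes>\<^sub>M coins d) (\<lambda>(k, w). F (w(c := k)))"
      using bound by (intro P.integrable_const_bound[where B=b]) (auto simp: case_prod_unfold)
  qed
  finally show ?thesis .
qed

lemma coins_orthogonal:
  fixes V W :: "(nat \<times> nat \<Rightarrow> nat) \<Rightarrow> real"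
  assumes V: "V \<in> borel_measurable borel" "\<And>w. \<bar>V w\<bar> \<le> a"
    and W: "W \<in> borel_measurable borel" "\<And>w. \<bar>W w\<bar> \<le> b"
    and centred: "\<And>w. (\<integral>k. V (w(c := k)) \<partial>coin d) = 0"
    and indep: "\<And>w k. W (w(c := k)) = W w"
  shows "(\<integral>w. V w * W w \<partial>coins d) = 0"
proof -
  have "(\<integral>w. V w * W w \<partial>coins d) = (\<integral>w. (\<integral>k. V (w(c := k)) * W (w(c := k)) \<partial>coin d) \<partial>coins d)"
  proof (rule coins_resample[where b="a * b"])
    show "(\<lambda>w. V w * W w) \<in> borel_measurable borel" using V(1) W(1) by measurable
    show "\<bar>V w * W w\<bar> \<le> a * b" for w
    proof -
      have "0 \<le> a" using V(2)[of w] by linarith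
      then show ?thesis unfolding abs_mult using V(2) W(2) by (intro mult_mono) auto
    qed
  qed
  then show ?thesis by (simp add: indep centred)
qed

text \<open>The image under \<open>g\<close> of mu restricted to \<open>B\<close>, convolved with
  \<open>kern n\<close> and evaluated at \<open>y\<close>.\<close>

definition dens :: "'k measure \<Rightarrow> nat \<Rightarrow> 'k set \<Rightarrow> real ^ 'd \<Rightarrow> ('k \<Rightarrow> real ^ 'd) \<Rightarrow> real" where
  "dens \<mu> n B y g = (\<integral>x. indicator B x * kern n (y - g x) \<partial>\<mu>)"

locale cell_system = finite_measure \<mu>
  for \<mu> :: "'k::metric_space measure" +
  fixes N :: "nat \<Rightarrow> nat" and \<phi> :: "nat \<Rightarrow> nat \<Rightarrow> 'k \<Rightarrow> real"
  assumes sets_\<mu>: "sets \<mu> = sets borel"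
    and \<phi>_cont: "\<And>l j. continuous_on UNIV (\<phi> l j)" and \<phi>_nonneg: "\<And>l j x. 0 \<le> \<phi> l j x"
    and \<phi>_sum: "\<And>l x. (\<Sum>j<N l. \<phi> l j x) \<le> 1"
begin

lemma space_\<mu>: "space \<mu> = UNIV"
  using sets_eq_imp_space_eq[OF sets_\<mu>] by simp

lemma dens_integrable:
  fixes g :: "'k \<Rightarrow> real ^ 'd"
  assumes "B \<in> sets borel" "continuous_on UNIV g"
  shows "integrable \<mu> (\<lambda>x. indicator B x * kern n (y - g x))"
proof (rule integrable_const_bound[where B="2 ^ (n * CARD('d))"])
  have "(\<lambda>x. indicator B x * kern n (y - g x)) \<in> borel_measurable borel"
    using assms by (intro borel_measurable_times borel_measurable_indicator borel_measurable_continuous_onI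
        continuous_on_compose2[OF continuous_on_kern] continuous_intros) auto
  then show "(\<lambda>x. indicator B x * kern n (y - g x)) \<in> borel_measurable \<mu>"
    using measurable_cong_sets[OF sets_\<mu> refl] by blast
  show "AE x in \<mu>. norm (indicator B x * kern n (y - g x)) \<le> 2 ^ (n * CARD('d))"
    by (intro AE_I2) (auto simp: indicator_def abs_of_nonneg kern_nonneg kern_le)
qed

lemma dens_nonneg: "0 \<le> dens \<mu> n B y g"
  unfolding dens_def by (intro Bochner_Integration.integral_nonneg mult_nonneg_nonneg kern_nonneg) auto

lemma dens_le:
  fixes g :: "'k \<Rightarrow> real ^ 'd"
  assumes "B \<in> sets borel" "continuous_on UNIV g"
  shows "dens \<mu> n B y g \<le> 2 ^ (n * CARD('d)) * measure \<mu> B"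
proof -
  have "integrable \<mu> (indicator B :: 'k \<Rightarrow> real)"
    using assms(1) by (intro integrable_real_indicator) (auto simp: sets_\<mu> less_top[symmetric])
  then have "dens \<mu> n B y g \<le> (\<integral>x. 2 ^ (n * CARD('d)) * indicator B x \<partial>\<mu>)"
    unfolding dens_def using assms
    by (intro integral_mono dens_integrable integrable_mult_right)
       (assumption | simp add: indicator_def kern_le)+
  also have "\<dots> = 2 ^ (n * CARD('d)) * measure \<mu> B" by (simp add: space_\<mu>)
  finally show ?thesis .
qed

lemma dens_lipschitz:
  fixes g h :: "'k \<Rightarrow> real ^ 'd"
  assumes "B \<in> sets borel" "continuous_on UNIV g" "continuous_on UNIV h"
    and "\<And>x. norm ((y - g x) - (z - h x)) \<le> e"
  shows "\<bar>dens \<mu> n B y g - dens \<mu> n B z h\<bar> \<le> kern_lip TYPE('d) n * measure \<mu> UNIV * e"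
proof -
  have e: "0 \<le> e" using assms(4) norm_ge_zero order_trans by blast
  have "\<bar>dens \<mu> n B y g - dens \<mu> n B z h\<bar> = \<bar>\<integral>x. indicator B x * kern n (y - g x) - indicator B x * kern n (z - h x) \<partial>\<mu>\<bar>"
    unfolding dens_def using assms by (subst Bochner_Integration.integral_diff) (auto intro: dens_integrable)
  also have "\<dots> \<le> (\<integral>x. \<bar>indicator B x * kern n (y - g x) - indicator B x * kern n (z - h x)\<bar> \<partial>\<mu>)"
    by (rule integral_abs_bound)
  also have "\<dots> \<le> (\<integral>x. kern_lip TYPE('d) n * e \<partial>\<mu>)"
  proof (intro integral_mono)
    show "integrable \<mu> (\<lambda>x. \<bar>indicator B x * kern n (y - g x) - indicator B x * kern n (z - h x)\<bar>)"
      using assms by (intro integrable_abs Bochner_Integration.integrable_diff dens_integrable) auto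
    fix x
    have "\<bar>kern n (y - g x) - kern n (z - h x)\<bar> \<le> kern_lip TYPE('d) n * norm ((y - g x) - (z - h x))"
      by (rule kern_lipschitz)
    also have "\<dots> \<le> kern_lip TYPE('d) n * e" using assms(4) kern_lip_pos[of n] by (intro mult_left_mono) (auto intro: less_imp_le)
    finally show "\<bar>indicator B x * kern n (y - g x) - indicator B x * kern n (z - h x)\<bar> \<le> kern_lip TYPE('d) n * e"
      using e kern_lip_pos[of n, where 'd='d] by (auto simp: indicator_def)
  qed simp
  also have "\<dots> = kern_lip TYPE('d) n * measure \<mu> UNIV * e" by (simp add: space_\<mu>)
  finally show ?thesis .
qed

text \<open>The deterministic form of the martingale property: one random step of level
  \<open>n\<close>, subtracted from \<open>y\<close>, compensates on average for the sharper
  kernel.\<close>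

lemma dens_refine:
  fixes g :: "'k \<Rightarrow> real ^ 'd"
  assumes "B \<in> sets borel" "continuous_on UNIV g"
  shows "dens \<mu> n B y g = (\<Sum>e\<in>UNIV. dens \<mu> (Suc n) B (y - (1/2) ^ Suc n *\<^sub>R bits e) g) / CARD('d \<Rightarrow> bool \<times> bool)"
proof -
  have "dens \<mu> n B y g = (\<integral>x. (\<Sum>e\<in>UNIV. indicator B x * kern (Suc n) ((y - (1/2) ^ Suc n *\<^sub>R bits e) - g x)) / CARD('d \<Rightarrow> bool \<times> bool) \<partial>\<mu>)"
    unfolding dens_def
  proof (intro Bochner_Integration.integral_cong refl)
    fix x
    have "kern n (y - g x) = (\<Sum>e\<in>UNIV. kern (Suc n) ((y - (1/2) ^ Suc n *\<^sub>R bits e) - g x)) / CARD('d \<Rightarrow> bool \<times> bool)"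
      by (subst kern_refine) (simp add: algebra_simps del: power_Suc)
    then show "indicator B x * kern n (y - g x) = (\<Sum>e\<in>UNIV. indicator B x * kern (Suc n) ((y - (1/2) ^ Suc n *\<^sub>R bits e) - g x)) / CARD('d \<Rightarrow> bool \<times> bool)"
      by (simp only: sum_distrib_left times_divide_eq_right)
  qed
  also have "\<dots> = (\<integral>x. (\<Sum>e\<in>UNIV. indicator B x * kern (Suc n) ((y - (1/2) ^ Suc n *\<^sub>R bits e) - g x)) \<partial>\<mu>) / CARD('d \<Rightarrow> bool \<times> bool)"
    by (rule integral_divide_zero)
  also have "\<dots> = (\<Sum>e\<in>UNIV. dens \<mu> (Suc n) B (y - (1/2) ^ Suc n *\<^sub>R bits e) g) / CARD('d \<Rightarrow> bool \<times> bool)"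
    unfolding dens_def using assms by (subst Bochner_Integration.integral_sum) (auto intro: dens_integrable)
  finally show ?thesis .
qed

lemma dens_mono:
  fixes g :: "'k \<Rightarrow> real ^ 'd"
  assumes "A \<subseteq> B" "A \<in> sets borel" "B \<in> sets borel" "continuous_on UNIV g"
  shows "dens \<mu> n A y g \<le> dens \<mu> n B y g"
  unfolding dens_def using assms
  by (intro integral_mono dens_integrable mult_right_mono kern_nonneg) (auto simp: indicator_def)

lemma dens_disjoint_union:
  fixes g :: "'k \<Rightarrow> real ^ 'd"
  assumes "finite I" "\<And>j. j \<in> I \<Longrightarrow> Q j \<in> sets borel" "disjoint_family_on Q I" "B \<in> sets borel" "B \<subseteq> (\<Union>j\<in>I. Q j)" "continuous_on UNIV g"
  shows "dens \<mu> n B y g = (\<Sum>j\<in>I. dens \<mu> n (B \<inter> Q j) y g)"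
proof -
  have "indicator B x = (\<Sum>j\<in>I. indicator (B \<inter> Q j) x :: real)" for x
  proof -
    have "B = (\<Union>j\<in>I. B \<inter> Q j)" using assms(5) by auto
    then have "indicator B x = (indicator (\<Union>j\<in>I. B \<inter> Q j) x :: real)" by simp
    also have "\<dots> = (\<Sum>j\<in>I. indicator (B \<inter> Q j) x)"
      using assms(1,3) by (intro indicator_UN_disjoint) (auto simp: disjoint_family_on_def)
    finally show ?thesis .
  qed
  then have "dens \<mu> n B y g = (\<integral>x. (\<Sum>j\<in>I. indicator (B \<inter> Q j) x * kern n (y - g x)) \<partial>\<mu>)"
    unfolding dens_def by (simp only: sum_distrib_right)
  also have "\<dots> = (\<Sum>j\<in>I. dens \<mu> n (B \<inter> Q j) y g)"
    unfolding dens_def using assms by (intro Bochner_Integration.integral_sum dens_integrable) auto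
  finally show ?thesis .
qed

lemma dens_cong:
  "(\<And>x. x \<in> B \<Longrightarrow> y - g x = z - h x) \<Longrightarrow> dens \<mu> n B y g = dens \<mu> n B z h"
  unfolding dens_def by (intro Bochner_Integration.integral_cong) (auto simp: indicator_def)

end

section \<open>The random series as an element of the space of bounded continuous maps\<close>

instance bcontfun :: (metric_space, banach) banach ..

lemma apply_bcontfun_sum:
  "apply_bcontfun (\<Sum>i\<in>I. f i) x = (\<Sum>i\<in>I. apply_bcontfun (f i) x)"
  by (induction I rule: infinite_finite_induct) auto

lemma continuous_on_coordinate: "continuous_on UNIV (\<lambda>w :: nat \<times> nat \<Rightarrow> nat. f (w c))"
  by (rule continuous_on_compose2[of UNIV f]) auto

lemma geometric_half_tail: "n \<le> m \<Longrightarrow> (\<Sum>l=n..<m. (1/2::real) ^ Suc l) = (1/2) ^ n - (1/2) ^ m"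
  by (induction m rule: dec_induct) auto

context cell_system
begin

definition cell :: "nat \<Rightarrow> nat \<Rightarrow> 'k set" where
  "cell l j = {x. \<phi> l j x = 1}"

text \<open>Boundedness, and with it the meaning of \<open>Bcontfun\<close>, is secured by
  \<open>apply_piece\<close> for \<open>j < N l\<close>; \<open>level\<close> sums just these
  pieces.\<close>

definition piece :: "nat \<Rightarrow> nat \<Rightarrow> nat \<Rightarrow> 'k \<Rightarrow>\<^sub>C (real ^ 'd)" where
  "piece l j k = Bcontfun (\<lambda>x. \<phi> l j x *\<^sub>R step k)"

definition level :: "nat \<Rightarrow> (nat \<times> nat \<Rightarrow> nat) \<Rightarrow> 'k \<Rightarrow>\<^sub>C (real ^ 'd)" where
  "level l w = (\<Sum>j<N l. piece l j (w (l, j)))"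

definition part :: "nat \<Rightarrow> (nat \<times> nat \<Rightarrow> nat) \<Rightarrow> 'k \<Rightarrow>\<^sub>C (real ^ 'd)" where
  "part n w = (\<Sum>l<n. (1/2) ^ Suc l *\<^sub>R level l w)"

definition total :: "(nat \<times> nat \<Rightarrow> nat) \<Rightarrow> 'k \<Rightarrow>\<^sub>C (real ^ 'd)" where
  "total w = (\<Sum>l. (1/2) ^ Suc l *\<^sub>R level l w)"

lemma \<phi>_le_1: "j < N l \<Longrightarrow> \<phi> l j x \<le> 1"
proof -
  assume "j < N l"
  then have "\<phi> l j x \<le> (\<Sum>j<N l. \<phi> l j x)" using \<phi>_nonneg by (intro member_le_sum) auto
  then show ?thesis using \<phi>_sum[of l x] by linarith
qed

lemma apply_piece:
  assumes "j < N l"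
  shows "apply_bcontfun (piece l j k :: 'k \<Rightarrow>\<^sub>C (real ^ 'd)) = (\<lambda>x. \<phi> l j x *\<^sub>R step k)"
  unfolding piece_def
proof (rule Bcontfun_inverse, rule bcontfun_normI)
  show "continuous_on UNIV (\<lambda>x. \<phi> l j x *\<^sub>R step k :: real ^ 'd)"
    by (intro continuous_intros \<phi>_cont)
  show "norm (\<phi> l j x *\<^sub>R step k :: real ^ 'd) \<le> 1 * real CARD('d)" for x
    unfolding norm_scaleR step_def using \<phi>_nonneg \<phi>_le_1[OF assms] norm_bits_le
    by (intro mult_mono) auto
qed

lemma apply_level: "apply_bcontfun (level l w) x = (\<Sum>j<N l. \<phi> l j x *\<^sub>R step (w (l, j)))"
  unfolding level_def apply_bcontfun_sum by (intro sum.cong) (auto simp: apply_piece)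

lemma level_component: "\<bar>apply_bcontfun (level l w) x $ i\<bar> \<le> 1"
proof -
  have "\<bar>apply_bcontfun (level l w) x $ i\<bar> \<le> (\<Sum>j<N l. \<bar>\<phi> l j x * step (w (l, j)) $ i\<bar>)"
    unfolding apply_level by (simp add: sum_abs)
  also have "\<dots> \<le> (\<Sum>j<N l. \<phi> l j x * 1)"
    unfolding abs_mult step_def using \<phi>_nonneg by (intro sum_mono mult_mono bits_bound) auto
  also have "\<dots> \<le> 1" using \<phi>_sum by simp
  finally show ?thesis .
qed

lemma norm_level: "norm (level l w :: 'k \<Rightarrow>\<^sub>C (real ^ 'd)) \<le> CARD('d)"
proof (rule norm_bound)
  fix x
  have "(\<Sum>i\<in>UNIV. \<bar>apply_bcontfun (level l w :: 'k \<Rightarrow>\<^sub>C (real ^ 'd)) x $ i\<bar>) \<le> (\<Sum>i\<in>(UNIV :: 'd set). 1)"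
    by (intro sum_mono level_component)
  then show "norm (apply_bcontfun (level l w :: 'k \<Rightarrow>\<^sub>C (real ^ 'd)) x) \<le> CARD('d)"
    using norm_le_l1_cart[of "apply_bcontfun (level l w :: 'k \<Rightarrow>\<^sub>C (real ^ 'd)) x"] by simp
qed

text \<open>The weights are nonnegative with sum at most one, so where one of them is 1 the others
  vanish and the level reduces to a single coin.\<close>

lemma level_eq_on_cell:
  assumes "j < N l" "x \<in> cell l j"
  shows "apply_bcontfun (level l w) x = step (w (l, j))"
proof -
  have 1: "\<phi> l j x = 1" using assms(2) by (simp add: cell_def)
  have "(\<Sum>i<N l. \<phi> l i x) = \<phi> l j x + (\<Sum>i\<in>{..<N l} - {j}. \<phi> l i x)"
    using assms(1) by (intro sum.remove) auto
  then have "(\<Sum>i\<in>{..<N l} - {j}. \<phi> l i x) = 0"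
    using \<phi>_sum[of l x] 1 sum_nonneg[of "{..<N l} - {j}" "\<lambda>i. \<phi> l i x"] \<phi>_nonneg by force
  then have 0: "\<phi> l i x = 0" if "i < N l" "i \<noteq> j" for i
    using that \<phi>_nonneg by (subst (asm) sum_nonneg_eq_0_iff) auto
  have "(\<Sum>i<N l. \<phi> l i x *\<^sub>R step (w (l, i))) = (\<Sum>i\<in>{j}. \<phi> l i x *\<^sub>R step (w (l, i)))"
    using assms(1) 0 by (intro sum.mono_neutral_right) auto
  then show ?thesis unfolding apply_level using 1 by simp
qed

lemma disjoint_cells: "disjoint_family_on (cell l) {..<N l}"
  unfolding disjoint_family_on_def
proof (intro ballI impI)
  fix i j assume ij: "i \<in> {..<N l}" "j \<in> {..<N l}" "i \<noteq> j"
  show "cell l i \<inter> cell l j = {}"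
  proof (rule ccontr)
    assume "cell l i \<inter> cell l j \<noteq> {}"
    then obtain x where "\<phi> l i x = 1" "\<phi> l j x = 1" by (auto simp: cell_def)
    moreover have "(\<Sum>i\<in>{i, j}. \<phi> l i x) \<le> (\<Sum>i<N l. \<phi> l i x)"
      using ij \<phi>_nonneg by (intro sum_mono2) auto
    ultimately show False using ij(3) \<phi>_sum[of l x] by simp
  qed
qed

lemma closed_cell: "closed (cell l j)"
  unfolding cell_def by (intro closed_Collect_eq \<phi>_cont continuous_intros)

lemma part_Suc: "part (Suc n) w = part n w + (1/2) ^ Suc n *\<^sub>R level n w"
  by (simp add: part_def)

lemma part_diff:
  assumes "n \<le> m"
  shows "part m w - part n w = (\<Sum>l=n..<m. (1/2) ^ Suc l *\<^sub>R level l w)"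
  using assms unfolding part_def lessThan_atLeast0
  by (subst sum_diff_nat_ivl) auto

lemma part_tendsto: "(\<lambda>n. part n w :: 'k \<Rightarrow>\<^sub>C (real ^ 'd)) \<longlonglongrightarrow> total w"
proof -
  have "summable (\<lambda>l. (1/2) ^ Suc l *\<^sub>R level l w :: 'k \<Rightarrow>\<^sub>C (real ^ 'd))"
  proof (rule summable_comparison_test'[where N=0])
    show "summable (\<lambda>l. (1/2::real) ^ Suc l * CARD('d))"
      using power_half_series by (intro summable_mult2 sums_summable)
    show "norm ((1/2) ^ Suc l *\<^sub>R level l w :: 'k \<Rightarrow>\<^sub>C (real ^ 'd)) \<le> (1/2::real) ^ Suc l * CARD('d)" for l
      unfolding norm_scaleR using norm_level by (intro mult_mono) auto
  qed
  then show ?thesis unfolding part_def total_def by (rule summable_LIMSEQ)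
qed

lemma total_component:
  "\<bar>(apply_bcontfun (total w) x - apply_bcontfun (part n w) x) $ i\<bar> \<le> (1/2) ^ n"
proof (rule LIMSEQ_le_const2)
  have "(\<lambda>m. apply_bcontfun (part m w) x) \<longlonglongrightarrow> apply_bcontfun (total w) x"
    using tendsto_bcontfun_uniform_limit[OF part_tendsto] by (rule tendsto_uniform_limitI) simp
  then show "(\<lambda>m. \<bar>(apply_bcontfun (part m w) x - apply_bcontfun (part n w) x) $ i\<bar>) \<longlonglongrightarrow>
      \<bar>(apply_bcontfun (total w) x - apply_bcontfun (part n w) x) $ i\<bar>"
    by (intro tendsto_intros)
  show "\<exists>M. \<forall>m\<ge>M. \<bar>(apply_bcontfun (part m w) x - apply_bcontfun (part n w) x) $ i\<bar> \<le> (1/2) ^ n"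
  proof (intro exI[of _ n] allI impI)
    fix m assume m: "n \<le> m"
    have "(apply_bcontfun (part m w) x - apply_bcontfun (part n w) x) $ i = apply_bcontfun (part m w - part n w) x $ i"
      by simp
    also have "\<dots> = (\<Sum>l=n..<m. (1/2) ^ Suc l * apply_bcontfun (level l w) x $ i)"
      unfolding part_diff[OF m] apply_bcontfun_sum by simp
    also have "\<bar>\<dots>\<bar> \<le> (\<Sum>l=n..<m. \<bar>(1/2) ^ Suc l * apply_bcontfun (level l w) x $ i\<bar>)" by (rule sum_abs)
    also have "\<dots> \<le> (\<Sum>l=n..<m. (1/2) ^ Suc l * 1)"
      unfolding abs_mult by (intro sum_mono mult_mono level_component) auto
    also have "\<dots> \<le> (1/2) ^ n" using geometric_half_tail[OF m] by simp
    finally show "\<bar>(apply_bcontfun (part m w) x - apply_bcontfun (part n w) x) $ i\<bar> \<le> (1/2) ^ n" .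
  qed
qed

lemma norm_total_diff: "norm (total w - part n w :: 'k \<Rightarrow>\<^sub>C (real ^ 'd)) \<le> CARD('d) * (1/2) ^ n"
proof (rule norm_bound)
  fix x
  have "(\<Sum>i\<in>UNIV. \<bar>apply_bcontfun (total w - part n w :: 'k \<Rightarrow>\<^sub>C (real ^ 'd)) x $ i\<bar>) \<le> (\<Sum>i\<in>(UNIV :: 'd set). (1/2) ^ n)"
    using total_component by (intro sum_mono) simp
  then show "norm (apply_bcontfun (total w - part n w :: 'k \<Rightarrow>\<^sub>C (real ^ 'd)) x) \<le> CARD('d) * (1/2) ^ n"
    using norm_le_l1_cart[of "apply_bcontfun (total w - part n w :: 'k \<Rightarrow>\<^sub>C (real ^ 'd)) x"] by simp
qed

lemma continuous_on_part: "continuous_on UNIV (part n)"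
  unfolding part_def level_def by (intro continuous_intros continuous_on_coordinate)

text \<open>Each \<open>part n\<close> depends on finitely many discrete coins, and the partial sums
  converge uniformly in \<open>w\<close>.\<close>

lemma continuous_on_total: "continuous_on UNIV (total :: _ \<Rightarrow> 'k \<Rightarrow>\<^sub>C (real ^ 'd))"
proof (rule uniform_limit_theorem)
  show "\<forall>\<^sub>F n in sequentially. continuous_on UNIV (part n :: _ \<Rightarrow> 'k \<Rightarrow>\<^sub>C (real ^ 'd))"
    by (intro always_eventually allI continuous_on_part)
  show "uniform_limit UNIV part (total :: _ \<Rightarrow> 'k \<Rightarrow>\<^sub>C (real ^ 'd)) sequentially"
  proof (rule uniform_limitI)
    fix e :: real assume "e > 0"
    have "(\<lambda>n. real CARD('d) * (1/2) ^ n) \<longlonglongrightarrow> real CARD('d) * 0"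
      by (intro tendsto_intros LIMSEQ_power_zero) auto
    then have "\<forall>\<^sub>F n in sequentially. CARD('d) * (1/2::real) ^ n < e"
      using \<open>e > 0\<close> by (intro order_tendstoD(2)[where a=e]) auto
    then show "\<forall>\<^sub>F n in sequentially. \<forall>w\<in>UNIV. dist (part n w :: 'k \<Rightarrow>\<^sub>C (real ^ 'd)) (total w) < e"
    proof eventually_elim
      case (elim n)
      then show ?case using norm_total_diff[of _ n, where 'd='d]
        by (auto simp: dist_norm norm_minus_commute intro: le_less_trans)
    qed
  qed
qed simp

lemma part_cong: "(\<And>l j. l < n \<Longrightarrow> v (l, j) = w (l, j)) \<Longrightarrow> part n v = part n w"
  unfolding part_def level_def by (intro sum.cong) auto

abbreviation path :: "nat \<Rightarrow> ('k \<Rightarrow>\<^sub>C (real ^ 'd)) \<Rightarrow> (nat \<times> nat \<Rightarrow> nat) \<Rightarrow> 'k \<Rightarrow> real ^ 'd" where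
  "path n g w \<equiv> apply_bcontfun (g + part n w)"

text \<open>
  The conditional density at \<open>y\<close> of the image under \<open>g + total\<close> of the measure restricted to \<open>B\<close>, given
  the coins of the levels below \<open>n\<close> (for \<open>B\<close> covered by the cells of all levels from \<open>n\<close> on).
\<close>

abbreviation occ :: "nat \<Rightarrow> 'k set \<Rightarrow> real ^ 'd \<Rightarrow> ('k \<Rightarrow>\<^sub>C (real ^ 'd)) \<Rightarrow> (nat \<times> nat \<Rightarrow> nat) \<Rightarrow> real" where
  "occ n B y g w \<equiv> dens \<mu> n B y (path n g w)"

abbreviation jump :: "nat \<Rightarrow> 'k set \<Rightarrow> real ^ 'd \<Rightarrow> ('k \<Rightarrow>\<^sub>C (real ^ 'd)) \<Rightarrow> (nat \<times> nat \<Rightarrow> nat) \<Rightarrow> real" where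
  "jump n B y g w \<equiv> \<bar>occ (Suc n) B y g w - occ n B y g w\<bar>"

lemma dens_lipschitz_bcontfun:
  fixes g h :: "'k \<Rightarrow>\<^sub>C (real ^ 'd)"
  assumes "B \<in> sets borel"
  shows "\<bar>dens \<mu> n B y (apply_bcontfun g) - dens \<mu> n B z (apply_bcontfun h)\<bar>
    \<le> kern_lip TYPE('d) n * measure \<mu> UNIV * (norm (y - z) + norm (g - h))"
proof (rule dens_lipschitz[OF assms])
  fix x
  have "norm ((y - apply_bcontfun g x) - (z - apply_bcontfun h x)) = norm ((y - z) - apply_bcontfun (g - h) x)"
    by (simp add: algebra_simps)
  also have "\<dots> \<le> norm (y - z) + norm (apply_bcontfun (g - h) x)" by (rule norm_triangle_ineq4)
  also have "norm (apply_bcontfun (g - h) x) \<le> norm (g - h)" by (rule norm_bounded)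
  finally show "norm ((y - apply_bcontfun g x) - (z - apply_bcontfun h x)) \<le> norm (y - z) + norm (g - h)" by simp
qed auto

lemma continuous_on_dens:
  assumes "B \<in> sets borel"
  shows "continuous_on UNIV (\<lambda>(y, g :: 'k \<Rightarrow>\<^sub>C (real ^ 'd)). dens \<mu> n B y (apply_bcontfun g))"
proof (rule continuous_onI)
  fix q :: "(real ^ 'd) \<times> ('k \<Rightarrow>\<^sub>C (real ^ 'd))" and e :: real
  assume e: "0 < e"
  obtain y g where q: "q = (y, g)" by force
  let ?L = "kern_lip TYPE('d) n * measure \<mu> UNIV + 1"
  have L: "0 < ?L" using kern_lip_pos[of n, where 'd='d] by (intro add_nonneg_pos) auto
  show "\<exists>d>0. \<forall>p\<in>UNIV. dist p q < d \<longrightarrow>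
      dist (case p of (y, g) \<Rightarrow> dens \<mu> n B y (apply_bcontfun g)) (case q of (y, g) \<Rightarrow> dens \<mu> n B y (apply_bcontfun g)) \<le> e"
  proof (intro exI[of _ "e / ?L / 2"] conjI ballI impI)
    show "0 < e / ?L / 2" using e L by simp
    fix p :: "(real ^ 'd) \<times> ('k \<Rightarrow>\<^sub>C (real ^ 'd))"
    assume d: "dist p q < e / ?L / 2"
    obtain z h where p: "p = (z, h)" by force
    note d = d[unfolded q]
    have "norm (z - y) \<le> e / ?L / 2" "norm (h - g) \<le> e / ?L / 2"
      using d dist_fst_le[of p "(y, g)"] dist_snd_le[of p "(y, g)"] by (auto simp: p dist_norm)
    then have "norm (z - y) + norm (h - g) \<le> e / ?L" by linarith
    then have "kern_lip TYPE('d) n * measure \<mu> UNIV * (norm (z - y) + norm (h - g)) \<le> ?L * (e / ?L)"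
      using kern_lip_pos[of n, where 'd='d] L e by (intro mult_mono) auto
    also have "\<dots> = e" using L by simp
    finally show "dist (case p of (y, g) \<Rightarrow> dens \<mu> n B y (apply_bcontfun g)) (case q of (y, g) \<Rightarrow> dens \<mu> n B y (apply_bcontfun g)) \<le> e"
      using dens_lipschitz_bcontfun[OF assms, of n z h y g] by (simp add: p q dist_real_def)
  qed
qed

lemma continuous_on_occ:
  fixes g :: "'x::topological_space \<Rightarrow> 'k \<Rightarrow>\<^sub>C (real ^ 'd)"
  assumes "B \<in> sets borel" "continuous_on A y" "continuous_on A g" "continuous_on A w"
  shows "continuous_on A (\<lambda>x. occ n B (y x) (g x) (w x))"
proof -
  have "continuous_on A (\<lambda>x. (y x, g x + part n (w x)))"
    using assms(2-4)
    by (intro continuous_on_Pair continuous_on_add continuous_on_compose2[OF continuous_on_part]) auto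
  from continuous_on_compose2[OF continuous_on_dens[OF assms(1), of n] this] show ?thesis by simp
qed

section \<open>Variance and tail bound of a martingale increment\<close>

lemma occ_increment_second_moment:
  fixes y :: "real ^ 'd" and g :: "'k \<Rightarrow>\<^sub>C (real ^ 'd)"
  assumes B: "B \<in> sets borel" "B \<subseteq> (\<Union>j<N n. cell n j)"
    and m: "\<And>j. measure \<mu> (cell n j) \<le> m"
  shows "(\<integral>w. (occ (Suc n) B y g w - occ n B y g w)\<^sup>2 \<partial>coins TYPE('d)) \<le> (2 ^ (Suc n * CARD('d)))\<^sup>2 * m * measure \<mu> UNIV"
proof -
  interpret P: prob_space "coins TYPE('d)" by (rule prob_space_coins)
  define K :: real where "K = 2 ^ (Suc n * CARD('d))"
  let ?B = "\<lambda>j. B \<inter> cell n j"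
  have bB: "?B j \<in> sets borel" for j using B(1) closed_cell by auto
  \<comment> \<open>On a cell, adding level \<open>n\<close> to the map is the same as subtracting
    its single step from \<open>y\<close>. Thus the term depends on the levels below
    \<open>n\<close> and on the one coin \<open>(n, j)\<close>.\<close>
  define V where "V j w = dens \<mu> (Suc n) (?B j) (y - (1/2) ^ Suc n *\<^sub>R step (w (n, j))) (path n g w)
      - dens \<mu> n (?B j) y (path n g w)" for j w
  have sum: "occ (Suc n) B y g w - occ n B y g w = (\<Sum>j<N n. V j w)" for w
  proof -
    have "occ (Suc n) B y g w = (\<Sum>j<N n. occ (Suc n) (?B j) y g w)"
      using B closed_cell disjoint_cells by (intro dens_disjoint_union continuous_on_apply_bcontfun) auto
    moreover have "occ n B y g w = (\<Sum>j<N n. occ n (?B j) y g w)"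
      using B closed_cell disjoint_cells by (intro dens_disjoint_union continuous_on_apply_bcontfun) auto
    moreover have "occ (Suc n) (?B j) y g w = dens \<mu> (Suc n) (?B j) (y - (1/2) ^ Suc n *\<^sub>R step (w (n, j))) (path n g w)"
      if "j < N n" for j
      using that by (intro dens_cong) (simp add: part_Suc level_eq_on_cell algebra_simps)
    ultimately show ?thesis by (simp add: V_def sum_subtractf)
  qed
  have Vb: "\<bar>V j w\<bar> \<le> K * measure \<mu> (?B j)" for j w
  proof -
    have "dens \<mu> n (?B j) y (path n g w) \<le> 2 ^ (n * CARD('d)) * measure \<mu> (?B j)"
      using bB by (intro dens_le continuous_on_apply_bcontfun)
    also have "\<dots> \<le> K * measure \<mu> (?B j)" unfolding K_def by (intro mult_right_mono power_increasing) auto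
    finally have "dens \<mu> n (?B j) y (path n g w) \<le> K * measure \<mu> (?B j)" .
    moreover have "dens \<mu> (Suc n) (?B j) (y - (1/2) ^ Suc n *\<^sub>R step (w (n, j))) (path n g w) \<le> K * measure \<mu> (?B j)"
      unfolding K_def using bB by (intro dens_le continuous_on_apply_bcontfun)
    ultimately show ?thesis unfolding V_def
      using dens_nonneg[of n "?B j" y "path n g w"]
        dens_nonneg[of "Suc n" "?B j" "y - (1/2) ^ Suc n *\<^sub>R step (w (n, j))" "path n g w"] by linarith
  qed
  have Vm: "V j \<in> borel_measurable borel" for j
  proof (rule borel_measurable_continuous_onI)
    have "continuous_on UNIV (\<lambda>w :: nat \<times> nat \<Rightarrow> nat. (y - (1/2) ^ Suc n *\<^sub>R step (w (n, j)) :: real ^ 'd, g + part n w))"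
      by (intro continuous_intros continuous_on_coordinate[of "step :: nat \<Rightarrow> real ^ 'd"] continuous_on_part)
    from continuous_on_compose2[OF continuous_on_dens[OF bB] this]
    have "continuous_on UNIV (\<lambda>w. dens \<mu> (Suc n) (?B j) (y - (1/2) ^ Suc n *\<^sub>R step (w (n, j))) (path n g w))"
      by simp
    moreover have "continuous_on UNIV (\<lambda>w. occ n (?B j) y g w)"
      by (intro continuous_on_occ bB continuous_intros continuous_on_id)
    ultimately show "continuous_on UNIV (V j)" unfolding V_def by (intro continuous_intros)
  qed
  \<comment> \<open>Resampling the coin \<open>(n, i)\<close> averages \<open>V i\<close> to zero by
    \<open>dens_refine\<close> and leaves \<open>V j\<close> alone, because \<open>part n\<close>
    reads only levels below \<open>n\<close>.\<close>
  have orth: "(\<integral>w. V i w * V j w \<partial>coins TYPE('d)) = 0" if "i \<noteq> j" for i j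
  proof (rule coins_orthogonal[where c="(n, i)"])
    show "V i \<in> borel_measurable borel" "V j \<in> borel_measurable borel" by (rule Vm)+
    show "\<bar>V i w\<bar> \<le> K * measure \<mu> (?B i)" "\<bar>V j w\<bar> \<le> K * measure \<mu> (?B j)" for w by (rule Vb)+
    have pc: "(part n (w((n, i) := k)) :: 'k \<Rightarrow>\<^sub>C (real ^ 'd)) = part n w" for w k by (rule part_cong) auto
    show "V j (w((n, i) := k)) = V j w" for w k using that by (simp add: V_def pc)
    show "(\<integral>k. V i (w((n, i) := k)) \<partial>coin TYPE('d)) = 0" for w
    proof -
      let ?h = "path n g w"
      have "(\<integral>k. V i (w((n, i) := k)) \<partial>coin TYPE('d)) =
          (\<integral>k. (\<lambda>v. dens \<mu> (Suc n) (?B i) (y - (1/2) ^ Suc n *\<^sub>R v) ?h - dens \<mu> n (?B i) y ?h) (step k) \<partial>coin TYPE('d))"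
        by (simp add: V_def pc)
      also have "\<dots> = (\<Sum>e\<in>UNIV. dens \<mu> (Suc n) (?B i) (y - (1/2) ^ Suc n *\<^sub>R bits e) ?h - dens \<mu> n (?B i) y ?h) / CARD('d \<Rightarrow> bool \<times> bool)"
        by (rule coin_integral)
      also have "\<dots> = 0"
        using dens_refine[OF bB[of i] continuous_on_apply_bcontfun, of n y "g + part n w"]
        by (simp add: sum_subtractf diff_divide_distrib del: power_Suc)
      finally show ?thesis .
    qed
  qed
  have int: "integrable (coins TYPE('d)) (\<lambda>w. V i w * V j w)" for i j
  proof (rule P.integrable_const_bound[where B="(K * measure \<mu> (?B i)) * (K * measure \<mu> (?B j))"])
    have "norm (V i w * V j w) \<le> (K * measure \<mu> (?B i)) * (K * measure \<mu> (?B j))" for w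
      unfolding real_norm_def abs_mult using Vb order_trans[OF abs_ge_zero Vb] by (intro mult_mono) auto
    then show "AE w in coins TYPE('d). norm (V i w * V j w) \<le> (K * measure \<mu> (?B i)) * (K * measure \<mu> (?B j))" by simp
    have "(\<lambda>w. V i w * V j w) \<in> borel_measurable borel" using Vm by measurable
    then show "(\<lambda>w. V i w * V j w) \<in> borel_measurable (coins TYPE('d))"
      using measurable_cong_sets[OF sets_coins refl] by blast
  qed
  have "(\<integral>w. (occ (Suc n) B y g w - occ n B y g w)\<^sup>2 \<partial>coins TYPE('d)) =
      (\<integral>w. (\<Sum>i<N n. \<Sum>j<N n. V i w * V j w) \<partial>coins TYPE('d))"
    unfolding sum power2_eq_square sum_product ..
  also have "\<dots> = (\<Sum>i<N n. \<Sum>j<N n. \<integral>w. V i w * V j w \<partial>coins TYPE('d))"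
    by (simp add: Bochner_Integration.integral_sum Bochner_Integration.integrable_sum int)
  also have "\<dots> = (\<Sum>i<N n. \<integral>w. V i w * V i w \<partial>coins TYPE('d))"
  proof (rule sum.cong[OF refl])
    fix i assume "i \<in> {..<N n}"
    then show "(\<Sum>j<N n. \<integral>w. V i w * V j w \<partial>coins TYPE('d)) = (\<integral>w. V i w * V i w \<partial>coins TYPE('d))"
      using orth by (subst sum.remove[of _ i]) (auto intro!: sum.neutral)
  qed
  also have "\<dots> \<le> (\<Sum>i<N n. K\<^sup>2 * m * measure \<mu> (?B i))"
  proof (rule sum_mono)
    fix i
    \<comment> \<open>Of the two factors \<open>measure \<mu> (?B i)\<close> in the bound for the
      square, one is replaced by \<open>m\<close>; the other is kept, since its sum over the
      disjoint cells is at most the total mass.\<close>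
    have mi: "measure \<mu> (?B i) \<le> m"
      using m[of i] finite_measure_mono[of "?B i" "cell n i"] closed_cell by (force simp: sets_\<mu>)
    have "(\<integral>w. V i w * V i w \<partial>coins TYPE('d)) \<le> (\<integral>w. K\<^sup>2 * m * measure \<mu> (?B i) \<partial>coins TYPE('d))"
    proof (intro integral_mono int)
      fix w
      have "V i w * V i w \<le> (K * measure \<mu> (?B i)) * (K * measure \<mu> (?B i))"
        using Vb[of i w] order_trans[OF abs_ge_zero Vb] abs_le_square_iff[of "V i w" "K * measure \<mu> (?B i)"]
        by (simp add: power2_eq_square)
      also have "\<dots> \<le> (K * m) * (K * measure \<mu> (?B i))"
        using mi by (intro mult_right_mono mult_left_mono) (auto simp: K_def)
      finally show "V i w * V i w \<le> K\<^sup>2 * m * measure \<mu> (?B i)" by (simp add: power2_eq_square mult_ac)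
    qed simp
    then show "(\<integral>w. V i w * V i w \<partial>coins TYPE('d)) \<le> K\<^sup>2 * m * measure \<mu> (?B i)"
      by (simp add: P.prob_space)
  qed
  also have "\<dots> = K\<^sup>2 * m * (\<Sum>i<N n. measure \<mu> (?B i))" by (simp add: sum_distrib_left)
  also have "\<dots> \<le> K\<^sup>2 * m * measure \<mu> UNIV"
  proof (rule mult_left_mono)
    have "(\<Sum>i<N n. measure \<mu> (?B i)) = measure \<mu> (\<Union>i<N n. ?B i)"
      using disjoint_cells[of n] bB by (intro finite_measure_finite_Union[symmetric])
        (auto simp: sets_\<mu> disjoint_family_on_def)
    also have "\<dots> \<le> measure \<mu> UNIV" using bB by (intro finite_measure_mono) (auto simp: sets_\<mu>)
    finally show "(\<Sum>i<N n. measure \<mu> (?B i)) \<le> measure \<mu> UNIV" .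
    have "0 \<le> m" using m[of 0] measure_nonneg[of \<mu> "cell n 0"] by linarith
    then show "0 \<le> K\<^sup>2 * m" by simp
  qed
  finally show ?thesis by (simp add: K_def)
qed

lemma occ_increment_prob:
  fixes y :: "real ^ 'd" and g :: "'k \<Rightarrow>\<^sub>C (real ^ 'd)"
  assumes B: "B \<in> sets borel" "B \<subseteq> (\<Union>j<N n. cell n j)"
    and m: "\<And>j. measure \<mu> (cell n j) \<le> m" and \<eta>: "0 < \<eta>"
  shows "measure (coins TYPE('d)) {w. \<eta> \<le> jump n B y g w} \<le>
    (2 ^ (Suc n * CARD('d)))\<^sup>2 * m * measure \<mu> UNIV / \<eta>\<^sup>2"
proof -
  interpret P: prob_space "coins TYPE('d)" by (rule prob_space_coins)
  let ?D = "\<lambda>w. occ (Suc n) B y g w - occ n B y g w"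
  let ?M = "measure \<mu> UNIV"
  have cont: "continuous_on UNIV ?D"
    by (intro continuous_intros continuous_on_occ B continuous_on_id)
  have bound: "\<bar>?D w\<bar> \<le> 2 ^ (Suc n * CARD('d)) * ?M + 2 ^ (n * CARD('d)) * ?M" for w
  proof -
    have "dens \<mu> k B y (apply_bcontfun h) \<le> 2 ^ (k * CARD('d)) * ?M" for k h
    proof -
      have "dens \<mu> k B y (apply_bcontfun h) \<le> 2 ^ (k * CARD('d)) * measure \<mu> B"
        using B by (intro dens_le continuous_on_apply_bcontfun)
      also have "\<dots> \<le> 2 ^ (k * CARD('d)) * ?M"
        by (intro mult_left_mono finite_measure_mono) (auto simp: sets_\<mu>)
      finally show ?thesis .
    qed
    then show ?thesis
      using dens_nonneg[of n B y "path n g w"] dens_nonneg[of "Suc n" B y "apply_bcontfun (g + part (Suc n) w)"]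
      by (smt (verit))
  qed
  have "integrable (coins TYPE('d)) (\<lambda>w. (?D w)\<^sup>2)"
  proof (rule P.integrable_const_bound)
    show "AE w in coins TYPE('d). norm ((?D w)\<^sup>2) \<le> (2 ^ (Suc n * CARD('d)) * ?M + 2 ^ (n * CARD('d)) * ?M)\<^sup>2"
    proof (rule AE_I2)
      fix w
      have "\<bar>?D w\<bar>\<^sup>2 \<le> (2 ^ (Suc n * CARD('d)) * ?M + 2 ^ (n * CARD('d)) * ?M)\<^sup>2"
        using bound by (rule power_mono) simp
      then show "norm ((?D w)\<^sup>2) \<le> (2 ^ (Suc n * CARD('d)) * ?M + 2 ^ (n * CARD('d)) * ?M)\<^sup>2"
        by (simp only: real_norm_def power_abs)
    qed
    have "(\<lambda>w. (?D w)\<^sup>2) \<in> borel_measurable borel"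
      by (intro borel_measurable_continuous_onI continuous_on_power cont)
    then show "(\<lambda>w. (?D w)\<^sup>2) \<in> borel_measurable (coins TYPE('d))"
      using measurable_cong_sets[OF sets_coins refl] by blast
  qed
  then have "measure (coins TYPE('d)) {w \<in> space (coins TYPE('d)). \<eta>\<^sup>2 \<le> (?D w)\<^sup>2} \<le> (\<integral>w. (?D w)\<^sup>2 \<partial>coins TYPE('d)) / \<eta>\<^sup>2"
    using \<eta> by (intro integral_Markov_inequality_measure[where A="{}"]) auto
  also have "{w \<in> space (coins TYPE('d)). \<eta>\<^sup>2 \<le> (?D w)\<^sup>2} = {w. \<eta> \<le> \<bar>?D w\<bar>}"
    using \<eta> by (simp add: space_coins abs_le_square_iff[symmetric])
  also have "(\<integral>w. (?D w)\<^sup>2 \<partial>coins TYPE('d)) / \<eta>\<^sup>2 \<le> (2 ^ (Suc n * CARD('d)))\<^sup>2 * m * ?M / \<eta>\<^sup>2"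
    using occ_increment_second_moment[OF B m, of y g] by (intro divide_right_mono) auto
  finally show ?thesis .
qed

end

section \<open>The Borel set of good maps\<close>

text \<open>
  Balls of radius \<open>2\<^sup>-\<^sup>k\<close> are tested from level \<open>n \<approx> sqrt k\<close> on. Then the crude bound \<open>2\<^sup>n\<^sup>d\<close> for the
  kernel at that level is \<open>2\<^sup>o\<^sup>(\<^sup>k\<^sup>)\<close>, and the cubic exponent in \<open>incr\<close> keeps all later errors
  below every power \<open>2\<^sup>-\<^sup>k\<^sup>s\<close>.
\<close>

definition tests :: "(nat \<Rightarrow> 'k::metric_space set) \<Rightarrow> nat \<Rightarrow> 'k set set" where
  "tests Z n = insert UNIV (\<Union>k\<le>(n+1)^2. (\<lambda>z. ball z (2 * (1/2)^k)) ` Z k)"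

text \<open>The summand \<open>n + 3\<close> makes the tripled increments that
  \<open>occ_step\<close> allows sum to at most \<open>tail n\<close>:
  \<open>3 * (1/2)^(j+3)\<close> is three quarters of \<open>(1/2)^Suc j\<close>.\<close>

definition incr :: "nat \<Rightarrow> real" where
  "incr n = (1/2) ^ ((n+1)^3 + n + 3)"

definition tail :: "nat \<Rightarrow> real" where
  "tail n = (1/2) ^ ((n+1)^3)"

lemma incr_pos: "0 < incr n"
  by (simp add: incr_def)

lemma tail_pos: "0 < tail n"
  by (simp add: tail_def)

lemma tail_le: "tail n \<le> (1/2) ^ n"
proof -
  have "n \<le> (n+1)^3" using self_le_power[of "n+1" 3] by linarith
  then show ?thesis unfolding tail_def by (intro power_decreasing) auto
qed

lemma tail_tendsto: "tail \<longlonglongrightarrow> 0"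
proof (rule tendsto_sandwich[OF _ _ tendsto_const])
  show "(\<lambda>n. (1/2::real) ^ n) \<longlonglongrightarrow> 0" by (intro LIMSEQ_power_zero) auto
qed (auto simp: tail_le less_imp_le[OF tail_pos])

lemma sum_incr_le:
  assumes "n \<le> m"
  shows "(\<Sum>j=n..<m. 3 * incr j) \<le> tail n"
proof -
  have "(\<Sum>j=n..<m. 3 * incr j) \<le> (\<Sum>j=n..<m. tail n * (3/4 * (1/2) ^ Suc j))"
  proof (rule sum_mono)
    fix j assume "j \<in> {n..<m}"
    then have "(1/2::real) ^ ((j+1)^3) \<le> tail n"
      unfolding tail_def by (intro power_decreasing power_mono) auto
    then have "(1/2::real) ^ ((j+1)^3) * (1/2) ^ (j+3) \<le> tail n * (1/2) ^ (j+3)" by (intro mult_right_mono) auto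
    then have "incr j \<le> tail n * (1/2) ^ (j+3)"
      unfolding incr_def by (simp only: power_add[symmetric] add.assoc)
    then show "3 * incr j \<le> tail n * (3/4 * (1/2) ^ Suc j)" by (simp add: power_add power3_eq_cube)
  qed
  also have "\<dots> = tail n * (3/4 * (\<Sum>j=n..<m. (1/2) ^ Suc j))" by (simp only: sum_distrib_left)
  also have "\<dots> = tail n * (3/4 * ((1/2) ^ n - (1/2) ^ m))"
    using geometric_half_tail[OF assms] by (simp only:)
  also have "\<dots> \<le> tail n * 1"
  proof (intro mult_left_mono)
    have half: "3/4 * (a - b) \<le> 1" if "a \<le> 1" "0 \<le> b" for a b :: real using that by (simp add: field_simps)
    show "3/4 * ((1/2::real) ^ n - (1/2) ^ m) \<le> 1"
      by (rule half; intro power_le_one zero_le_power) simp_all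
  qed (rule less_imp_le[OF tail_pos])
  finally show ?thesis by simp
qed

lemma finite_tests: "(\<And>k. finite (Z k)) \<Longrightarrow> finite (tests Z n)"
  by (simp add: tests_def)

lemma tests_mono: "n \<le> m \<Longrightarrow> tests Z n \<subseteq> tests Z m"
proof -
  assume "n \<le> m"
  then have "(n+1)^2 \<le> (m+1)^2" by (intro power_mono) auto
  then have sub: "{..(n+1)^2} \<subseteq> {..(m+1)^2}" by simp
  show ?thesis unfolding tests_def by (intro Set.insert_mono UN_mono sub subset_refl)
qed

lemma tests_borel: "D \<in> tests Z n \<Longrightarrow> D \<in> sets borel"
  by (auto simp: tests_def)

text \<open>The sets \<open>G\<close> and the nets \<open>Z\<close>, \<open>Y\<close> come first.
  \<open>m_small\<close> involves only the number of tests at level \<open>n\<close>, so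
  \<open>m\<close> can be fixed next and the cells last. There is no circularity although a test set
  \<open>D \<inter> core i\<close> depends on the cells of all levels from \<open>i\<close> on:
  \<open>core i\<close> enters the count only through the index \<open>i \<le> n\<close>. The bound
  itself is Chebyshev's estimate times the number of tests, made summable.\<close>

locale tested_cells = cell_system \<mu> N \<phi>
  for \<mu> :: "'k::metric_space measure" and N \<phi> +
  fixes G :: "nat \<Rightarrow> 'k set" and Z :: "nat \<Rightarrow> 'k set" and Y :: "nat \<Rightarrow> (real ^ 'd) set" and m :: "nat \<Rightarrow> real"
  assumes compact_K: "compact (UNIV :: 'k set)"
    and uncovered: "\<And>l. measure \<mu> {x. \<forall>j<N l. \<phi> l j x \<noteq> 1} \<le> (1/2) ^ l"
    and closed_G: "\<And>i. closed (G i)" and measure_G: "\<And>i. measure \<mu> (- G i) \<le> (1/2) ^ i"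
    and G_hausdorff: "\<And>i q. 0 < q \<Longrightarrow> ereal q < hausdorff_dim_measure \<mu> \<Longrightarrow> \<exists>k0. \<forall>k\<ge>k0. G i \<subseteq> low_ball \<mu> q k"
    and G_packing: "\<And>i q b. 0 < q \<Longrightarrow> ereal q < packing_dim_measure \<mu> \<Longrightarrow>
      \<exists>J. finite J \<and> J \<subseteq> {b..} \<and> G i \<subseteq> (\<Union>k\<in>J. low_ball \<mu> q k)"
    and finite_Z: "\<And>k. finite (Z k)" and net_Z: "\<And>k x. \<exists>z\<in>Z k. dist z x < (1/2) ^ k"
    and finite_Y: "\<And>n. finite (Y n)"
    and net_Y: "\<And>n y. norm y \<le> real n \<Longrightarrow>
      \<exists>z\<in>Y n. (kern_lip TYPE('d) n + kern_lip TYPE('d) (Suc n)) * measure \<mu> UNIV * norm (y - z) \<le> incr n"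
    and small_cells: "\<And>l j. measure \<mu> {x. \<phi> l j x = 1} \<le> m l"
    and m_small: "\<And>n. real (card (tests Z n \<times> {..n} \<times> Y n)) * ((2 ^ (Suc n * CARD('d)))\<^sup>2 * m n * measure \<mu> UNIV / (incr n)\<^sup>2) \<le> (1/2) ^ n"
begin

text \<open>Being covered by the cells of every level from \<open>i\<close> on is what makes each
  increment at a level \<open>n >= i\<close> a sum over cells. The lost mass is \<open>2^-i\<close>
  from \<open>G i\<close> and a geometric tail \<open>2 * 2^-i\<close> from the gaps.\<close>

definition core :: "nat \<Rightarrow> 'k set" where
  "core i = G i \<inter> (\<Inter>l\<in>{i..}. \<Union>j<N l. cell l j)"

lemma closed_core: "closed (core i)"
  unfolding core_def using closed_cell by (intro closed_Int closed_G closed_INT ballI closed_UN) auto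

lemma compact_core: "compact (core i)"
  using compact_Int_closed[OF compact_K closed_core] by simp

lemma core_covered: "i \<le> l \<Longrightarrow> core i \<subseteq> (\<Union>j<N l. cell l j)"
  by (auto simp: core_def)

lemma borel_core: "D \<in> sets borel \<Longrightarrow> D \<inter> core i \<in> sets borel"
  using closed_core by auto

lemma measure_core: "measure \<mu> (- core i) \<le> 3 * (1/2) ^ i"
proof -
  let ?X = "\<lambda>l. - (\<Union>j<N l. cell l j)"
  have X: "?X l = {x. \<forall>j<N l. \<phi> l j x \<noteq> 1}" for l by (auto simp: cell_def)
  have bX: "?X l \<in> sets borel" for l using closed_cell by (intro borel_comp sets.finite_UN) auto
  have S: "(\<lambda>l. (1/2::real) ^ (l + i)) sums (2 * (1/2) ^ i)"
    using sums_mult2[OF geometric_sums[of "1/2::real"], of "(1/2)^i"] by (simp add: power_add)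
  have sm: "summable (\<lambda>l. measure \<mu> (?X (l + i)))"
    unfolding X by (rule summable_comparison_test'[OF sums_summable[OF S], of 0]) (simp add: uncovered)
  have "- core i = - G i \<union> (\<Union>l. ?X (l + i))"
  proof -
    have "(\<Inter>l\<in>{i..}. \<Union>j<N l. cell l j) = (\<Inter>l. \<Union>j<N (l + i). cell (l + i) j)"
    proof (intro equalityI subsetI INT_I)
      fix x l assume "x \<in> (\<Inter>l. \<Union>j<N (l + i). cell (l + i) j)" "l \<in> {i..}"
      then have "x \<in> (\<Union>j<N (l - i + i). cell (l - i + i) j)" by blast
      then show "x \<in> (\<Union>j<N l. cell l j)" using \<open>l \<in> {i..}\<close> by simp
    qed (auto simp: INT_iff)
    then show ?thesis unfolding core_def Compl_Int by (simp only: Compl_INT)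
  qed
  then have "measure \<mu> (- core i) \<le> measure \<mu> (- G i) + measure \<mu> (\<Union>l. ?X (l + i))"
    using closed_G bX by (simp only:) (intro measure_subadditive, auto simp: sets_\<mu> simp del: Compl_UN)
  also have "measure \<mu> (\<Union>l. ?X (l + i)) \<le> (\<Sum>l. measure \<mu> (?X (l + i)))"
    using bX sm by (intro finite_measure_subadditive_countably) (auto simp: sets_\<mu> simp del: Compl_UN)
  also have "\<dots> \<le> (\<Sum>l. (1/2::real) ^ (l + i))"
    using uncovered by (intro suminf_le sm sums_summable[OF S]) (simp only: X)
  also have "\<dots> = 2 * (1/2) ^ i" using sums_unique[OF S] by simp
  finally show ?thesis using measure_G[of i] by simp
qed

definition tame :: "nat \<Rightarrow> ('k \<Rightarrow>\<^sub>C (real ^ 'd)) \<Rightarrow> (nat \<times> nat \<Rightarrow> nat) \<Rightarrow> bool" where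
  "tame n g w \<longleftrightarrow> (\<forall>D\<in>tests Z n. \<forall>i\<le>n. \<forall>y\<in>Y n.
     jump n (D \<inter> core i) y g w \<le> incr n)"

lemma AE_eventually_tame: "AE w in coins TYPE('d). \<forall>\<^sub>F n in sequentially. tame n g w"
proof -
  interpret P: prob_space "coins TYPE('d)" by (rule prob_space_coins)
  let ?I = "\<lambda>n. tests Z n \<times> {..n} \<times> Y n"
  let ?E = "\<lambda>n (D, i, y). {w. incr n \<le> jump n (D \<inter> core i) y g w}"
  define A where "A n = (\<Union>p\<in>?I n. ?E n p)" for n
  have finI: "finite (?I n)" for n using finite_tests[OF finite_Z] finite_Y by auto
  have closedE0: "closed (?E n (D, i, y))" if "D \<in> tests Z n" for n D i y
    using borel_core[OF tests_borel[OF that]] unfolding prod.case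
    by (intro closed_Collect_le continuous_intros continuous_on_occ continuous_on_id)
  have closedE: "closed (?E n p)" if "p \<in> ?I n" for n p
  proof -
    obtain D i y where p: "p = (D, i, y)" by (cases p)
    then have "D \<in> tests Z n" using that by simp
    then show ?thesis unfolding p by (rule closedE0)
  qed
  have clA: "closed (A n)" for n
    unfolding A_def using finI closedE by (intro closed_UN ballI)
  have meas: "A n \<in> sets (coins TYPE('d))" for n using clA by (simp add: sets_coins)
  have mA: "measure (coins TYPE('d)) (A n) \<le> (1/2) ^ n" for n
  proof -
    let ?b = "(2 ^ (Suc n * CARD('d)))\<^sup>2 * m n * measure \<mu> UNIV / (incr n)\<^sup>2"
    have "measure (coins TYPE('d)) (A n) \<le> (\<Sum>p\<in>?I n. measure (coins TYPE('d)) (?E n p))"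
      unfolding A_def
    proof (rule P.finite_measure_subadditive_finite[OF finI], rule image_subsetI)
      fix p assume "p \<in> ?I n"
      then show "?E n p \<in> sets (coins TYPE('d))" unfolding sets_coins by (intro borel_closed closedE)
    qed
    also have "\<dots> \<le> (\<Sum>p\<in>?I n. ?b)"
    proof (rule sum_mono)
      fix p assume "p \<in> ?I n"
      then obtain D i y where p: "p = (D, i, y)" "D \<in> tests Z n" "i \<le> n" "y \<in> Y n" by auto
      have "measure (coins TYPE('d)) {w. incr n \<le> jump n (D \<inter> core i) y g w} \<le> ?b"
      proof (rule occ_increment_prob)
        show "D \<inter> core i \<in> sets borel" by (rule borel_core[OF tests_borel[OF p(2)]])
        show "D \<inter> core i \<subseteq> (\<Union>j<N n. cell n j)" using core_covered[OF p(3)] by blast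
        show "measure \<mu> (cell n j) \<le> m n" for j using small_cells by (simp add: cell_def)
      qed (rule incr_pos)
      then show "measure (coins TYPE('d)) (?E n p) \<le> ?b" by (simp only: p(1) prod.case)
    qed
    also have "\<dots> = real (card (?I n)) * ?b" by (simp only: sum_constant)
    also have "\<dots> \<le> (1/2) ^ n" by (rule m_small)
    finally show ?thesis .
  qed
  have geo: "summable (\<lambda>n. (1/2::real) ^ n)" by (intro summable_geometric) simp
  have sA: "summable (\<lambda>n. measure (coins TYPE('d)) (A n))"
    by (rule summable_comparison_test'[OF geo, of 0]) (simp add: mA)
  have "AE w in coins TYPE('d). \<forall>\<^sub>F n in sequentially. w \<in> space (coins TYPE('d)) - A n"
    by (rule borel_cantelli_AE1[OF meas _ sA]) (simp add: less_top[symmetric])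
  then show ?thesis
  proof eventually_elim
    case (elim w)
    then show ?case
    proof (rule eventually_mono)
      fix n assume w: "w \<in> space (coins TYPE('d)) - A n"
      show "tame n g w"
        unfolding tame_def
      proof (intro ballI allI impI)
        fix D i y assume "D \<in> tests Z n" "i \<le> n" "y \<in> Y n"
        then have "w \<notin> ?E n (D, i, y)" using w unfolding A_def by blast
        then show "jump n (D \<inter> core i) y g w \<le> incr n" by simp
      qed
    qed
  qed
qed

lemma closed_tame: "closed {(w, f). tame n (f - total w) w}"
proof -
  have "{(w, f). tame n (f - total w) w} = (\<Inter>D\<in>tests Z n. \<Inter>i\<in>{..n}. \<Inter>y\<in>Y n.
      {p. \<bar>occ (Suc n) (D \<inter> core i) y (snd p - total (fst p)) (fst p) - occ n (D \<inter> core i) y (snd p - total (fst p)) (fst p)\<bar> \<le> incr n})"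
    unfolding tame_def by auto
  moreover have "closed {p. \<bar>occ (Suc n) (D \<inter> core i) y (snd p - total (fst p)) (fst p) - occ n (D \<inter> core i) y (snd p - total (fst p)) (fst p)\<bar> \<le> incr n}"
    if "D \<in> tests Z n" for D i y
    using borel_core[OF tests_borel[OF that]]
    by (intro closed_Collect_le continuous_intros continuous_on_occ continuous_on_compose2[OF continuous_on_total]) auto
  ultimately show ?thesis by (simp only:) (intro closed_INT ballI)
qed

text \<open>
  A good map is \<open>g + total w\<close> with \<open>g\<close> and \<open>w\<close> eventually tame. This set is \<open>F\<^sub>\<sigma>\<close> because \<open>w\<close> may be taken
  in the compact set \<open>codes\<close>, and projection along a compact factor is a closed map.
\<close>

definition codes :: "(nat \<times> nat \<Rightarrow> nat) set" where
  "codes = PiE UNIV (\<lambda>_. range (to_nat :: ('d \<Rightarrow> bool \<times> bool) \<Rightarrow> nat))"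

lemma compact_codes: "compact codes"
proof -
  have "compactin (product_topology (\<lambda>_. euclidean) UNIV) codes"
    unfolding codes_def compactin_PiE by (auto intro!: finite_imp_compact)
  then show ?thesis by (simp add: euclidean_product_topology)
qed

text \<open>\<open>step\<close> reads a coin only through \<open>from_nat\<close>, so re-encoding
  every value moves \<open>w\<close> into \<open>codes\<close> without changing the random
  map.\<close>

lemma codes_representative:
  "\<exists>v\<in>codes. total v = (total w :: 'k \<Rightarrow>\<^sub>C (real ^ 'd)) \<and> (\<forall>n. part n v = (part n w :: 'k \<Rightarrow>\<^sub>C (real ^ 'd)))"
proof -
  define v where "v c = to_nat (from_nat (w c) :: 'd \<Rightarrow> bool \<times> bool)" for c
  have "(step (v c) :: real ^ 'd) = step (w c)" for c by (simp add: step_def v_def)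
  then have "(level l v :: 'k \<Rightarrow>\<^sub>C (real ^ 'd)) = level l w" for l by (simp add: level_def piece_def)
  then show ?thesis by (intro bexI[of _ v]) (auto simp: total_def part_def codes_def v_def)
qed

definition good :: "('k \<Rightarrow>\<^sub>C (real ^ 'd)) set" where
  "good = (\<Union>n0. {f. \<exists>w\<in>codes. \<forall>n\<ge>n0. tame n (f - total w) w})"

lemma borel_good: "good \<in> sets borel"
proof -
  have "closed {f. \<exists>w\<in>codes. \<forall>n\<ge>n0. tame n (f - total w) w}" for n0
  proof -
    define T where "T = (\<Inter>n\<in>{n0..}. {(w, f). tame n (f - total w) w})"
    have "closed T" unfolding T_def by (intro closed_INT ballI closed_tame)
    then have "closedin (prod_topology (top_of_set codes) euclidean) (codes \<times> UNIV \<inter> T)"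
      by (simp add: prod_topology_subtopology prod_topology_euclidean closedin_closed_Int)
    moreover have "closed_map (prod_topology (top_of_set codes) euclidean) euclidean (snd :: _ \<Rightarrow> 'k \<Rightarrow>\<^sub>C (real ^ 'd))"
      using compact_codes by (intro closed_map_snd) (simp add: compact_space_subtopology)
    ultimately have "closed (snd ` (codes \<times> UNIV \<inter> T))" by (simp add: closed_map_def)
    also have "snd ` (codes \<times> UNIV \<inter> T) = {f. \<exists>w\<in>codes. \<forall>n\<ge>n0. tame n (f - total w) w}"
      by (force simp: T_def)
    finally show ?thesis .
  qed
  then show ?thesis unfolding good_def by (intro sets.countable_UN) auto
qed

text \<open>The shyness witnesses are the complement of \<open>good\<close> and the law of
  \<open>total\<close>. Translation by \<open>x\<close> amounts to \<open>g = - x\<close> in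
  \<open>AE_eventually_tame\<close>, which has probability one for each fixed
  \<open>g\<close>.\<close>

lemma prevalent_superset_good:
  assumes "good \<subseteq> P"
  shows "prevalent P"
proof -
  let ?\<nu> = "distr (coins TYPE('d)) borel (total :: _ \<Rightarrow> 'k \<Rightarrow>\<^sub>C (real ^ 'd))"
  interpret P: prob_space "coins TYPE('d)" by (rule prob_space_coins)
  have "total \<in> borel_measurable (borel :: (nat \<times> nat \<Rightarrow> nat) measure)"
    by (rule borel_measurable_continuous_onI[OF continuous_on_total])
  then have tm: "(total :: _ \<Rightarrow> 'k \<Rightarrow>\<^sub>C (real ^ 'd)) \<in> borel_measurable (coins TYPE('d))"
    using measurable_cong_sets[OF sets_coins refl] by blast
  have "emeasure ?\<nu> ((\<lambda>b. b + x) ` (- good)) = 0" for x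
  proof -
    have im: "(\<lambda>b. b + x) ` (- good) = (\<lambda>h. h - x) -` (- good)"
    proof (intro equalityI subsetI)
      fix h assume "h \<in> (\<lambda>h. h - x) -` (- good)"
      then show "h \<in> (\<lambda>b. b + x) ` (- good)" by (intro image_eqI[of _ _ "h - x"]) auto
    qed auto
    have "(\<lambda>h. h - x) -` (- good) \<inter> space borel \<in> sets borel"
      by (intro measurable_sets[OF borel_measurable_continuous_onI] continuous_intros)
         (use borel_good in auto)
    then have b: "(\<lambda>b. b + x) ` (- good) \<in> sets borel" by (simp add: im)
    have "AE w in coins TYPE('d). total w \<notin> (\<lambda>b. b + x) ` (- good)"
      using AE_eventually_tame[of "- x"]
    proof eventually_elim
      case (elim w)
      then obtain n0 where n0: "\<And>n. n \<ge> n0 \<Longrightarrow> tame n (- x) w" by (auto simp: eventually_sequentially)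
      obtain v where v: "v \<in> codes" "total v = (total w :: 'k \<Rightarrow>\<^sub>C (real ^ 'd))"
        "\<And>n. part n v = (part n w :: 'k \<Rightarrow>\<^sub>C (real ^ 'd))" using codes_representative by blast
      \<comment> \<open>Tameness sees the coins only through \<open>part\<close>, so it passes from
        \<open>w\<close> to its representative \<open>v\<close> in \<open>codes\<close>.\<close>
      have "tame n ((total w - x) - total v) v" if "n \<ge> n0" for n
        using n0[OF that] by (simp add: tame_def v)
      then have "total w - x \<in> good" using v(1) unfolding good_def by blast
      then show ?case by (simp add: im)
    qed
    then have "emeasure (coins TYPE('d)) {w \<in> space (coins TYPE('d)). \<not> total w \<notin> (\<lambda>b. b + x) ` (- good)} = 0"
      using measurable_sets[OF tm b] by (intro emeasure_eq_0_AE) simp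
    moreover have "total -` ((\<lambda>b. b + x) ` (- good)) \<inter> space (coins TYPE('d)) = {w \<in> space (coins TYPE('d)). \<not> total w \<notin> (\<lambda>b. b + x) ` (- good)}"
      by auto
    ultimately show ?thesis using emeasure_distr[OF tm b] by simp
  qed
  moreover have "prob_space ?\<nu>" by (rule P.prob_space_distr[OF tm])
  ultimately show ?thesis
    unfolding prevalent_def shy_def using assms borel_good
    by (intro exI[of _ "- good"] exI[of _ ?\<nu>]) auto
qed

end

section \<open>Fibres of good maps\<close>

context tested_cells
begin

text \<open>The points where the limit density of the image of \<open>core i\<close> is positive,
  phrased as an eventual lower bound so that the limit need not be named.\<close>

definition hit :: "('k \<Rightarrow>\<^sub>C (real ^ 'd)) \<Rightarrow> (nat \<times> nat \<Rightarrow> nat) \<Rightarrow> nat \<Rightarrow> (real ^ 'd) set" where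
  "hit g w i = {y. \<exists>c>0. \<forall>\<^sub>F p in sequentially. c \<le> occ p (core i) y g w}"

lemma occ_lipschitz:
  fixes y z :: "real ^ 'd"
  assumes "B \<in> sets borel"
  shows "\<bar>occ n B y g w - occ n B z g w\<bar> \<le> kern_lip TYPE('d) n * measure \<mu> UNIV * norm (y - z)"
  using dens_lipschitz_bcontfun[OF assms, of n y "g + part n w" z "g + part n w"] by simp

lemma total_approx: "norm (apply_bcontfun (g + total w) x - path n g w x) \<le> CARD('d) * (1/2) ^ n"
  for g :: "'k \<Rightarrow>\<^sub>C (real ^ 'd)"
proof -
  have "norm (apply_bcontfun (g + total w) x - path n g w x) = norm (apply_bcontfun (total w - part n w :: 'k \<Rightarrow>\<^sub>C (real ^ 'd)) x)"
    by simp
  also have "\<dots> \<le> norm (total w - part n w :: 'k \<Rightarrow>\<^sub>C (real ^ 'd))" by (rule norm_bounded)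
  also have "\<dots> \<le> CARD('d) * (1/2) ^ n" by (rule norm_total_diff)
  finally show ?thesis .
qed

end

locale tame_point = tested_cells \<mu> N \<phi> G Z Y m
  for \<mu> :: "'k::metric_space measure" and N \<phi> G Z and Y :: "nat \<Rightarrow> (real ^ 'd) set" and m +
  fixes g :: "'k \<Rightarrow>\<^sub>C (real ^ 'd)" and w :: "nat \<times> nat \<Rightarrow> nat" and n0 :: nat
  assumes tame: "\<And>n. n0 \<le> n \<Longrightarrow> tame n g w"
begin

text \<open>Tameness speaks of net points only. The Lipschitz constants of levels \<open>n\<close>
  and \<open>n + 1\<close> grow with \<open>n\<close>, but \<open>Y n\<close> is fine enough to
  absorb them.\<close>

lemma occ_step:
  assumes n: "n0 \<le> n" "i \<le> n" and D: "D \<in> tests Z n" and y: "norm y \<le> real n"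
  shows "jump n (D \<inter> core i) y g w \<le> 3 * incr n"
proof -
  let ?M = "measure \<mu> UNIV" and ?B = "D \<inter> core i"
  have B: "?B \<in> sets borel" by (rule borel_core[OF tests_borel[OF D]])
  obtain z where z: "z \<in> Y n" "(kern_lip TYPE('d) n + kern_lip TYPE('d) (Suc n)) * ?M * norm (y - z) \<le> incr n"
    using net_Y[OF y] by blast
  have "\<bar>occ (Suc n) ?B z g w - occ n ?B z g w\<bar> \<le> incr n"
    using tame[OF n(1)] D n(2) z(1) unfolding tame_def by blast
  moreover have "\<bar>occ n ?B y g w - occ n ?B z g w\<bar> + \<bar>occ (Suc n) ?B y g w - occ (Suc n) ?B z g w\<bar> \<le> incr n"
    using z(2) occ_lipschitz[OF B, of n y g w z] occ_lipschitz[OF B, of "Suc n" y g w z]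
    by (simp only: distrib_right)
  ultimately show ?thesis using incr_pos[of n] by linarith
qed

lemma occ_stable:
  assumes n: "n0 \<le> n" "i \<le> n" and D: "D \<in> tests Z n" and y: "norm y \<le> real n" and p: "n \<le> p"
  shows "\<bar>occ p (D \<inter> core i) y g w - occ n (D \<inter> core i) y g w\<bar> \<le> tail n"
proof -
  have "\<bar>occ p (D \<inter> core i) y g w - occ n (D \<inter> core i) y g w\<bar> \<le> (\<Sum>j=n..<p. 3 * incr j)"
    using p
  proof (induction p rule: dec_induct)
    case base
    then show ?case by simp
  next
    case (step p)
    have "\<bar>occ (Suc p) (D \<inter> core i) y g w - occ p (D \<inter> core i) y g w\<bar> \<le> 3 * incr p"
      using step.hyps n y D tests_mono[OF step.hyps(1), of Z] by (intro occ_step) auto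
    then show ?case using step by (simp only: sum.atLeastLessThan_Suc)
  qed
  then show ?thesis using sum_incr_le[OF p] by linarith
qed

lemma UNIV_test: "UNIV \<in> tests Z n"
  by (simp add: tests_def)

lemma occ_core_stable:
  assumes "n0 \<le> n" "i \<le> n" "norm y \<le> real n" "n \<le> p"
  shows "\<bar>occ p (core i) y g w - occ n (core i) y g w\<bar> \<le> tail n"
  using occ_stable[OF assms(1,2) UNIV_test assms(3,4)] by simp

text \<open>At one fixed level \<open>n\<close> with \<open>tail n\<close> below
  \<open>c / 4\<close> the density is Lipschitz in the point, so near \<open>y\<close> it stays
  above \<open>3 * c / 4\<close>; all later levels together change it by at most
  \<open>tail n\<close>.\<close>

lemma open_hit: "open (hit g w i)"
proof (subst open_subopen, intro ballI)
  fix y assume "y \<in> hit g w i"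
  then obtain c where c: "0 < c" "\<forall>\<^sub>F p in sequentially. c \<le> occ p (core i) y g w" by (auto simp: hit_def)
  have "\<forall>\<^sub>F p in sequentially. tail p < c / 4" using c(1) by (intro order_tendstoD(2)[OF tail_tendsto]) simp
  moreover have "\<forall>\<^sub>F p in sequentially. max n0 (max i (nat \<lceil>norm y + 1\<rceil>)) \<le> p" by (rule eventually_ge_at_top)
  ultimately have "\<forall>\<^sub>F p in sequentially. tail p < c / 4 \<and> n0 \<le> p \<and> i \<le> p \<and> norm y + 1 \<le> real p \<and> c \<le> occ p (core i) y g w"
    using c(2)
  proof eventually_elim
    case (elim p)
    then show ?case using real_nat_ceiling_ge[of "norm y + 1"] by (intro conjI) linarith+
  qed
  then obtain n where n: "tail n < c / 4" "n0 \<le> n" "i \<le> n" "norm y + 1 \<le> real n" "c \<le> occ n (core i) y g w"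
    by (auto simp: eventually_sequentially)
  let ?L = "kern_lip TYPE('d) n * measure \<mu> UNIV"
  have L: "0 \<le> ?L" using kern_lip_pos[of n, where 'd='d] by simp
  define r where "r = min 1 (c / 4 / (?L + 1))"
  have r: "0 < r" using c(1) L by (simp add: r_def)
  have "z \<in> hit g w i" if z: "z \<in> ball y r" for z
  proof -
    have d: "norm (y - z) < r" using z by (simp add: dist_norm)
    then have nz: "norm z \<le> real n"
      using n(4) norm_triangle_ineq2[of z y] norm_minus_commute[of y z] by (simp add: r_def)
    have "?L * norm (y - z) \<le> ?L * (c / 4 / (?L + 1))" using L d by (intro mult_left_mono) (simp_all add: r_def)
    also have "\<dots> \<le> c / 4" using L c(1) by (simp add: field_simps)
    finally have "\<bar>occ n (core i) y g w - occ n (core i) z g w\<bar> \<le> c / 4"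
      using occ_lipschitz[of "core i" n y g w z] closed_core by (auto intro: order_trans)
    then have "3 * c / 4 \<le> occ n (core i) z g w" using n(5) by linarith
    then have "c / 2 \<le> occ p (core i) z g w" if "n \<le> p" for p
      using occ_core_stable[OF n(2,3) nz that] n(1) by linarith
    then have "\<forall>\<^sub>F p in sequentially. c / 2 \<le> occ p (core i) z g w" by (rule eventually_sequentiallyI)
    then show ?thesis unfolding hit_def using half_gt_zero[OF c(1)] by blast
  qed
  then show "\<exists>T. open T \<and> y \<in> T \<and> T \<subseteq> hit g w i" using r by (intro exI[of _ "ball y r"]) auto
qed

text \<open>Off \<open>hit\<close> some later densities are arbitrarily close to 0, and all later
  densities lie within \<open>tail n\<close> of the one at level \<open>n\<close>.\<close>

lemma occ_le_off_hit:
  assumes "y \<notin> hit g w i" "n0 \<le> n" "i \<le> n" "norm y \<le> real n"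
  shows "occ n (core i) y g w \<le> tail n"
proof (rule field_le_epsilon)
  fix c :: real assume "0 < c"
  then have "\<exists>\<^sub>F p in sequentially. occ p (core i) y g w < c"
    using assms(1) by (auto simp: hit_def not_eventually not_le)
  then obtain p where "n \<le> p" "occ p (core i) y g w < c" by (auto simp: frequently_sequentially)
  then show "occ n (core i) y g w \<le> tail n + c"
    using occ_core_stable[OF assms(2-4), of p] by linarith
qed

lemma grid_box_card:
  fixes T :: real
  assumes "0 \<le> T"
  shows "real (card (PiE (UNIV :: 'd set) (\<lambda>_. {-\<lceil>T\<rceil>..\<lceil>T\<rceil>}))) \<le> (2 * T + 3) ^ CARD('d)"
proof -
  have "real (card {-\<lceil>T\<rceil>..\<lceil>T\<rceil>}) \<le> 2 * T + 3" using assms by simp linarith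
  then have "real (card {-\<lceil>T\<rceil>..\<lceil>T\<rceil>}) ^ CARD('d) \<le> (2 * T + 3) ^ CARD('d)" by (intro power_mono) auto
  then show ?thesis by (simp add: card_PiE)
qed

text \<open>
  Integer translates of the tent sum to one, so the mass of a set is recovered from the densities at
  the points of a grid; off \<open>hit\<close> these are small.
\<close>

lemma null_off_hit: "measure \<mu> (core i - apply_bcontfun (g + total w) -` hit g w i) = 0"
proof -
  let ?f = "apply_bcontfun (g + total w)" and ?d = "real CARD('d)" and ?M = "measure \<mu> UNIV"
  define S where "S = core i - ?f -` hit g w i"
  have bS: "S \<in> sets borel"
  proof -
    have "open (?f -` hit g w i)" by (intro open_vimage open_hit continuous_on_apply_bcontfun)
    then show ?thesis unfolding S_def using closed_core by auto
  qed
  define R where "R = norm (g + total w)"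
  have R: "norm (?f x) \<le> R" for x unfolding R_def by (rule norm_bounded)
  have R0: "0 \<le> R" by (simp add: R_def)
  define W where "W = 2 * (R + 2 * ?d) + 3"
  have W: "0 < W" using R0 by (simp add: W_def add_nonneg_pos)
  \<comment> \<open>Two levels are needed: densities are compared at level \<open>q\<close>, where
    the Lipschitz constant is fixed, while the grid has mesh \<open>2^-n\<close>. Then
    \<open>n\<close> tends to infinity first and \<open>q\<close> afterwards.\<close>
  have est: "measure \<mu> S \<le> W ^ CARD('d) * (2 * tail q + kern_lip TYPE('d) q * ?M * (2 * ?d * (1/2) ^ n))"
    if q: "n0 \<le> q" "i \<le> q" "R + 2 * ?d \<le> real q" and n: "q \<le> n" for q n
  proof -
    define pt where "pt k = (\<chi> j. of_int (k j) / 2 ^ n :: real ^ 'd)" for k :: "'d \<Rightarrow> int"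
    \<comment> \<open>The distance counts \<open>CARD('d) * 2^-n\<close> once for the support of the
      kernel and once for the rest of the series. Each selected grid point is thus near some
      \<open>?f x\<close> outside \<open>hit\<close>, where the density is small.\<close>
    define A where "A = {k. \<exists>x\<in>S. norm (pt k - ?f x) \<le> 2 * ?d * (1/2) ^ n}"
    define b where "b = 2 * tail q + kern_lip TYPE('d) q * ?M * (2 * ?d * (1/2) ^ n)"
    have half: "(1/2::real) ^ n \<le> 1" by (simp add: power_le_one)
    have pt_norm: "norm (pt k) \<le> R + 2 * ?d * (1/2) ^ n" if "k \<in> A" for k
    proof -
      obtain x where "norm (pt k - ?f x) \<le> 2 * ?d * (1/2) ^ n" using \<open>k \<in> A\<close> unfolding A_def by blast
      then show ?thesis using R[of x] norm_triangle_ineq2[of "pt k" "?f x"] by linarith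
    qed
    have pt_norm': "norm (pt k) \<le> R + 2 * ?d" if "k \<in> A" for k
    proof -
      have "2 * ?d * (1/2) ^ n \<le> 2 * ?d * 1" using half by (intro mult_left_mono) auto
      then show ?thesis using pt_norm[OF that] by linarith
    qed
    let ?T = "2 ^ n * (R + 2 * ?d)"
    have T0: "0 \<le> ?T" using R0 by simp
    have Abox: "A \<subseteq> PiE UNIV (\<lambda>_. {-\<lceil>?T\<rceil>..\<lceil>?T\<rceil>})"
    proof
      fix k assume "k \<in> A"
      have "k j \<in> {-\<lceil>?T\<rceil>..\<lceil>?T\<rceil>}" for j
      proof -
        have "\<bar>pt k $ j\<bar> \<le> R + 2 * ?d" using component_le_norm_cart[of "pt k" j] pt_norm'[OF \<open>k \<in> A\<close>] by linarith
        then have "\<bar>of_int (k j)\<bar> \<le> ?T" by (simp add: pt_def abs_divide field_simps)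
        then show ?thesis by (auto simp: abs_le_iff) linarith+
      qed
      then show "k \<in> PiE UNIV (\<lambda>_. {-\<lceil>?T\<rceil>..\<lceil>?T\<rceil>})" by auto
    qed
    have finbox: "finite (PiE (UNIV :: 'd set) (\<lambda>_. {-\<lceil>?T\<rceil>..\<lceil>?T\<rceil>}))" by (intro finite_PiE) auto
    have finA: "finite A" by (rule finite_subset[OF Abox finbox])
    \<comment> \<open>The factor \<open>2^(n d)\<close> in the number of grid points cancels against
      the same factor in \<open>kern_grid_sum\<close>, which leaves the constant
      \<open>W ^ CARD('d)\<close>.\<close>
    have cardA: "real (card A) \<le> (2 ^ n * W) ^ CARD('d)"
    proof -
      have "real (card A) \<le> real (card (PiE (UNIV :: 'd set) (\<lambda>_. {-\<lceil>?T\<rceil>..\<lceil>?T\<rceil>})))"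
        using card_mono[OF finbox Abox] by simp
      also have "\<dots> \<le> (2 * ?T + 3) ^ CARD('d)" by (rule grid_box_card[OF T0])
      also have "\<dots> \<le> (2 ^ n * W) ^ CARD('d)"
      proof (rule power_mono)
        have "(1::real) \<le> 2 ^ n" by simp
        then show "2 * ?T + 3 \<le> 2 ^ n * W" unfolding W_def by (simp add: algebra_simps)
      qed (use T0 in simp)
      finally show ?thesis .
    qed
    have occA: "dens \<mu> n S (pt k) (path n g w) \<le> b" if "k \<in> A" for k
    proof -
      obtain x where x: "x \<in> S" "norm (pt k - ?f x) \<le> 2 * ?d * (1/2) ^ n" using \<open>k \<in> A\<close> unfolding A_def by blast
      have bc: "core i \<in> sets borel" using closed_core by simp
      have "dens \<mu> n S (pt k) (path n g w) \<le> occ n (core i) (pt k) g w"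
        using bS bc by (intro dens_mono continuous_on_apply_bcontfun) (auto simp: S_def)
      also have "\<dots> \<le> occ q (core i) (pt k) g w + tail q"
        using occ_core_stable[OF q(1,2) order_trans[OF pt_norm'[OF that] q(3)] n] by linarith
      also have "occ q (core i) (pt k) g w \<le> occ q (core i) (?f x) g w + kern_lip TYPE('d) q * ?M * norm (pt k - ?f x)"
        using occ_lipschitz[OF bc, of q "pt k" g w "?f x"] by linarith
      also have "kern_lip TYPE('d) q * ?M * norm (pt k - ?f x) \<le> kern_lip TYPE('d) q * ?M * (2 * ?d * (1/2) ^ n)"
        using x(2) kern_lip_pos[of q, where 'd='d] by (intro mult_left_mono) auto
      also have "occ q (core i) (?f x) g w \<le> tail q"
      proof (rule occ_le_off_hit[OF _ q(1,2)])
        show "?f x \<notin> hit g w i" using x(1) by (simp add: S_def)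
        show "norm (?f x) \<le> real q" using R[of x] q(3) by (smt (verit) of_nat_0_le_iff)
      qed
      finally show ?thesis by (simp add: b_def)
    qed
    have grid: "2 ^ (n * CARD('d)) * indicator S x \<le> (\<Sum>k\<in>A. indicator S x * kern n (pt k - path n g w x))" for x
    proof (cases "x \<in> S")
      case True
      let ?v = "path n g w x"
      have "2 ^ (n * CARD('d)) \<le> (\<Sum>k\<in>A. kern n (pt k - ?v))"
        unfolding pt_def
      proof (rule kern_grid_sum[OF finA], rule subsetI)
        fix k assume k: "k \<in> PiE UNIV (\<lambda>i. {\<lfloor>2 ^ n * ?v $ i\<rfloor>, \<lfloor>2 ^ n * ?v $ i\<rfloor> + 1})"
        have "\<bar>(pt k - ?v) $ j\<bar> \<le> (1/2) ^ n" for j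
        proof -
          have "k j \<in> {\<lfloor>2 ^ n * ?v $ j\<rfloor>, \<lfloor>2 ^ n * ?v $ j\<rfloor> + 1}" using k by auto
          then have "\<bar>of_int (k j) - 2 ^ n * ?v $ j\<bar> \<le> 1" by (auto simp: abs_le_iff) linarith+
          moreover have "(pt k - ?v) $ j = (of_int (k j) - 2 ^ n * ?v $ j) / 2 ^ n"
            by (simp add: pt_def diff_divide_distrib)
          ultimately show ?thesis by (simp add: abs_divide power_divide divide_right_mono)
        qed
        then have "(\<Sum>j\<in>UNIV. \<bar>(pt k - ?v) $ j\<bar>) \<le> (\<Sum>j\<in>(UNIV :: 'd set). (1/2) ^ n)" by (intro sum_mono)
        then have "norm (pt k - ?v) \<le> ?d * (1/2) ^ n" using norm_le_l1_cart[of "pt k - ?v"] by simp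
        moreover have "norm (?v - ?f x) \<le> ?d * (1/2) ^ n"
          using total_approx[of g w x n] by (simp only: norm_minus_commute)
        ultimately have "norm (pt k - ?f x) \<le> ?d * (1/2) ^ n + ?d * (1/2) ^ n" by (rule norm_diff_triangle_le)
        then have "norm (pt k - ?f x) \<le> 2 * ?d * (1/2) ^ n" by linarith
        then show "k \<in> A" unfolding A_def using True by blast
      qed
      then show ?thesis using True by simp
    qed simp
    have intk: "integrable \<mu> (\<lambda>x. indicator S x * kern n (pt k - path n g w x))" for k
      using bS by (intro dens_integrable continuous_on_apply_bcontfun)
    have "integrable \<mu> (indicator S :: 'k \<Rightarrow> real)"
      using bS by (intro integrable_real_indicator) (auto simp: sets_\<mu> less_top[symmetric])
    then have "(\<integral>x. 2 ^ (n * CARD('d)) * indicator S x \<partial>\<mu>) \<le> (\<integral>x. (\<Sum>k\<in>A. indicator S x * kern n (pt k - path n g w x)) \<partial>\<mu>)"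
      by (intro integral_mono integrable_mult_right Bochner_Integration.integrable_sum intk grid)
    also have "\<dots> = (\<Sum>k\<in>A. dens \<mu> n S (pt k) (path n g w))"
      unfolding dens_def by (intro Bochner_Integration.integral_sum intk)
    also have "\<dots> \<le> (\<Sum>k\<in>A. b)" by (intro sum_mono occA)
    also have "\<dots> = real (card A) * b" by simp
    also have "\<dots> \<le> (2 ^ n * W) ^ CARD('d) * b"
    proof (rule mult_right_mono[OF cardA])
      show "0 \<le> b" unfolding b_def using tail_pos[of q] kern_lip_pos[of q, where 'd='d] by simp
    qed
    also have "\<dots> = 2 ^ (n * CARD('d)) * (W ^ CARD('d) * b)" by (simp add: power_mult_distrib power_mult)
    finally have "2 ^ (n * CARD('d)) * measure \<mu> S \<le> 2 ^ (n * CARD('d)) * (W ^ CARD('d) * b)"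
      using bS by (simp add: space_\<mu>)
    then show ?thesis unfolding b_def by simp
  qed
  have est': "measure \<mu> S \<le> W ^ CARD('d) * (2 * tail q)"
    if q: "n0 \<le> q" "i \<le> q" "R + 2 * ?d \<le> real q" for q
  proof (rule LIMSEQ_le_const)
    have "(\<lambda>n. W ^ CARD('d) * (2 * tail q + kern_lip TYPE('d) q * ?M * (2 * ?d * (1/2) ^ n))) \<longlonglongrightarrow>
        W ^ CARD('d) * (2 * tail q + kern_lip TYPE('d) q * ?M * (2 * ?d * 0))"
      by (intro tendsto_intros LIMSEQ_power_zero) auto
    then show "(\<lambda>n. W ^ CARD('d) * (2 * tail q + kern_lip TYPE('d) q * ?M * (2 * ?d * (1/2) ^ n))) \<longlonglongrightarrow> W ^ CARD('d) * (2 * tail q)"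
      by simp
    show "\<exists>n1. \<forall>n\<ge>n1. measure \<mu> S \<le> W ^ CARD('d) * (2 * tail q + kern_lip TYPE('d) q * ?M * (2 * ?d * (1/2) ^ n))"
      using est[OF q] by blast
  qed
  have "measure \<mu> S \<le> 0"
  proof (rule LIMSEQ_le_const)
    have "(\<lambda>q. W ^ CARD('d) * (2 * tail q)) \<longlonglongrightarrow> W ^ CARD('d) * (2 * 0)"
      by (intro tendsto_intros tail_tendsto)
    then show "(\<lambda>q. W ^ CARD('d) * (2 * tail q)) \<longlonglongrightarrow> 0" by simp
    have "measure \<mu> S \<le> W ^ CARD('d) * (2 * tail q)" if "max n0 (max i (nat \<lceil>R + 2 * ?d\<rceil>)) \<le> q" for q
      using that real_nat_ceiling_ge[of "R + 2 * ?d"] by (intro est') linarith+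
    then show "\<exists>q0. \<forall>q\<ge>q0. measure \<mu> S \<le> W ^ CARD('d) * (2 * tail q)" by blast
  qed
  then show ?thesis using measure_nonneg[of \<mu> S] unfolding S_def by linarith
qed

end

section \<open>Transfer of the dimensions of mu to the fibres\<close>

lemma upper_box_dim_nonneg:
  fixes A :: "'a::metric_space set"
  assumes "compact (UNIV :: 'a set)" "A \<noteq> {}"
  shows "0 \<le> upper_box_dim A"
proof -
  have tb: "totally_bounded A" by (rule totally_bounded_if_compact_UNIV[OF assms(1)])
  have "1 \<le> real (covering_number \<delta> A)" if \<delta>: "0 < \<delta>" for \<delta>
  proof -
    obtain C where C: "finite C" "card C \<le> covering_number \<delta> A" "A \<subseteq> (\<Union>c\<in>C. cball c \<delta>)"
      using covering_number_cover[OF tb \<delta>] by blast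
    then have "C \<noteq> {}" using assms(2) by auto
    then have "0 < card C" using C(1) by (simp add: card_gt_0_iff)
    then show ?thesis using C(2) by linarith
  qed
  then have "ereal 0 \<le> upper_box_dim A"
    by (intro upper_box_dim_ge_frequently[OF assms(2), of 1]) auto
  then show ?thesis by (simp only: zero_ereal_def)
qed

lemma packing_dim_nonneg:
  fixes A :: "'a::metric_space set"
  assumes "compact (UNIV :: 'a set)" "A \<noteq> {}"
  shows "0 \<le> packing_dim A"
  unfolding packing_dim_def
proof (rule INF_greatest)
  fix G :: "nat \<Rightarrow> 'a set" assume "G \<in> {G. A = (\<Union>i. G i)}"
  then obtain i where "G i \<noteq> {}" using assms(2) by auto
  then have "0 \<le> upper_box_dim (G i)" by (rule upper_box_dim_nonneg[OF assms(1)])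
  also have "\<dots> \<le> (SUP i. upper_box_dim (G i))" by (rule SUP_upper) simp
  finally show "0 \<le> (SUP i. upper_box_dim (G i))" .
qed

lemma hausdorff_dim_nonneg: "A \<noteq> {} \<Longrightarrow> 0 \<le> hausdorff_dim A"
  by (auto simp: hausdorff_dim_def intro!: Inf_greatest)

text \<open>The local dimension argument handles positive exponents; the remaining range is covered
  because a nonempty fibre has nonnegative dimension.\<close>

lemma ereal_le_from_positive:
  assumes "0 \<le> b" "\<And>t. 0 < t \<Longrightarrow> ereal t < a \<Longrightarrow> ereal t \<le> b"
  shows "a \<le> b"
proof (rule dense_le)
  fix r assume r: "r < a"
  show "r \<le> b"
  proof (cases "r < 0")
    case True
    then show ?thesis using assms(1) by simp
  next
    case False
    obtain t where t: "r < ereal t" "ereal t < a" using ereal_dense2[OF r] by auto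
    have "0 < ereal t" using False t(1) by (intro order_le_less_trans[of 0 r]) (simp_all add: not_less)
    then have "ereal t \<le> b" using assms(2) t(2) by simp
    then show ?thesis using t(1) by (rule order_trans[OF less_imp_le, rotated])
  qed
qed

text \<open>The least \<open>n\<close> with \<open>k + 2 \<le> (n+1)^2\<close> is at most
  \<open>sqrt (k + 2)\<close>, so \<open>n * D\<close> is negligible against \<open>k\<close>, while
  radius \<open>2^-(k+2)\<close> is already tested at level \<open>n\<close>. The added 1 will halve
  the bound, leaving the other half for \<open>tail n\<close>.\<close>

lemma square_root_level:
  fixes b :: nat and s r D :: real
  assumes "0 < r"
  shows "\<exists>k0. \<forall>k\<ge>k0. \<exists>n\<ge>b. s \<le> real n \<and> k + 2 \<le> (n+1)^2 \<and> real n * D + 1 \<le> real k * r"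
proof -
  define B where "B = max b (nat \<lceil>s\<rceil>)"
  have "\<forall>\<^sub>F k in sequentially. \<bar>D\<bar> * sqrt (real k + 2) + 1 \<le> real k * r"
    using assms by real_asymp
  then obtain k1 where k1: "\<And>k. k \<ge> k1 \<Longrightarrow> \<bar>D\<bar> * sqrt (real k + 2) + 1 \<le> real k * r"
    by (auto simp: eventually_sequentially)
  have "\<exists>n\<ge>b. s \<le> real n \<and> k + 2 \<le> (n+1)^2 \<and> real n * D + 1 \<le> real k * r" if k: "k \<ge> max k1 ((B+1)^2)" for k
  proof -
    have "k + 2 \<le> (k + 2 + 1)^2" by (simp add: power2_eq_square)
    then have ex: "\<exists>n. k + 2 \<le> (n+1)^2" by blast
    define n where "n = (LEAST n. k + 2 \<le> (n+1)^2)"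
    have n1: "k + 2 \<le> (n+1)^2" unfolding n_def by (rule LeastI_ex[OF ex])
    have "n \<ge> B"
    proof (rule ccontr)
      assume "\<not> n \<ge> B"
      then have "(n+1)^2 \<le> (B+1)^2" by (intro power_mono) auto
      then show False using n1 k by linarith
    qed
    moreover have "real n \<le> sqrt (real k + 2)"
    proof (cases n)
      case 0
      then show ?thesis by simp
    next
      case (Suc j)
      then have "\<not> k + 2 \<le> (j+1)^2" using not_less_Least[of j "\<lambda>n. k + 2 \<le> (n+1)^2"] n_def by simp
      then have "n^2 \<le> k + 2" using Suc by simp
      then have "(real n)^2 \<le> real k + 2" by (metis of_nat_add of_nat_le_iff of_nat_numeral of_nat_power)
      then show ?thesis by (rule real_le_rsqrt)
    qed
    moreover have "real n * D \<le> \<bar>D\<bar> * sqrt (real k + 2)"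
    proof -
      have "real n * D \<le> real n * \<bar>D\<bar>" by (intro mult_left_mono) auto
      also have "\<dots> \<le> sqrt (real k + 2) * \<bar>D\<bar>" using \<open>real n \<le> sqrt (real k + 2)\<close> by (intro mult_right_mono) auto
      finally show ?thesis by (simp add: mult.commute)
    qed
    moreover have "b \<le> n" "s \<le> real n" using \<open>n \<ge> B\<close> real_nat_ceiling_ge[of s] unfolding B_def by linarith+
    ultimately show ?thesis using n1 k1[of k] k by (intro exI[of _ n]) auto
  qed
  then show ?thesis by blast
qed

context tame_point
begin

lemma ball_estimate:
  assumes s: "0 < s" "s < q"
  shows "\<exists>k0. \<forall>k\<ge>k0. \<forall>x\<in>low_ball \<mu> q k. \<forall>\<^sub>F p in sequentially.
    occ p (ball x ((1/2)^(k+2)) \<inter> core i) y g w \<le> 2 powr (-(real k * s))"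
proof -
  define b where "b = max n0 (max i (nat \<lceil>norm y\<rceil>))"
  have qs: "0 < q - s" using s by simp
  obtain k0 where k0: "\<And>k. k \<ge> k0 \<Longrightarrow> \<exists>n\<ge>b. s \<le> real n \<and> k + 2 \<le> (n+1)^2 \<and> real n * real CARD('d) + 1 \<le> real k * (q - s)"
    using square_root_level[OF qs, of b s "real CARD('d)"] by blast
  have "\<forall>\<^sub>F p in sequentially. occ p (ball x ((1/2)^(k+2)) \<inter> core i) y g w \<le> 2 powr (-(real k * s))"
    if k: "k \<ge> k0" and x: "x \<in> low_ball \<mu> q k" for k x
  proof -
    obtain n where n: "n \<ge> b" "s \<le> real n" "k + 2 \<le> (n+1)^2" "real n * real CARD('d) + 1 \<le> real k * (q - s)"
      using k0[OF k] by blast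
    have n': "n0 \<le> n" "i \<le> n" "norm y \<le> real n"
      using n(1) real_nat_ceiling_ge[of "norm y"] unfolding b_def by linarith+
    obtain z where z: "z \<in> Z (k+2)" "dist z x < (1/2)^(k+2)" using net_Z by blast
    \<comment> \<open>The tested ball about a net point contains the ball of radius
      \<open>2^-(k+2)\<close> about \<open>x\<close> and lies within distance
      \<open>3 * 2^-(k+2)\<close> of \<open>x\<close>, hence in the ball of radius
      \<open>2^-k\<close> controlled by \<open>low_ball\<close>.\<close>
    define D where "D = ball z (2 * (1/2)^(k+2))"
    have D: "D \<in> tests Z n" using z(1) n(3) unfolding tests_def D_def by blast
    have bD: "D \<inter> core i \<in> sets borel" by (rule borel_core[OF tests_borel[OF D]])
    have sub1: "ball x ((1/2)^(k+2)) \<subseteq> D"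
    proof
      fix v assume "v \<in> ball x ((1/2)^(k+2))"
      then show "v \<in> D" unfolding D_def mem_ball using z(2) dist_triangle[of z v x] by linarith
    qed
    have sub2: "D \<subseteq> ball x ((1/2)^k)"
    proof
      fix v assume "v \<in> D"
      then have "dist x v < 3 * (1/2)^(k+2)"
        unfolding D_def mem_ball using z(2) dist_triangle[of x v z] by (simp add: dist_commute)
      also have "\<dots> \<le> (1/2::real)^k" by (simp add: power_add power2_eq_square)
      finally show "v \<in> ball x ((1/2)^k)" by simp
    qed
    have "measure \<mu> (D \<inter> core i) \<le> measure \<mu> (ball x ((1/2)^k))"
      using sub2 by (intro finite_measure_mono) (auto simp: sets_\<mu>)
    also have "\<dots> \<le> 2 powr (-(real k * q))" using x by (simp add: low_ball_def)
    finally have mD: "measure \<mu> (D \<inter> core i) \<le> 2 powr (-(real k * q))" .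
    have "occ n (D \<inter> core i) y g w \<le> 2 ^ (n * CARD('d)) * measure \<mu> (D \<inter> core i)"
      by (intro dens_le bD continuous_on_apply_bcontfun)
    also have "\<dots> \<le> 2 ^ (n * CARD('d)) * 2 powr (-(real k * q))" using mD by (intro mult_left_mono) auto
    also have "\<dots> = 2 powr (real n * real CARD('d) - real k * q)"
      by (simp add: powr_realpow[symmetric] powr_add[symmetric])
    also have "\<dots> \<le> 2 powr (-(real k * s) - 1)"
      using n(4) by (intro powr_mono) (auto simp: algebra_simps)
    finally have occn: "occ n (D \<inter> core i) y g w \<le> 2 powr (-(real k * s) - 1)" .
    \<comment> \<open>From \<open>s \<le> n\<close> and \<open>k + 2 \<le> (n+1)^2\<close> follows
      \<open>k * s + 1 \<le> (n+1) * (k+2) \<le> (n+1)^3\<close>, the exponent in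
      \<open>tail\<close>.\<close>
    have "tail n \<le> 2 powr (-(real k * s) - 1)"
    proof -
      have "real k * s + 1 \<le> (real n + 1) * (real k + 2)"
      proof -
        have "s * real k \<le> real n * real k" using n(2) by (intro mult_right_mono) auto
        then show ?thesis by (simp add: algebra_simps)
      qed
      also have "\<dots> \<le> (real n + 1) * (real n + 1)^2"
      proof (rule mult_left_mono)
        have "real (k + 2) \<le> real ((n+1)^2)" using n(3) by (rule of_nat_mono)
        then show "real k + 2 \<le> (real n + 1)^2" by (simp add: add.commute)
      qed simp
      also have "\<dots> = real ((n+1)^3)" by (simp add: power3_eq_cube power2_eq_square algebra_simps)
      finally have "2 powr (- real ((n+1)^3)) \<le> (2::real) powr (-(real k * s) - 1)" by (intro powr_mono) auto
      moreover have "tail n = 2 powr (- real ((n+1)^3))"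
        unfolding tail_def by (simp only: powr_minus powr_realpow zero_less_numeral power_divide power_one inverse_eq_divide)
      ultimately show ?thesis by simp
    qed
    moreover have "2 powr (-(real k * s) - 1) + 2 powr (-(real k * s) - 1) = 2 powr (-(real k * s))"
      by (simp add: powr_diff)
    ultimately have tot: "occ n (D \<inter> core i) y g w + tail n \<le> 2 powr (-(real k * s))" using occn by linarith
    have "occ p (ball x ((1/2)^(k+2)) \<inter> core i) y g w \<le> 2 powr (-(real k * s))" if "n \<le> p" for p
    proof -
      have "occ p (ball x ((1/2)^(k+2)) \<inter> core i) y g w \<le> occ p (D \<inter> core i) y g w"
        using sub1 by (intro dens_mono bD borel_core continuous_on_apply_bcontfun) auto
      also have "\<dots> \<le> occ n (D \<inter> core i) y g w + tail n"
        using occ_stable[OF n'(1,2) D n'(3) that] by linarith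
      finally show ?thesis using tot by linarith
    qed
    then show ?thesis by (rule eventually_sequentiallyI)
  qed
  then show ?thesis by blast
qed

text \<open>On the compact set \<open>core i - V\<close> the map stays at a positive distance from
  \<open>y\<close>. Once this exceeds the width of the kernel plus the error of the partial sum,
  each at most \<open>CARD('d) * 2^-p\<close>, the integrand is identically zero.\<close>

lemma occ_concentrates:
  assumes V: "open V" "core i \<inter> apply_bcontfun (g + total w) -` {y} \<subseteq> V"
  shows "\<forall>\<^sub>F p in sequentially. occ p (- V \<inter> core i) y g w = 0"
proof (cases "- V \<inter> core i = {}")
  case True
  then show ?thesis by (simp add: dens_def)
next
  case ne: False
  let ?f = "apply_bcontfun (g + total w)" and ?d = "real CARD('d)"
  have "compact (- V \<inter> core i)" using compact_Int_closed[OF compact_core, of "- V"] V(1) by (simp add: Int_commute closed_Compl)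
  moreover have "continuous_on (- V \<inter> core i) (\<lambda>x. norm (?f x - y))"
    by (intro continuous_on_norm continuous_on_diff continuous_on_apply_bcontfun continuous_on_const)
  ultimately obtain x0 where x0: "x0 \<in> - V \<inter> core i" "\<And>x. x \<in> - V \<inter> core i \<Longrightarrow> norm (?f x0 - y) \<le> norm (?f x - y)"
    using continuous_attains_inf[OF _ ne] by blast
  have "?f x0 \<noteq> y" using x0(1) V(2) by blast
  then have pos: "2 * ?d * 0 < norm (?f x0 - y)" by simp
  have lim: "(\<lambda>p. 2 * ?d * (1/2) ^ p) \<longlonglongrightarrow> 2 * ?d * 0" by (intro tendsto_intros LIMSEQ_power_zero) auto
  have "\<forall>\<^sub>F p in sequentially. 2 * ?d * (1/2) ^ p < norm (?f x0 - y)"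
    using order_tendstoD(2)[OF lim pos] .
  then show ?thesis
  proof eventually_elim
    case (elim p)
    have "indicator (- V \<inter> core i) x * kern p (y - path p g w x) = 0" for x
    proof (cases "x \<in> - V \<inter> core i")
      case True
      have "norm (?f x - y) \<le> norm (?f x - path p g w x) + norm (path p g w x - y)"
        by (rule norm_diff_triangle_le[OF order_refl order_refl])
      then have "?d * (1/2) ^ p \<le> norm (y - path p g w x)"
        using x0(2)[OF True] elim total_approx[of g w x p] by (simp only: norm_minus_commute[of y])
      then show ?thesis by (simp only: kern_eq_0_norm mult_zero_right)
    qed simp
    then show ?case unfolding dens_def by (simp only: Bochner_Integration.integral_zero)
  qed
qed

text \<open>Approximation at level \<open>p\<close> to the local time of the map at
  \<open>y\<close>, restricted to \<open>core i\<close>; its total mass is the density at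
  \<open>y\<close>.\<close>

definition fibre_measure :: "nat \<Rightarrow> real ^ 'd \<Rightarrow> nat \<Rightarrow> 'k measure" where
  "fibre_measure i y p = density \<mu> (\<lambda>x. ennreal (indicator (core i) x * kern p (y - path p g w x)))"

lemma sets_fibre_measure: "sets (fibre_measure i y p) = sets borel"
  by (simp add: fibre_measure_def sets_\<mu>)

lemma emeasure_fibre_measure:
  assumes "B \<in> sets borel"
  shows "emeasure (fibre_measure i y p) B = ennreal (occ p (B \<inter> core i) y g w)"
proof -
  let ?h = "\<lambda>x. indicator (core i) x * kern p (y - path p g w x)"
  have bc: "core i \<in> sets borel" using closed_core by simp
  have m: "(\<lambda>x. ennreal (?h x)) \<in> borel_measurable \<mu>"
    using dens_integrable[OF bc continuous_on_apply_bcontfun, of p y "g + part p w"]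
    by (intro measurable_compose[OF _ measurable_ennreal]) (rule borel_measurable_integrable)
  have "emeasure (fibre_measure i y p) B = (\<integral>\<^sup>+x. ennreal (?h x) * indicator B x \<partial>\<mu>)"
    unfolding fibre_measure_def using assms by (intro emeasure_density m) (simp add: sets_\<mu>)
  also have "\<dots> = (\<integral>\<^sup>+x. ennreal (indicator (B \<inter> core i) x * kern p (y - path p g w x)) \<partial>\<mu>)"
    by (intro nn_integral_cong) (auto simp: indicator_def)
  also have "\<dots> = ennreal (occ p (B \<inter> core i) y g w)"
    unfolding dens_def
    by (intro nn_integral_eq_integral dens_integrable borel_core assms continuous_on_apply_bcontfun AE_I2
        mult_nonneg_nonneg kern_nonneg) auto
  finally show ?thesis .
qed

lemma measure_fibre_measure:
  "B \<in> sets borel \<Longrightarrow> measure (fibre_measure i y p) B = occ p (B \<inter> core i) y g w"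
  using emeasure_fibre_measure by (simp add: measure_def dens_nonneg)

lemma finite_fibre_measure: "finite_measure (fibre_measure i y p)"
proof
  have "space (fibre_measure i y p) = UNIV" by (simp add: fibre_measure_def space_\<mu>)
  then show "emeasure (fibre_measure i y p) (space (fibre_measure i y p)) \<noteq> \<infinity>"
    using emeasure_fibre_measure[of UNIV] by simp
qed

lemma fibre_dimensions:
  assumes y: "y \<in> hit g w i"
  shows "hausdorff_dim_measure \<mu> \<le> hausdorff_dim (apply_bcontfun (g + total w) -` {y})"
    and "packing_dim_measure \<mu> \<le> packing_dim (apply_bcontfun (g + total w) -` {y})"
proof -
  let ?A = "apply_bcontfun (g + total w) -` {y}"
  let ?lam = "fibre_measure i y"
  define F where "F = core i \<inter> ?A"
  have "closed ?A" by (intro closed_vimage continuous_on_apply_bcontfun) simp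
  then have cF: "compact F" unfolding F_def by (rule compact_Int_closed[OF compact_core])
  have FA: "F \<subseteq> ?A" by (simp add: F_def)
  obtain c where c: "0 < c" "\<forall>\<^sub>F p in sequentially. c \<le> occ p (core i) y g w" using y by (auto simp: hit_def)
  have mass: "\<forall>\<^sub>F p in sequentially. c \<le> measure (?lam p) UNIV"
    using c(2) measure_fibre_measure[of UNIV i y] by simp
  have conc: "\<forall>\<^sub>F p in sequentially. measure (?lam p) (- V) = 0" if "open V" "F \<subseteq> V" for V
  proof -
    have "- V \<in> sets borel" using that(1) by simp
    then show ?thesis using occ_concentrates[OF that(1), of i y] that(2) by (simp only: F_def measure_fibre_measure)
  qed
  have small: "\<exists>k0. \<forall>k\<ge>k0. \<forall>x\<in>low_ball \<mu> q k. decays ?lam s k x" if "0 < s" "s < q" for s q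
    using ball_estimate[OF that, of i y] by (simp only: measure_fibre_measure borel_open open_ball)
  \<comment> \<open>The empty set has dimension -1, so nonemptiness must be shown: otherwise the
    measures would concentrate on the empty set and lose their mass.\<close>
  have ne: "?A \<noteq> {}"
  proof
    assume "?A = {}"
    then have "\<forall>\<^sub>F p in sequentially. measure (?lam p) (- {}) = 0" by (intro conc) (auto simp: F_def)
    then have "\<forall>\<^sub>F p in sequentially. measure (?lam p) UNIV = 0" by simp
    with mass have "\<forall>\<^sub>F p in sequentially. False" by eventually_elim (use c(1) in linarith)
    then show False by simp
  qed
  show "hausdorff_dim_measure \<mu> \<le> hausdorff_dim ?A"
  proof (rule ereal_le_from_positive[OF hausdorff_dim_nonneg[OF ne]])
    fix t assume t: "0 < t" "ereal t < hausdorff_dim_measure \<mu>"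
    obtain k1 where k1: "\<And>k. k \<ge> k1 \<Longrightarrow> G i \<subseteq> low_ball \<mu> t k" using G_hausdorff[OF t] by blast
    show "ereal t \<le> hausdorff_dim ?A"
    proof (rule hausdorff_dim_ge_concentrating[OF cF FA finite_fibre_measure sets_fibre_measure conc c(1) mass])
      fix s assume "0 < s" "s < t"
      then obtain k0 where k0: "\<And>k x. k \<ge> k0 \<Longrightarrow> x \<in> low_ball \<mu> t k \<Longrightarrow> decays ?lam s k x"
        using small[of s t] by blast
      have "F \<subseteq> low_ball \<mu> t k" if "k \<ge> k1" for k using k1[OF that] by (auto simp: F_def core_def)
      then show "\<exists>k0. \<forall>k\<ge>k0. \<forall>x\<in>F. decays ?lam s k x"
        using k0 by (intro exI[of _ "max k0 k1"]) (auto simp: subset_iff)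
    qed
  qed
  show "packing_dim_measure \<mu> \<le> packing_dim ?A"
  proof (rule ereal_le_from_positive[OF packing_dim_nonneg[OF compact_K ne]])
    fix t assume t: "0 < t" "ereal t < packing_dim_measure \<mu>"
    show "ereal t \<le> packing_dim ?A"
    proof (rule packing_dim_ge_concentrating[OF cF FA finite_fibre_measure sets_fibre_measure conc c(1) mass])
      show "low_ball \<mu> t k \<in> sets borel" for k
        using closed_low_ball[OF finite_measure_axioms sets_\<mu>] by simp
      fix b
      obtain J where J: "finite J" "J \<subseteq> {b..}" "G i \<subseteq> (\<Union>k\<in>J. low_ball \<mu> t k)" using G_packing[OF t, of b i] by blast
      have cl: "closed (\<Union>k\<in>J. low_ball \<mu> t k)"
        using closed_low_ball[OF finite_measure_axioms sets_\<mu>] J(1) by (intro closed_UN) auto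
      have "core i \<subseteq> (\<Union>k\<in>J. low_ball \<mu> t k)" using J(3) unfolding core_def by (rule le_infI1)
      then have "- (\<Union>k\<in>J. low_ball \<mu> t k) \<inter> core i = {}" by blast
      then have "measure (?lam p) (- (\<Union>k\<in>J. low_ball \<mu> t k)) = 0" for p
        using measure_fibre_measure[of "- (\<Union>k\<in>J. low_ball \<mu> t k)" i y p] cl
        by (simp add: dens_def del: Compl_UN)
      then show "\<exists>J. finite J \<and> J \<subseteq> {b..} \<and> (\<forall>p. measure (?lam p) (- (\<Union>k\<in>J. low_ball \<mu> t k)) = 0)"
        using J(1,2) by (intro exI[of _ J] conjI allI)
    next
      fix s assume "0 < s" "s < t"
      then show "\<exists>k0. \<forall>k\<ge>k0. \<forall>x\<in>low_ball \<mu> t k. decays ?lam s k x"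
        by (rule small)
    qed (auto intro: t(1))
  qed
qed

end

context tested_cells
begin

lemma good_fibres:
  assumes "f \<in> good"
  shows "\<exists>U :: (real ^ 'd) set. open U \<and>
    emeasure \<mu> (apply_bcontfun f -` U) = emeasure \<mu> (space \<mu>) \<and>
    (\<forall>y\<in>U. hausdorff_dim (apply_bcontfun f -` {y}) \<ge> hausdorff_dim_measure \<mu> \<and>
            packing_dim (apply_bcontfun f -` {y}) \<ge> packing_dim_measure \<mu>)"
proof -
  obtain n0 w where w: "\<And>n. n \<ge> n0 \<Longrightarrow> tame n (f - total w) w" using assms by (auto simp: good_def)
  define g where "g = f - total w"
  have f: "f = g + total w" by (simp add: g_def)
  interpret tame_point \<mu> N \<phi> G Z Y m g w n0
    by unfold_locales (use w in \<open>simp add: g_def\<close>)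
  \<comment> \<open>For each \<open>i\<close>, almost all of \<open>core i\<close> is mapped into
    \<open>hit g w i\<close>, so the complement of the preimage of the union has mass at most that
    of \<open>- core i\<close>, for every \<open>i\<close>.\<close>
  define U where "U = (\<Union>i. hit g w i)"
  have oU: "open U" unfolding U_def using open_hit by auto
  have oV: "open (apply_bcontfun f -` U)" by (intro open_vimage oU continuous_on_apply_bcontfun)
  have small: "measure \<mu> (- (apply_bcontfun f -` U)) \<le> 3 * (1/2) ^ i" for i
  proof -
    have oi: "open (apply_bcontfun f -` hit g w i)" by (intro open_vimage open_hit continuous_on_apply_bcontfun)
    have "measure \<mu> (- (apply_bcontfun f -` U)) \<le> measure \<mu> (- core i \<union> (core i - apply_bcontfun f -` hit g w i))"
      using closed_core oi by (intro finite_measure_mono) (auto simp: U_def sets_\<mu>)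
    also have "\<dots> \<le> measure \<mu> (- core i) + measure \<mu> (core i - apply_bcontfun f -` hit g w i)"
      using closed_core oi by (intro measure_subadditive) (auto simp: sets_\<mu>)
    also have "\<dots> = measure \<mu> (- core i)" using null_off_hit[of i] by (simp add: f)
    also have "\<dots> \<le> 3 * (1/2) ^ i" by (rule measure_core)
    finally show ?thesis .
  qed
  have "measure \<mu> (- (apply_bcontfun f -` U)) \<le> 0"
  proof (rule LIMSEQ_le_const)
    have "(\<lambda>i. 3 * (1/2::real) ^ i) \<longlonglongrightarrow> 3 * 0" by (intro tendsto_intros LIMSEQ_power_zero) auto
    then show "(\<lambda>i. 3 * (1/2::real) ^ i) \<longlonglongrightarrow> 0" by simp
  qed (use small in blast)
  then have "measure \<mu> (- (apply_bcontfun f -` U)) = 0" using measure_nonneg by (rule antisym)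
  moreover have "- (apply_bcontfun f -` U) = space \<mu> - apply_bcontfun f -` U" using space_\<mu> by auto
  ultimately have "measure \<mu> (apply_bcontfun f -` U) = measure \<mu> (space \<mu>)"
    using finite_measure_compl[of "apply_bcontfun f -` U"] oV by (simp add: sets_\<mu>)
  then have "emeasure \<mu> (apply_bcontfun f -` U) = emeasure \<mu> (space \<mu>)" by (simp add: emeasure_eq_measure)
  then show ?thesis using oU fibre_dimensions by (intro exI[of _ U]) (auto simp: U_def f)
qed

end

theorem theorem4p14:
  fixes \<mu> :: "'k::metric_space measure"
  assumes "compact (UNIV :: 'k set)"
    and "non_exploding (UNIV :: 'k set)"
    and "continuous_mass_distribution \<mu>"
  shows "prevalent {f :: 'k \<Rightarrow>\<^sub>C (real ^ 'd).
           \<exists>U :: (real ^ 'd) set. open U \<and>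
             emeasure \<mu> (apply_bcontfun f -` U) = emeasure \<mu> (space \<mu>) \<and>
             (\<forall>y\<in>U. hausdorff_dim (apply_bcontfun f -` {y}) \<ge> hausdorff_dim_measure \<mu> \<and>
                     packing_dim (apply_bcontfun f -` {y}) \<ge> packing_dim_measure \<mu>)}"
proof -
  have sets: "sets \<mu> = sets borel" and atom: "\<And>x. emeasure \<mu> {x} = 0" and "emeasure \<mu> (space \<mu>) < \<infinity>"
    using assms(3) by (auto simp: continuous_mass_distribution_def mass_distribution_def)
  then interpret finite_measure \<mu> by (intro finite_measureI) simp
  note fin = finite_measure_axioms
  let ?M = "measure \<mu> UNIV"
  have "\<forall>k. \<exists>Z. finite Z \<and> (\<forall>x::'k. \<exists>z\<in>Z. dist z x < (1/2) ^ k)"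
  proof
    fix k
    have "\<exists>Z. finite Z \<and> (UNIV :: 'k set) \<subseteq> (\<Union>z\<in>Z. ball z ((1/2) ^ k))"
      using assms(1) unfolding compact_eq_totally_bounded by simp
    then show "\<exists>Z. finite Z \<and> (\<forall>x::'k. \<exists>z\<in>Z. dist z x < (1/2) ^ k)" by (auto simp: subset_iff)
  qed
  then obtain Z where Z: "\<And>k. finite (Z k)" "\<And>k (x::'k). \<exists>z\<in>Z k. dist z x < (1/2) ^ k" by metis
  let ?L = "\<lambda>n. (kern_lip TYPE('d) n + kern_lip TYPE('d) (Suc n)) * ?M"
  have "\<forall>n. \<exists>Y. finite Y \<and> (\<forall>y :: real ^ 'd. norm y \<le> real n \<longrightarrow> (\<exists>z\<in>Y. ?L n * norm (y - z) \<le> incr n))"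
  proof
    fix n
    have L: "0 \<le> ?L n" using kern_lip_pos[of n, where 'd='d] kern_lip_pos[of "Suc n", where 'd='d] by simp
    define \<delta> where "\<delta> = incr n / (?L n + 1)"
    have \<delta>: "0 < \<delta>" using L incr_pos[of n] by (simp add: \<delta>_def)
    have "compact (cball (0 :: real ^ 'd) (real n))" by simp
    then obtain Y where Y: "finite Y" "cball (0 :: real ^ 'd) (real n) \<subseteq> (\<Union>z\<in>Y. ball z \<delta>)"
      using \<delta> unfolding compact_eq_totally_bounded by blast
    have "\<exists>z\<in>Y. ?L n * norm (y - z) \<le> incr n" if y: "norm y \<le> real n" for y :: "real ^ 'd"
    proof -
      obtain z where z: "z \<in> Y" "norm (y - z) < \<delta>"
      proof -
        have "y \<in> (\<Union>z\<in>Y. ball z \<delta>)" using Y(2) y by (auto simp del: mem_ball)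
        then show thesis using that by (auto simp: dist_norm norm_minus_commute)
      qed
      have "?L n * norm (y - z) \<le> ?L n * \<delta>" using L z(2) by (intro mult_left_mono) auto
      also have "\<dots> \<le> (?L n + 1) * \<delta>" using \<delta> by (intro mult_right_mono) auto
      also have "\<dots> = incr n" using L by (simp add: \<delta>_def)
      finally show ?thesis using z(1) by blast
    qed
    then show "\<exists>Y. finite Y \<and> (\<forall>y :: real ^ 'd. norm y \<le> real n \<longrightarrow> (\<exists>z\<in>Y. ?L n * norm (y - z) \<le> incr n))"
      using Y(1) by blast
  qed
  then obtain Y :: "nat \<Rightarrow> (real ^ 'd) set" where Y: "\<And>n. finite (Y n)"
    "\<And>n y. norm y \<le> real n \<Longrightarrow> \<exists>z\<in>Y n. ?L n * norm (y - z) \<le> incr n" by metis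
  let ?G = "\<lambda>i G. closed G \<and> measure \<mu> (- G) \<le> (1/2) ^ i \<and>
    (\<forall>q>0. ereal q < hausdorff_dim_measure \<mu> \<longrightarrow> (\<exists>k0. \<forall>k\<ge>k0. G \<subseteq> low_ball \<mu> q k)) \<and>
    (\<forall>q>0. ereal q < packing_dim_measure \<mu> \<longrightarrow>
       (\<forall>b. \<exists>J. finite J \<and> J \<subseteq> {b..} \<and> G \<subseteq> (\<Union>k\<in>J. low_ball \<mu> q k)))"
  have "\<forall>i. \<exists>G. ?G i G"
    by (intro allI regular_closed_set[OF assms(1) fin sets]) simp
  from choice[OF this] obtain G where G: "\<forall>i. ?G i (G i)" ..
  let ?c = "\<lambda>n. real (card (tests Z n \<times> {..n} \<times> Y n))" and ?K = "\<lambda>n. (2 ^ (Suc n * CARD('d)))\<^sup>2 :: real"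
  \<comment> \<open>Solved from the requirement that the union bound at level \<open>n\<close> be at
    most \<open>(1/2) ^ n\<close>; the added 1s keep the denominator positive.\<close>
  define m where "m n = (1/2) ^ n * (incr n)\<^sup>2 / ((?c n + 1) * (?K n * (?M + 1)))" for n
  have m: "0 < m n" "?c n * (?K n * m n * ?M / (incr n)\<^sup>2) \<le> (1/2) ^ n" for n
  proof -
    have p: "0 < ?c n + 1" "0 < ?K n" "0 < ?M + 1" "0 < (incr n)\<^sup>2"
      using incr_pos[of n] by (auto intro: add_nonneg_pos)
    then show "0 < m n" unfolding m_def by (intro divide_pos_pos mult_pos_pos) auto
    have "?c n * (?K n * m n * ?M / (incr n)\<^sup>2) = (1/2) ^ n * (?c n / (?c n + 1)) * (?M / (?M + 1))"
      unfolding m_def using p by (simp add: divide_simps del: power_Suc)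
    also have "\<dots> \<le> (1/2) ^ n * 1 * 1"
      using p by (intro mult_mono) auto
    finally show "?c n * (?K n * m n * ?M / (incr n)\<^sup>2) \<le> (1/2) ^ n" by simp
  qed
  let ?P = "\<lambda>l (p :: nat \<times> (nat \<Rightarrow> 'k \<Rightarrow> real)). (\<forall>j. continuous_on UNIV (snd p j)) \<and> (\<forall>j x. 0 \<le> snd p j x) \<and>
    (\<forall>x. (\<Sum>j<fst p. snd p j x) \<le> 1) \<and> (\<forall>j. measure \<mu> {x. snd p j x = 1} \<le> m l) \<and>
    measure \<mu> {x. \<forall>j<fst p. snd p j x \<noteq> (1::real)} \<le> (1/2) ^ l"
  have "\<forall>l. \<exists>p. ?P l p"
  proof
    fix l
    have "0 < (1/2::real) ^ l" by simp
    from partition_into_small_cells[OF assms(1) fin sets atom m(1)[of l] this]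
    obtain N' and \<phi>' :: "nat \<Rightarrow> 'k \<Rightarrow> real" where "?P l (N', \<phi>')"
      unfolding fst_conv snd_conv by (elim exE)
    then show "\<exists>p. ?P l p" by (rule exI)
  qed
  from choice[OF this] obtain p :: "nat \<Rightarrow> nat \<times> (nat \<Rightarrow> 'k \<Rightarrow> real)" where p: "\<forall>l. ?P l (p l)" ..
  interpret tested_cells \<mu> "\<lambda>l. fst (p l)" "\<lambda>l. snd (p l)" G Z Y m
  proof
    show "compact (UNIV :: 'k set)" by (rule assms(1))
    fix i q b assume "0 < q" "ereal q < packing_dim_measure \<mu>"
    then show "\<exists>J. finite J \<and> J \<subseteq> {b..} \<and> G i \<subseteq> (\<Union>k\<in>J. low_ball \<mu> q k)" using G by simp
  qed (use sets p G Z Y m in simp_all)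
  show ?thesis using good_fibres by (intro prevalent_superset_good) blast
qed

end
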